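(* Let $\Lambda$ be a locally compact Polish space equipped with a positive Radon measure $\mu$ on its Borel $\sigma$-algebra. Consider a sequence $(\chi_n)_n$ of determinantal point processes on $\Lambda$ with good kernels $K_n$. Let $(D_n)_n$ be a sequence of measurable subsets of $\Lambda$ such that (the integral operator with kernel) $(K_n)_{D_n}$ is trace-class, and let $\eta_k^n$, $k\ge1$, denote the eigenvalues of $(K_n)_{D_n}$. Assume that $(a_n)_n$ is a sequence of real numbers such that $$1 \ll a_n \ll \Bigl(\sum_{k} \eta_k^n(1-\eta_k^n)\Bigr)^{1/2}.$$ Then $(Z_n)_n$ with $$Z_n := \frac{1}{a_n}\,\frac{\chi_n(D_n) - \mathbb{E}(\chi_n(D_n))}{\sqrt{\mathbb{V}(\chi_n(D_n))}}$$ satisfies a moderate deviation principle (MDP) with speed $a_n^2$ and rate function $I(x)=\frac{x^2}{2}$.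
   Context: Point processes: a point process on $\Lambda$ is a random integer-valued positive $\sigma$-finite Radon measure $\chi$ on $\Lambda$; it is simple if $P(\exists x\in\Lambda:\chi(\{x\})>1)=0$. For a simple point process, locally integrable functions $\varrho_k:\Lambda^k\to[0,\infty)$ are its joint intensities if for all mutually disjoint measurable $D_1,\dots,D_k\subset\Lambda$, $\mathbb{E}\bigl(\prod_{i=1}^k\chi(D_i)\bigr)=\int_{\prod_i D_i}\varrho_k(x_1,\dots,x_k)\,d\mu(x_1)\cdots d\mu(x_k)$. A simple point process is determinantal with kernel $K$ if its joint intensities exist and $\varrho_k(x_1,\dots,x_k)=\det(K(x_i,x_j))_{i,j=1,\dots,k}$ for all $k$. Kernels: an integral operator $\mathcal{K}f(x)=\int K(x,y)f(y)\,d\mu(y)$ on $L^2(\mu)$ is admissible (with admissible kernel $K$) if it is self-adjoint, nonnegative and locally trace-class. A compact such operator has a decomposition $K(x,y)=\sum_k\eta_k\phi_k(x)\phi_k^*(y)$ (equality in $L^2(\mu\times\mu)$, finite or infinite sum) with $\phi_k$ orthonormal in $L^2(\mu)$ and $\eta_k>0$. An admissible operator, and its kernel, is good if all $\eta_k\in(0,1]$. For $D\subset\Lambda$, $K_D(x,y)=1_D(x)K(x,y)1_D(y)$. $\mathbb{E}$ and $\mathbb{V}$ denote expectation and variance. $a_n\ll b_n$ means $\lim_{n\to\infty} a_n/b_n=0$. MDP: a sequence of real random variables $(Z_n)_n$ satisfies the MDP (formally, a large deviation principle) with speed $s_n\to\infty$ and (good) rate function $I:\mathbb{R}\to[0,\infty)$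 if the level sets $\{x: I(x)\le M\}$, $0\le M<\infty$, are compact, $\limsup_{n\to\infty} s_n^{-1}\log P(Z_n\in F)\le -\inf_{x\in F} I(x)$ for all closed $F\subset\mathbb{R}$, and $\liminf_{n\to\infty} s_n^{-1}\log P(Z_n\in O)\ge -\inf_{x\in O} I(x)$ for all open $O\subset\mathbb{R}$.
   Formalization: The operator fixes its kernel K only almost everywhere, leaving K(x,x) undetermined; the kernels are additionally assumed to satisfy the usual convention that the integral of K(x,x) over each compact D equals the trace of K_D, without which the number of points in D_n may be infinite. *)

theory Defs
  imports "HOL-Probability.Probability" "Jordan_Normal_Form.Determinant"
begin

section \<open>Radon measures and point processes\<close>

definition radon_measure :: "'a::topological_space measure \<Rightarrow> bool" where
  "radon_measure \<mu> \<longleftrightarrow>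
     sets \<mu> = sets borel \<and>
     (\<forall>C. compact C \<longrightarrow> emeasure \<mu> C < \<infinity>) \<and>
     (\<forall>A\<in>sets borel. emeasure \<mu> A = (SUP C\<in>{C. compact C \<and> C \<subseteq> A}. emeasure \<mu> C))"

text \<open>A random measure is a map into measures all of whose evaluations at Borel sets are
  random variables; \<open>P\<close> is the underlying probability space.\<close>

definition point_process :: "'w measure \<Rightarrow> ('w \<Rightarrow> 'a::topological_space measure) \<Rightarrow> bool" where
  "point_process P X \<longleftrightarrow>
     prob_space P \<and>
     (\<forall>\<omega>\<in>space P. radon_measure (X \<omega>) \<and> sigma_finite_measure (X \<omega>) \<and>
        (\<forall>A\<in>sets borel. emeasure (X \<omega>) A \<in> insert \<infinity> \<nat>)) \<and>
     (\<forall>A\<in>sets borel. (\<lambda>\<omega>. emeasure (X \<omega>) A) \<in> borel_measurable P)"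

text \<open>The real-valued number of points \<open>X(D)\<close>; the HOL convention \<open>measure M D = 0\<close> if
  \<open>emeasure M D = \<infinity>\<close> is irrelevant where \<open>X(D)\<close> is almost surely finite.\<close>

definition num_points :: "('w \<Rightarrow> 'a measure) \<Rightarrow> 'a set \<Rightarrow> 'w \<Rightarrow> real" where
  "num_points X D = (\<lambda>\<omega>. measure (X \<omega>) D)"

definition simple_point_process :: "'w measure \<Rightarrow> ('w \<Rightarrow> 'a::topological_space measure) \<Rightarrow> bool" where
  "simple_point_process P X \<longleftrightarrow>
     point_process P X \<and> (AE \<omega> in P. \<not> (\<exists>x. emeasure (X \<omega>) {x} > 1))"

text \<open>The power \<open>\<Lambda>^k\<close> is modelled by the extensional functions on \<open>{..<k}\<close>. Every compact subset
  of it is contained in \<open>C^k\<close> for some compact \<open>C\<close>, so local integrability is tested on such sets.\<close>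

definition joint_intensities ::
  "'w measure \<Rightarrow> ('w \<Rightarrow> 'a::topological_space measure) \<Rightarrow> 'a measure \<Rightarrow>
   (nat \<Rightarrow> (nat \<Rightarrow> 'a) \<Rightarrow> real) \<Rightarrow> bool" where
  "joint_intensities P X \<mu> \<rho> \<longleftrightarrow>
     (\<forall>k\<ge>1.
        \<rho> k \<in> borel_measurable (\<Pi>\<^sub>M i\<in>{..<k}. \<mu>) \<and>
        (\<forall>x. 0 \<le> \<rho> k x) \<and>
        (\<forall>C. compact C \<longrightarrow>
           (\<integral>\<^sup>+ x\<in>({..<k} \<rightarrow>\<^sub>E C). ennreal (\<rho> k x) \<partial>(\<Pi>\<^sub>M i\<in>{..<k}. \<mu>)) < \<infinity>) \<and>
        (\<forall>E. (\<forall>i<k. E i \<in> sets borel) \<and> disjoint_family_on E {..<k} \<longrightarrow>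
           (\<integral>\<^sup>+ \<omega>. (\<Prod>i<k. emeasure (X \<omega>) (E i)) \<partial>P) =
           (\<integral>\<^sup>+ x\<in>(\<Pi>\<^sub>E i\<in>{..<k}. E i). ennreal (\<rho> k x) \<partial>(\<Pi>\<^sub>M i\<in>{..<k}. \<mu>))))"

text \<open>Joint intensities are densities, hence unique only up to null sets; accordingly the
  determinantal formula is required almost everywhere.\<close>

definition determinantal_process ::
  "'w measure \<Rightarrow> ('w \<Rightarrow> 'a::topological_space measure) \<Rightarrow> 'a measure \<Rightarrow>
   ('a \<Rightarrow> 'a \<Rightarrow> complex) \<Rightarrow> bool" where
  "determinantal_process P X \<mu> K \<longleftrightarrow>
     simple_point_process P X \<and>
     (\<exists>\<rho>. joint_intensities P X \<mu> \<rho> \<and>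
        (\<forall>k\<ge>1. AE x in (\<Pi>\<^sub>M i\<in>{..<k}. \<mu>).
           complex_of_real (\<rho> k x) = Determinant.det (Matrix.mat k k (\<lambda>(i, j). K (x i) (x j)))))"


section \<open>Integral operators\<close>

definition L2 :: "'a measure \<Rightarrow> ('a \<Rightarrow> complex) set" where
  "L2 \<mu> = {f. f \<in> borel_measurable \<mu> \<and> integrable \<mu> (\<lambda>x. (cmod (f x))\<^sup>2)}"

definition L2_inner :: "'a measure \<Rightarrow> ('a \<Rightarrow> complex) \<Rightarrow> ('a \<Rightarrow> complex) \<Rightarrow> complex" where
  "L2_inner \<mu> f g = (LINT x|\<mu>. f x * cnj (g x))"

definition int_op :: "'a measure \<Rightarrow> ('a \<Rightarrow> 'a \<Rightarrow> complex) \<Rightarrow> ('a \<Rightarrow> complex) \<Rightarrow> 'a \<Rightarrow> complex" where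
  "int_op \<mu> K f = (\<lambda>x. LINT y|\<mu>. K x y * f y)"

text \<open>The kernel defines an operator from \<open>L\<^sup>2\<close> to \<open>L\<^sup>2\<close>. If that operator is self-adjoint, it is
  automatically bounded by the Hellinger--Toeplitz theorem.\<close>

definition L2_operator :: "'a measure \<Rightarrow> ('a \<Rightarrow> 'a \<Rightarrow> complex) \<Rightarrow> bool" where
  "L2_operator \<mu> K \<longleftrightarrow>
     (\<lambda>(x, y). K x y) \<in> borel_measurable (\<mu> \<Otimes>\<^sub>M \<mu>) \<and>
     (\<forall>f\<in>L2 \<mu>. (AE x in \<mu>. integrable \<mu> (\<lambda>y. K x y * f y)) \<and> int_op \<mu> K f \<in> L2 \<mu>)"

definition self_adjoint_kernel :: "'a measure \<Rightarrow> ('a \<Rightarrow> 'a \<Rightarrow> complex) \<Rightarrow> bool" where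
  "self_adjoint_kernel \<mu> K \<longleftrightarrow>
     (\<forall>f\<in>L2 \<mu>. \<forall>g\<in>L2 \<mu>. L2_inner \<mu> (int_op \<mu> K f) g = L2_inner \<mu> f (int_op \<mu> K g))"

definition nonnegative_kernel :: "'a measure \<Rightarrow> ('a \<Rightarrow> 'a \<Rightarrow> complex) \<Rightarrow> bool" where
  "nonnegative_kernel \<mu> K \<longleftrightarrow>
     (\<forall>f\<in>L2 \<mu>. L2_inner \<mu> (int_op \<mu> K f) f \<in> \<real> \<and> 0 \<le> Re (L2_inner \<mu> (int_op \<mu> K f) f))"

definition cut_kernel :: "'a set \<Rightarrow> ('a \<Rightarrow> 'a \<Rightarrow> complex) \<Rightarrow> 'a \<Rightarrow> 'a \<Rightarrow> complex" where
  "cut_kernel D K = (\<lambda>x y. indicator D x * K x y * indicator D y)"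

text \<open>The decomposition \<open>K(x,y) = \<Sum>k\<in>J. \<eta> k * \<phi> k x * cnj (\<phi> k y)\<close> with equality in
  \<open>L\<^sup>2(\<mu> \<times> \<mu>)\<close>. The index set \<open>J\<close> may be finite (even empty) or infinite; \<open>(\<eta> k)\<close>, \<open>k \<in> J\<close>, lists
  the nonzero eigenvalues of the operator with multiplicity.\<close>

definition eigen_decomposition ::
  "'a measure \<Rightarrow> ('a \<Rightarrow> 'a \<Rightarrow> complex) \<Rightarrow> nat set \<Rightarrow> (nat \<Rightarrow> real) \<Rightarrow> (nat \<Rightarrow> 'a \<Rightarrow> complex) \<Rightarrow> bool" where
  "eigen_decomposition \<mu> K J \<eta> \<phi> \<longleftrightarrow>
     (\<lambda>(x, y). K x y) \<in> borel_measurable (\<mu> \<Otimes>\<^sub>M \<mu>) \<and>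
     (\<forall>k\<in>J. \<eta> k > 0 \<and> \<phi> k \<in> L2 \<mu>) \<and>
     (\<forall>j\<in>J. \<forall>k\<in>J. L2_inner \<mu> (\<phi> j) (\<phi> k) = (if j = k then 1 else 0)) \<and>
     (\<lambda>N. \<integral>\<^sup>+ (x, y). ennreal ((cmod (K x y -
              (\<Sum>k\<in>J \<inter> {..<N}. complex_of_real (\<eta> k) * \<phi> k x * cnj (\<phi> k y))))\<^sup>2) \<partial>(\<mu> \<Otimes>\<^sub>M \<mu>))
       \<longlonglongrightarrow> 0"

text \<open>Used for self-adjoint nonnegative operators only, for which the singular values are the
  eigenvalues.\<close>

definition trace_class :: "'a measure \<Rightarrow> ('a \<Rightarrow> 'a \<Rightarrow> complex) \<Rightarrow> bool" where
  "trace_class \<mu> K \<longleftrightarrow> (\<exists>J \<eta> \<phi>. eigen_decomposition \<mu> K J \<eta> \<phi> \<and> \<eta> summable_on J)"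

definition locally_trace_class :: "'a::topological_space measure \<Rightarrow> ('a \<Rightarrow> 'a \<Rightarrow> complex) \<Rightarrow> bool" where
  "locally_trace_class \<mu> K \<longleftrightarrow> (\<forall>D. compact D \<longrightarrow> trace_class \<mu> (cut_kernel D K))"

text \<open>The operator determines its kernel only \<open>\<mu> \<times> \<mu>\<close>-almost everywhere, so it does not see the
  diagonal values \<open>K x x\<close>, whereas determinantal intensities depend on them. The usual convention
  is that the version of the kernel is chosen such that the trace of \<open>K\<^sub>D\<close> is the integral
  of \<open>K x x\<close> over \<open>D\<close>, for every compact \<open>D\<close>. (Without it, e.g. adding \<open>g x \<ge> 0\<close> to \<open>K x x\<close> for
  diffuse \<open>\<mu>\<close> amounts to superposing an independent Poisson process of intensity \<open>g\<close>, while all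
  operators and eigenvalues stay the same.)\<close>

definition trace_formula :: "'a::topological_space measure \<Rightarrow> ('a \<Rightarrow> 'a \<Rightarrow> complex) \<Rightarrow> bool" where
  "trace_formula \<mu> K \<longleftrightarrow>
     (\<forall>D J \<eta> \<phi>. compact D \<and> eigen_decomposition \<mu> (cut_kernel D K) J \<eta> \<phi> \<longrightarrow>
        set_integrable \<mu> D (\<lambda>x. K x x) \<and>
        (LINT x:D|\<mu>. K x x) = complex_of_real (\<Sum>\<^sub>\<infinity>k\<in>J. \<eta> k))"

definition admissible_kernel :: "'a::topological_space measure \<Rightarrow> ('a \<Rightarrow> 'a \<Rightarrow> complex) \<Rightarrow> bool" where
  "admissible_kernel \<mu> K \<longleftrightarrow>
     L2_operator \<mu> K \<and> self_adjoint_kernel \<mu> K \<and> nonnegative_kernel \<mu> K \<and>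
     locally_trace_class \<mu> K \<and> trace_formula \<mu> K"

text \<open>An admissible operator need not be compact (e.g. the sine kernel on the line), but its
  restrictions to compact sets are; the eigenvalue condition is imposed on these. For a compact
  operator this is equivalent to the condition on its own eigenvalues.\<close>

definition good_kernel :: "'a::topological_space measure \<Rightarrow> ('a \<Rightarrow> 'a \<Rightarrow> complex) \<Rightarrow> bool" where
  "good_kernel \<mu> K \<longleftrightarrow>
     admissible_kernel \<mu> K \<and>
     (\<forall>D J \<eta> \<phi>. compact D \<and> eigen_decomposition \<mu> (cut_kernel D K) J \<eta> \<phi> \<longrightarrow>
        (\<forall>k\<in>J. \<eta> k \<in> {0<..1}))"


section \<open>Moderate deviations\<close>

text \<open>The quotient must be meaningful: since \<open>x / 0 = 0\<close> in HOL, the limit alone would also hold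
  for a vanishing denominator.\<close>

definition much_less :: "(nat \<Rightarrow> real) \<Rightarrow> (nat \<Rightarrow> real) \<Rightarrow> bool" (infix "\<lless>" 50) where
  "a \<lless> b \<longleftrightarrow> (\<forall>\<^sub>F n in sequentially. b n \<noteq> 0) \<and> (\<lambda>n. a n / b n) \<longlonglongrightarrow> 0"

definition log_prob :: "real \<Rightarrow> ereal" where
  "log_prob p = (if p = 0 then -\<infinity> else ereal (ln p))"

text \<open>The variables \<open>Z n\<close> may live on different probability spaces \<open>P n\<close>.\<close>

definition satisfies_LDP ::
  "(nat \<Rightarrow> 'w measure) \<Rightarrow> (nat \<Rightarrow> 'w \<Rightarrow> real) \<Rightarrow> (nat \<Rightarrow> real) \<Rightarrow> (real \<Rightarrow> real) \<Rightarrow> bool" where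
  "satisfies_LDP P Z s I \<longleftrightarrow>
     (\<forall>n. Z n \<in> borel_measurable (P n)) \<and>
     filterlim s at_top sequentially \<and>
     (\<forall>x. 0 \<le> I x) \<and>
     (\<forall>M\<ge>0. compact {x. I x \<le> M}) \<and>
     (\<forall>F. closed F \<longrightarrow>
        limsup (\<lambda>n. ereal (inverse (s n)) * log_prob (measure (P n) {\<omega> \<in> space (P n). Z n \<omega> \<in> F}))
          \<le> - (INF x\<in>F. ereal (I x))) \<and>
     (\<forall>U. open U \<longrightarrow>
        liminf (\<lambda>n. ereal (inverse (s n)) * log_prob (measure (P n) {\<omega> \<in> space (P n). Z n \<omega> \<in> U}))
          \<ge> - (INF x\<in>U. ereal (I x)))"

end

theory Submission
  imports Defs
begin

text \<open>The number of points of a determinantal process in \<open>D\<close> behaves like a sum of independent Bernoulli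
variables whose parameters are the eigenvalues \<open>\<eta> k\<close> of the restricted operator: its generating
function is \<open>E (1 + z)\<^sup>N = \<Prod>k. (1 + z \<eta> k)\<close> for every real \<open>z\<close> (\<open>generating_function\<close>).
Therefore its mean is the sum of the \<open>\<eta> k\<close> and its variance \<open>V\<close> is the sum of the
\<open>\<eta> k (1 - \<eta> k)\<close>. Its centred cumulant generating function at \<open>t\<close> lies between
\<open>V t\<^sup>2 / 2\<close> times \<open>exp (-\<bar>t\<bar>)\<close> and \<open>V t\<^sup>2 / 2\<close> times \<open>exp \<bar>t\<bar>\<close>
(\<open>centered_mgf_bounds\<close>). For \<open>t = a l / sqrt V\<close>, which tends to \<open>0\<close>, division by \<open>a\<^sup>2\<close> gives
the limit \<open>l\<^sup>2 / 2\<close>, and a large deviation principle follows as in the Gaertner--Ellis theorem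
(\<open>satisfies_LDP_gaussian\<close>): upper bounds by Chernoff's inequality, lower bounds by exponential
tilting.

The generating function comes from the factorial moments. The joint intensities, given on products of
disjoint sets only, are summed over ever finer partitions of \<open>D\<close>; as the process is simple, this
yields the factorial moments of the count (\<open>factorial_moment\<close>). On the other side, the integral of
the determinant of the kernel over \<open>D\<^sup>k\<close> is \<open>k!\<close> times the elementary symmetric function of
degree \<open>k\<close> of the eigenvalues. For finitely many eigenvalues this is orthonormality inserted into
Leibniz' formula (\<open>integral_det_expansion\<close>); in general it follows by dominated convergence
(\<open>integral_det_eq_limit\<close>).

The delicate point is the diagonal of the kernel, which is invisible in the \<open>L\<^sup>2\<close>-expansion but
enters the determinants. The trace formula on compact sets, together with the fact that the trace does
not depend on the chosen expansion (\<open>trace_unique\<close>), shows that the expansion also converges to the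
kernel almost everywhere on the diagonal (\<open>kernel_diagonal\<close>).\<close>

section \<open>Large deviations from a quadratic limit of cumulants\<close>

lemma (in prob_space) chernoff_upper:
  fixes Z :: "'a \<Rightarrow> real"
  assumes [measurable]: "Z \<in> borel_measurable M" and int: "integrable M (\<lambda>\<omega>. exp (b * Z \<omega>))"
    and ge: "\<And>z. z \<in> A \<Longrightarrow> b * d \<le> b * z" and [measurable]: "A \<in> sets borel"
  shows "prob {\<omega> \<in> space M. Z \<omega> \<in> A} \<le> exp (- (b * d)) * expectation (\<lambda>\<omega>. exp (b * Z \<omega>))"
proof -
  have "prob {\<omega> \<in> space M. Z \<omega> \<in> A} = expectation (indicator {\<omega> \<in> space M. Z \<omega> \<in> A})"
    by simp
  also have "\<dots> \<le> expectation (\<lambda>\<omega>. exp (- (b * d)) * exp (b * Z \<omega>))"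
  proof (rule integral_mono)
    fix \<omega> assume "\<omega> \<in> space M"
    have "1 \<le> exp (- (b * d)) * exp (b * Z \<omega>)" if "Z \<omega> \<in> A"
      using ge[OF that] by (simp flip: exp_add)
    then show "indicator {\<omega> \<in> space M. Z \<omega> \<in> A} \<omega> \<le> exp (- (b * d)) * exp (b * Z \<omega>)"
      by (auto simp: indicator_def)
  qed (use int in \<open>auto intro!: integrable_real_indicator simp: less_top[symmetric]\<close>)
  finally show ?thesis by simp
qed

text \<open>The Chernoff bound under the law tilted by \<open>exp (c Z)\<close>, up to normalisation: on \<open>A\<close> the
density \<open>exp (c Z)\<close> is dominated by \<open>exp (b Z)\<close> at the price \<open>exp (-(b - c) d)\<close>. It is
used with \<open>d\<close> an endpoint of a half-line \<open>A\<close> and with \<open>b - c\<close> pointing into it.\<close>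

lemma (in prob_space) tilted_tail:
  fixes Z :: "'a \<Rightarrow> real"
  assumes [measurable]: "Z \<in> borel_measurable M"
    and int: "integrable M (\<lambda>\<omega>. exp (c * Z \<omega>))" "integrable M (\<lambda>\<omega>. exp (b * Z \<omega>))"
    and ge: "\<And>z. z \<in> A \<Longrightarrow> (b - c) * d \<le> (b - c) * z" and [measurable]: "A \<in> sets borel"
  shows "expectation (\<lambda>\<omega>. exp (c * Z \<omega>) * indicator A (Z \<omega>))
           \<le> exp (- ((b - c) * d)) * expectation (\<lambda>\<omega>. exp (b * Z \<omega>))"
proof -
  have "expectation (\<lambda>\<omega>. exp (c * Z \<omega>) * indicator A (Z \<omega>))
     \<le> expectation (\<lambda>\<omega>. exp (- ((b - c) * d)) * exp (b * Z \<omega>))"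
  proof (rule integral_mono)
    show "integrable M (\<lambda>\<omega>. exp (c * Z \<omega>) * indicator A (Z \<omega>))"
      by (rule Bochner_Integration.integrable_bound[OF int(1)]) (auto simp: indicator_def)
    fix \<omega> assume "\<omega> \<in> space M"
    have "exp (c * Z \<omega>) \<le> exp (- ((b - c) * d)) * exp (b * Z \<omega>)" if "Z \<omega> \<in> A"
      using ge[OF that] by (simp flip: exp_add add: algebra_simps)
    then show "exp (c * Z \<omega>) * indicator A (Z \<omega>) \<le> exp (- ((b - c) * d)) * exp (b * Z \<omega>)"
      by (auto simp: indicator_def)
  qed (use int in auto)
  then show ?thesis by simp
qed

lemma scaled_log_prob_le:
  assumes "0 < s" "0 \<le> p" "p \<le> exp (s * c)"
  shows "ereal (inverse s) * log_prob p \<le> ereal c"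
proof (cases "p = 0")
  case False
  then have "ln p \<le> s * c" using assms by (simp add: ln_le_cancel_iff[of p "exp (s*c)", simplified])
  then show ?thesis using assms False by (simp add: log_prob_def field_simps)
qed (use assms in \<open>simp add: log_prob_def\<close>)

lemma scaled_log_prob_ge:
  assumes "0 < s" "exp (s * c) \<le> p"
  shows "ereal c \<le> ereal (inverse s) * log_prob p"
proof -
  have p: "0 < p" using assms(2) exp_gt_zero[of "s * c"] by linarith
  then have "s * c \<le> ln p" using assms by (simp add: ln_ge_iff)
  then show ?thesis using assms p by (simp add: log_prob_def field_simps)
qed

lemma closed_rate_attained:
  fixes F :: "real set"
  assumes "closed F" "F \<noteq> {}"
  obtains d where "0 \<le> d" "\<And>z. z \<in> F \<Longrightarrow> d \<le> \<bar>z\<bar>" "(INF x\<in>F. ereal (x\<^sup>2 / 2)) = ereal (d\<^sup>2 / 2)"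
proof -
  obtain x where x: "x \<in> F" "\<And>z. z \<in> F \<Longrightarrow> dist 0 x \<le> dist 0 z"
    using distance_attains_inf[OF assms, of 0] by metis
  show ?thesis
  proof (rule that[of "\<bar>x\<bar>"])
    show "(INF x\<in>F. ereal (x\<^sup>2 / 2)) = ereal (\<bar>x\<bar>\<^sup>2 / 2)"
    proof (rule antisym)
      show "(INF x\<in>F. ereal (x\<^sup>2 / 2)) \<le> ereal (\<bar>x\<bar>\<^sup>2 / 2)"
        using x(1) by (intro INF_lower2[of x]) auto
      show "ereal (\<bar>x\<bar>\<^sup>2 / 2) \<le> (INF x\<in>F. ereal (x\<^sup>2 / 2))"
        using x(2) by (intro INF_greatest) (auto simp: abs_le_square_iff)
    qed
  qed (use x in auto)
qed

text \<open>The special case of the Gaertner--Ellis theorem with limiting cumulant generating function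
\<open>l\<^sup>2 / 2\<close>. The variables may live on different probability spaces. Since the limit is finite
and smooth on the whole line, every point is the point of concentration of some tilted law.\<close>

locale gaussian_cgf_limit =
  fixes P :: "nat \<Rightarrow> 'w measure" and Z :: "nat \<Rightarrow> 'w \<Rightarrow> real" and s :: "nat \<Rightarrow> real"
  assumes prob_space_P: "\<And>n. prob_space (P n)"
    and Z_meas: "\<And>n. Z n \<in> borel_measurable (P n)"
    and speed: "filterlim s at_top sequentially"
    and mgf_integrable: "\<And>n l. integrable (P n) (\<lambda>\<omega>. exp (l * Z n \<omega>))"
    and cgf_limit: "\<And>l. (\<lambda>n. ln (LINT \<omega>|P n. exp (s n * l * Z n \<omega>)) / s n) \<longlonglongrightarrow> l\<^sup>2 / 2"
begin

abbreviation mgf where "mgf n l \<equiv> (LINT \<omega>|P n. exp (s n * l * Z n \<omega>))"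

lemma mgf_pos: "0 < mgf n l"
proof -
  interpret prob_space "P n" by (rule prob_space_P)
  have "mgf n l \<noteq> 0"
  proof
    assume "mgf n l = 0"
    then have "AE \<omega> in P n. exp (s n * l * Z n \<omega>) = 0"
      by (subst (asm) integral_nonneg_eq_0_iff_AE) (use mgf_integrable in auto)
    then show False by simp
  qed
  moreover have "0 \<le> mgf n l" by simp
  ultimately show ?thesis by linarith
qed

lemma mgf_bounds:
  assumes "0 < e"
  shows "\<forall>\<^sub>F n in sequentially. exp (s n * (l\<^sup>2 / 2 - e)) \<le> mgf n l \<and> mgf n l \<le> exp (s n * (l\<^sup>2 / 2 + e))"
proof -
  have "\<forall>\<^sub>F n in sequentially. dist (ln (mgf n l) / s n) (l\<^sup>2 / 2) < e"
    using cgf_limit[of l] assms by (rule tendstoD)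
  moreover have "\<forall>\<^sub>F n in sequentially. 0 < s n"
    using speed by (simp add: filterlim_at_top_dense)
  ultimately show ?thesis
  proof eventually_elim
    case (elim n)
    then have "\<bar>ln (mgf n l) / s n - l\<^sup>2 / 2\<bar> < e" by (simp add: dist_real_def)
    then have "l\<^sup>2 / 2 - e \<le> ln (mgf n l) / s n" "ln (mgf n l) / s n \<le> l\<^sup>2 / 2 + e"
      by linarith+
    then have "s n * (l\<^sup>2 / 2 - e) \<le> ln (mgf n l)" "ln (mgf n l) \<le> s n * (l\<^sup>2 / 2 + e)"
      using elim by (simp_all add: field_simps)
    then have "exp (s n * (l\<^sup>2 / 2 - e)) \<le> exp (ln (mgf n l))" "exp (ln (mgf n l)) \<le> exp (s n * (l\<^sup>2 / 2 + e))"
      by simp_all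
    then show ?case using mgf_pos[of n l] by simp
  qed
qed

lemma speed_pos: "\<forall>\<^sub>F n in sequentially. c < s n"
  using speed by (simp add: filterlim_at_top_dense)

text \<open>The Legendre transform of \<open>l\<^sup>2 / 2\<close> at \<open>d\<close> is attained at \<open>l = d\<close>, so the Chernoff
bound with this \<open>l\<close> for the right half-line, and with \<open>-d\<close> for the left one, has the optimal
exponent. The factor \<open>2\<close> from the two half-lines disappears at the speed \<open>s n\<close>.\<close>

lemma upper_bound_away:
  assumes d: "0 \<le> d" and F[measurable]: "F \<in> sets borel" and away: "\<And>z. z \<in> F \<Longrightarrow> d \<le> \<bar>z\<bar>"
  shows "limsup (\<lambda>n. ereal (inverse (s n)) * log_prob (measure (P n) {\<omega> \<in> space (P n). Z n \<omega> \<in> F}))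
          \<le> ereal (- (d\<^sup>2 / 2))"
proof (rule ereal_le_epsilon2)
  fix e :: real assume e: "0 < e"
  have "\<forall>\<^sub>F n in sequentially. ereal (inverse (s n)) * log_prob (measure (P n) {\<omega> \<in> space (P n). Z n \<omega> \<in> F})
          \<le> ereal (- (d\<^sup>2 / 2) + e)"
    using mgf_bounds[OF half_gt_zero[OF e], of d] mgf_bounds[OF half_gt_zero[OF e], of "-d"]
      speed_pos[of "max 0 (2 * ln 2 / e)"]
  proof eventually_elim
    case (elim n)
    interpret prob_space "P n" by (rule prob_space_P)
    note Z_meas[measurable]
    have s: "0 < s n" "ln 2 \<le> s n * (e/2)"
      using elim(3) e by (simp_all only: max_less_iff_conj) (simp add: field_simps)
    let ?E = "exp (- (s n * d * d)) * exp (s n * (d\<^sup>2 / 2 + e/2))"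
    have A: "prob {\<omega> \<in> space (P n). Z n \<omega> \<in> {d..}} \<le> exp (- (s n * d * d)) * mgf n d"
      by (rule chernoff_upper) (use mgf_integrable s d in \<open>auto intro!: mult_left_mono\<close>)
    have B: "prob {\<omega> \<in> space (P n). Z n \<omega> \<in> {..-d}} \<le> exp (- (s n * (-d) * (-d))) * mgf n (-d)"
    proof (rule chernoff_upper)
      show "s n * (-d) * (-d) \<le> s n * (-d) * z" if "z \<in> {..-d}" for z
        using that s d by (intro mult_left_mono_neg) auto
    qed (use mgf_integrable[of n "s n * (-d)"] in auto)
    have "prob {\<omega> \<in> space (P n). Z n \<omega> \<in> F}
       \<le> prob ({\<omega> \<in> space (P n). Z n \<omega> \<in> {d..}} \<union> {\<omega> \<in> space (P n). Z n \<omega> \<in> {..-d}})"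
      using away by (intro finite_measure_mono) (auto, force)
    also have "\<dots> \<le> prob {\<omega> \<in> space (P n). Z n \<omega> \<in> {d..}} + prob {\<omega> \<in> space (P n). Z n \<omega> \<in> {..-d}}"
      by (rule measure_Un_le) auto
    also have "\<dots> \<le> ?E + ?E"
    proof (rule add_mono)
      show "prob {\<omega> \<in> space (P n). Z n \<omega> \<in> {d..}} \<le> ?E"
        using elim by (intro order_trans[OF A]) simp
      show "prob {\<omega> \<in> space (P n). Z n \<omega> \<in> {..-d}} \<le> ?E"
        using elim by (intro order_trans[OF B]) simp
    qed
    also have "\<dots> = exp (ln 2 + (- (s n * d * d) + s n * (d\<^sup>2 / 2 + e/2)))"
      unfolding exp_add by simp
    also have "\<dots> \<le> exp (s n * (- (d\<^sup>2 / 2) + e))"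
      using s(2) by (simp add: algebra_simps power2_eq_square)
    finally show ?case
      using s(1) scaled_log_prob_le[of "s n" _ "- (d\<^sup>2 / 2) + e"] by simp
  qed
  then show "limsup (\<lambda>n. ereal (inverse (s n)) * log_prob (measure (P n) {\<omega> \<in> space (P n). Z n \<omega> \<in> F}))
          \<le> ereal (- (d\<^sup>2 / 2)) + ereal e"
    by (simp add: Limsup_bounded)
qed

text \<open>Tilting by \<open>exp (s x Z)\<close> shifts the limiting Gaussian cumulant to mean \<open>x\<close>. Hence at least
half of the tilted mass eventually lies within \<open>d\<close> of \<open>x\<close>: by \<open>tilted_tail\<close> each tail has
relative mass of order \<open>exp (-s d\<^sup>2 / 2)\<close>.\<close>

lemma tilted_mass:
  assumes d: "0 < d"
  shows "\<forall>\<^sub>F n in sequentially. mgf n x / 2 \<le>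
           (LINT \<omega>|P n. exp (s n * x * Z n \<omega>) * indicator {x-d<..<x+d} (Z n \<omega>))"
proof -
  \<comment> \<open>the two errors \<open>e\<close> must leave \<open>d\<^sup>2 / 4\<close> of the exponent \<open>d\<^sup>2 / 2\<close>\<close>
  define e where "e = d\<^sup>2 / 8"
  have e: "0 < e" using d by (simp add: e_def)
  show ?thesis
    using mgf_bounds[OF e, of x] mgf_bounds[OF e, of "x+d"] mgf_bounds[OF e, of "x-d"]
      speed_pos[of "max 0 (4 * ln 4 / d\<^sup>2)"]
  proof eventually_elim
    case (elim n)
    interpret prob_space "P n" by (rule prob_space_P)
    note Z_meas[measurable]
    have s: "0 < s n" "ln 4 \<le> s n * (d\<^sup>2 / 4)"
      using elim(4) d by (simp_all only: max_less_iff_conj) (simp add: field_simps)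
    define I where "I A = (LINT \<omega>|P n. exp (s n * x * Z n \<omega>) * indicator A (Z n \<omega>))" for A
    have int: "integrable (P n) (\<lambda>\<omega>. exp (s n * x * Z n \<omega>) * indicator A (Z n \<omega>))"
      if [measurable]: "A \<in> sets borel" for A
      by (rule Bochner_Integration.integrable_bound[OF mgf_integrable[of n "s n * x"]]) 
         (auto simp: indicator_def)
    have small: "exp (- (s n * d\<^sup>2)) * exp (s n * (y\<^sup>2 / 2 + e)) * exp (s n * r) \<le> mgf n x / 4"
      if "y\<^sup>2 / 2 + r = x\<^sup>2/2 + d\<^sup>2 / 2" for y r
    proof -
      have "exp (- (s n * d\<^sup>2)) * exp (s n * (y\<^sup>2 / 2 + e)) * exp (s n * r)
          = exp (s n * (- d\<^sup>2 + e + (y\<^sup>2 / 2 + r)))"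
        by (simp add: algebra_simps flip: exp_add)
      also have "\<dots> = exp (s n * (x\<^sup>2/2 - e)) * exp (- (s n * (d\<^sup>2 / 4)))"
        by (subst that) (simp add: algebra_simps e_def flip: exp_add)
      also have "\<dots> \<le> exp (s n * (x\<^sup>2/2 - e)) * exp (- ln 4)"
        using s(2) by simp
      also have "\<dots> \<le> mgf n x / 4"
        using elim by (simp add: exp_minus)
      finally show ?thesis .
    qed
    have up: "I {x+d..} \<le> mgf n x / 4"
    proof -
      have "I {x+d..} \<le> exp (- ((s n * (x+d) - s n * x) * (x+d))) * mgf n (x+d)"
        unfolding I_def
      proof (rule tilted_tail)
        show "(s n * (x+d) - s n * x) * (x+d) \<le> (s n * (x+d) - s n * x) * z" if "z \<in> {x+d..}" for z
          using that s d by (intro mult_left_mono) (auto simp: distrib_left)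
      qed (use mgf_integrable in auto)
      also have "\<dots> \<le> exp (- ((s n * (x+d) - s n * x) * (x+d))) * exp (s n * ((x+d)\<^sup>2 / 2 + e))"
        using elim by simp
      also have "\<dots> = exp (- (s n * d\<^sup>2)) * exp (s n * ((x+d)\<^sup>2 / 2 + e)) * exp (s n * (- (x * d)))"
        by (simp add: algebra_simps power2_eq_square flip: exp_add)
      also have "\<dots> \<le> mgf n x / 4"
        by (rule small) (simp add: power2_eq_square algebra_simps add_divide_distrib)
      finally show ?thesis .
    qed
    have down: "I {..x-d} \<le> mgf n x / 4"
    proof -
      have "I {..x-d} \<le> exp (- ((s n * (x-d) - s n * x) * (x-d))) * mgf n (x-d)"
        unfolding I_def
      proof (rule tilted_tail)
        show "(s n * (x-d) - s n * x) * (x-d) \<le> (s n * (x-d) - s n * x) * z" if "z \<in> {..x-d}" for z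
          using that s d by (intro mult_left_mono_neg) (auto simp: right_diff_distrib)
      qed (use mgf_integrable in auto)
      also have "\<dots> \<le> exp (- ((s n * (x-d) - s n * x) * (x-d))) * exp (s n * ((x-d)\<^sup>2 / 2 + e))"
        using elim by simp
      also have "\<dots> = exp (- (s n * d\<^sup>2)) * exp (s n * ((x-d)\<^sup>2 / 2 + e)) * exp (s n * (x * d))"
        by (simp add: algebra_simps power2_eq_square flip: exp_add)
      also have "\<dots> \<le> mgf n x / 4"
        by (rule small) (simp add: power2_eq_square algebra_simps add_divide_distrib diff_divide_distrib)
      finally show ?thesis .
    qed
    have "mgf n x = (LINT \<omega>|P n. exp (s n * x * Z n \<omega>) * indicator {x-d<..<x+d} (Z n \<omega>) +
        (exp (s n * x * Z n \<omega>) * indicator {x+d..} (Z n \<omega>) + exp (s n * x * Z n \<omega>) * indicator {..x-d} (Z n \<omega>)))"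
      using d by (intro Bochner_Integration.integral_cong) (auto simp: indicator_def)
    also have "\<dots> = I {x-d<..<x+d} + (I {x+d..} + I {..x-d})"
      unfolding I_def by (subst Bochner_Integration.integral_add, (intro Bochner_Integration.integrable_add int; simp)+)+ simp
    finally show ?case using up down unfolding I_def by linarith
  qed
qed

text \<open>On the ball of radius \<open>d\<close> around \<open>x\<close> the tilting density is at most
\<open>exp (s (x\<^sup>2 + \<bar>x\<bar> d))\<close>. Removing the tilt from the mass found in \<open>tilted_mass\<close>
therefore costs \<open>x\<^sup>2\<close>, of which the moment generating function gives back \<open>x\<^sup>2 / 2\<close>.\<close>

lemma lower_bound_at:
  assumes U: "open U" "x \<in> U"
  shows "ereal (- (x\<^sup>2 / 2)) \<le>
    liminf (\<lambda>n. ereal (inverse (s n)) * log_prob (measure (P n) {\<omega> \<in> space (P n). Z n \<omega> \<in> U}))"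
proof (rule ereal_le_epsilon2)
  fix e :: real assume e: "0 < e"
  obtain r where r: "0 < r" "ball x r \<subseteq> U" using U by (auto simp: open_contains_ball)
  \<comment> \<open>small enough for the ball to lie in \<open>U\<close> and for \<open>\<bar>x\<bar> d\<close> to be negligible; the \<open>+ 1\<close> covers \<open>x = 0\<close>\<close>
  define d where "d = min r (e / (4 * (\<bar>x\<bar> + 1)))"
  have d: "0 < d" "\<bar>x\<bar> * d \<le> e / 4"
  proof -
    show "0 < d" using r e by (simp add: d_def)
    have "\<bar>x\<bar> * d \<le> (\<bar>x\<bar> + 1) * (e / (4 * (\<bar>x\<bar> + 1)))"
      using e r by (intro mult_mono) (auto simp: d_def)
    also have "\<dots> = e / 4" by (simp add: field_simps add_eq_0_iff)
    finally show "\<bar>x\<bar> * d \<le> e / 4" .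
  qed
  have sub: "{x-d<..<x+d} \<subseteq> U"
    using r(2) subset_ball[of d r x] by (simp add: d_def ball_eq_greaterThanLessThan)
  have [measurable]: "U \<in> sets borel" using U by simp
  have e4: "0 < e / 4" using e by simp
  have "\<forall>\<^sub>F n in sequentially. ereal (- (x\<^sup>2 / 2) - e) \<le>
    ereal (inverse (s n)) * log_prob (measure (P n) {\<omega> \<in> space (P n). Z n \<omega> \<in> U})"
    using tilted_mass[OF d(1), of x] mgf_bounds[OF e4, of x] speed_pos[of "max 0 (2 * ln 2 / e)"]
  proof eventually_elim
    case (elim n)
    interpret prob_space "P n" by (rule prob_space_P)
    note Z_meas[measurable]
    have s: "0 < s n" "ln 2 \<le> s n * (e/2)"
      using elim(3) e by (simp_all only: max_less_iff_conj) (simp add: field_simps)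
    let ?c = "s n * (x\<^sup>2 + e / 4)"
    have "mgf n x / 2 \<le> (LINT \<omega>|P n. exp (s n * x * Z n \<omega>) * indicator {x-d<..<x+d} (Z n \<omega>))"
      using elim by simp
    also have "\<dots> \<le> (LINT \<omega>|P n. exp ?c * indicator {\<omega> \<in> space (P n). Z n \<omega> \<in> U} \<omega>)"
    proof (rule integral_mono)
      show "integrable (P n) (\<lambda>\<omega>. exp (s n * x * Z n \<omega>) * indicator {x-d<..<x+d} (Z n \<omega>))"
        by (rule Bochner_Integration.integrable_bound[OF mgf_integrable[of n "s n * x"]])
           (auto simp: indicator_def)
      fix \<omega> assume \<omega>: "\<omega> \<in> space (P n)"
      have "s n * x * Z n \<omega> \<le> ?c" if "Z n \<omega> \<in> {x-d<..<x+d}"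
      proof -
        have "x * (Z n \<omega> - x) \<le> \<bar>x\<bar> * \<bar>Z n \<omega> - x\<bar>" by (metis abs_ge_self abs_mult)
        also have "\<dots> \<le> \<bar>x\<bar> * d" using that by (intro mult_left_mono) auto
        finally have "x * Z n \<omega> \<le> x\<^sup>2 + e / 4" using d(2) by (simp add: algebra_simps power2_eq_square)
        then have "s n * (x * Z n \<omega>) \<le> ?c" using s(1) by (intro mult_left_mono) auto
        then show ?thesis by (simp add: mult.assoc)
      qed
      then show "exp (s n * x * Z n \<omega>) * indicator {x-d<..<x+d} (Z n \<omega>)
          \<le> exp ?c * indicator {\<omega> \<in> space (P n). Z n \<omega> \<in> U} \<omega>"
        using sub \<omega> by (auto simp: indicator_def)
    qed (auto intro!: integrable_real_indicator simp: less_top[symmetric])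
    also have "\<dots> = exp ?c * prob {\<omega> \<in> space (P n). Z n \<omega> \<in> U}" by simp
    finally have 1: "exp (s n * (x\<^sup>2 / 2 - e/4)) / 2 \<le> exp ?c * prob {\<omega> \<in> space (P n). Z n \<omega> \<in> U}"
      using elim by simp
    have "exp (s n * (- (x\<^sup>2 / 2) - e)) = exp (- ?c) * (exp (s n * (x\<^sup>2 / 2 - e/4)) * exp (- (s n * (e / 2))))"
      by (simp add: algebra_simps flip: exp_add)
    also have "\<dots> \<le> exp (- ?c) * (exp (s n * (x\<^sup>2 / 2 - e/4)) * exp (- ln 2))"
      using s(2) by (intro mult_left_mono) auto
    also have "\<dots> = exp (- ?c) * (exp (s n * (x\<^sup>2 / 2 - e/4)) / 2)"
      by (simp add: exp_minus)
    also have "\<dots> \<le> exp (- ?c) * (exp ?c * prob {\<omega> \<in> space (P n). Z n \<omega> \<in> U})"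
      using 1 by (intro mult_left_mono) auto
    also have "\<dots> = prob {\<omega> \<in> space (P n). Z n \<omega> \<in> U}"
      by (simp add: exp_minus)
    finally show ?case
      using scaled_log_prob_ge[OF s(1), of "- (x\<^sup>2 / 2) - e"] by simp
  qed
  then have "ereal (- (x\<^sup>2 / 2) - e) \<le>
    liminf (\<lambda>n. ereal (inverse (s n)) * log_prob (measure (P n) {\<omega> \<in> space (P n). Z n \<omega> \<in> U}))"
    by (rule Liminf_bounded)
  then have le: "ereal (- (x\<^sup>2 / 2) - e) + ereal e \<le>
    liminf (\<lambda>n. ereal (inverse (s n)) * log_prob (measure (P n) {\<omega> \<in> space (P n). Z n \<omega> \<in> U})) + ereal e"
    by (rule add_right_mono)
  have "ereal (- (x\<^sup>2 / 2)) = ereal (- (x\<^sup>2 / 2) - e) + ereal e" by simp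
  then show "ereal (- (x\<^sup>2 / 2)) \<le>
    liminf (\<lambda>n. ereal (inverse (s n)) * log_prob (measure (P n) {\<omega> \<in> space (P n). Z n \<omega> \<in> U})) + ereal e"
    using le by (simp only:)
qed

theorem satisfies_LDP_gaussian: "satisfies_LDP P Z s (\<lambda>x. x\<^sup>2 / 2)"
  unfolding satisfies_LDP_def
proof (intro conjI allI impI)
  show "Z n \<in> borel_measurable (P n)" for n by (rule Z_meas)
  show "filterlim s at_top sequentially" by (rule speed)
  show "compact {x::real. x\<^sup>2 / 2 \<le> M}" if "0 \<le> M" for M :: real
  proof -
    have "x\<^sup>2 / 2 \<le> M \<longleftrightarrow> \<bar>x\<bar> \<le> sqrt (2 * M)" for x :: real
      by (metis (no_types) real_sqrt_abs real_sqrt_le_iff mult.commute pos_divide_le_eq zero_less_numeral)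
    then have "{x::real. x\<^sup>2 / 2 \<le> M} = {x. \<bar>x\<bar> \<le> sqrt (2 * M)}" by (simp only:)
    also have "\<dots> = {- sqrt (2 * M) .. sqrt (2 * M)}" by auto
    finally show ?thesis by simp
  qed
  show "limsup (\<lambda>n. ereal (inverse (s n)) * log_prob (measure (P n) {\<omega> \<in> space (P n). Z n \<omega> \<in> F}))
          \<le> - (INF x\<in>F. ereal (x\<^sup>2 / 2))" if cl: "closed F" for F
  proof (cases "F = {}")
    case True
    have "\<forall>\<^sub>F n in sequentially. ereal (inverse (s n)) * log_prob (measure (P n) {\<omega> \<in> space (P n). Z n \<omega> \<in> F}) = -\<infinity>"
      using speed_pos[of 0] by eventually_elim (simp add: True log_prob_def)
    from Limsup_eq[OF this] show ?thesis by (simp add: True Limsup_const top_ereal_def)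
  next
    case False
    obtain d where "0 \<le> d" "\<And>z. z \<in> F \<Longrightarrow> d \<le> \<bar>z\<bar>" "(INF x\<in>F. ereal (x\<^sup>2 / 2)) = ereal (d\<^sup>2 / 2)"
      using closed_rate_attained[OF cl False] by blast
    then show ?thesis using upper_bound_away[of d F] cl by simp
  qed
  show "- (INF x\<in>U. ereal (x\<^sup>2 / 2)) \<le>
     liminf (\<lambda>n. ereal (inverse (s n)) * log_prob (measure (P n) {\<omega> \<in> space (P n). Z n \<omega> \<in> U}))" if "open U" for U
  proof (subst ereal_uminus_le_reorder, rule INF_greatest)
    fix x assume "x \<in> U"
    then show "- liminf (\<lambda>n. ereal (inverse (s n)) * log_prob (measure (P n) {\<omega> \<in> space (P n). Z n \<omega> \<in> U}))
        \<le> ereal (x\<^sup>2 / 2)"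
      using lower_bound_at[OF that] by (subst ereal_uminus_le_reorder) simp
  qed
qed simp

end

section \<open>The cumulant generating function of a Bernoulli variable\<close>

text \<open>The second derivative of the cumulant generating function \<open>u \<mapsto> ln (1 + h (e\<^sup>u - 1)) - u h\<close>
of a centred Bernoulli variable is the variance of the tilted variable,
\<open>h (1 - h) e\<^sup>u / q(u)\<^sup>2\<close> with \<open>q(u) = 1 - h + h e\<^sup>u\<close>. As \<open>q(u)\<close> is a convex combination
of \<open>1\<close> and \<open>e\<^sup>u\<close>, it differs from the variance \<open>h (1 - h)\<close> by a factor between
\<open>exp (-\<bar>u\<bar>)\<close> and \<open>exp \<bar>u\<bar>\<close>. The error is thus relative to the variance and uniform in
\<open>h\<close>, which is what allows infinitely many such bounds to be added.\<close>

lemma bernoulli_cgf_bounds: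
  fixes h t :: real
  assumes h: "0 \<le> h" "h \<le> 1"
  shows "h * (1 - h) * (t\<^sup>2 / 2) * exp (- \<bar>t\<bar>) \<le> ln (1 + h * (exp t - 1)) - t * h"
    and "ln (1 + h * (exp t - 1)) - t * h \<le> h * (1 - h) * (t\<^sup>2 / 2) * exp \<bar>t\<bar>"
proof -
  define q where "q = (\<lambda>u::real. 1 + h * (exp u - 1))"
  have q_between: "min 1 (exp u) \<le> q u" "q u \<le> max 1 (exp u)" for u
  proof -
    have "q u = (1 - h) * 1 + h * exp u" by (simp add: q_def algebra_simps)
    moreover have "min 1 (exp u) = (1 - h) * min 1 (exp u) + h * min 1 (exp u)"
      "max 1 (exp u) = (1 - h) * max 1 (exp u) + h * max 1 (exp u)" by (simp_all add: algebra_simps)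
    ultimately show "min 1 (exp u) \<le> q u" "q u \<le> max 1 (exp u)"
      using h by (metis add_mono mult_left_mono min.cobounded1 min.cobounded2 diff_ge_0_iff_ge,
          metis add_mono mult_left_mono max.cobounded1 max.cobounded2 diff_ge_0_iff_ge)
  qed
  have q_pos: "0 < q u" for u
    using q_between(1)[of u] by (rule less_le_trans[rotated]) simp
  \<comment> \<open>the function and its first two derivatives, in the format of Taylor's theorem\<close>
  define g where "g = (\<lambda>m::nat. if m = 0 then (\<lambda>u. ln (q u) - u * h)
     else if m = 1 then (\<lambda>u. h * exp u / q u - h) else (\<lambda>u. h * (1 - h) * (exp u / (q u)\<^sup>2)))"
  have q_deriv: "(q has_real_derivative h * exp u) (at u)" for u
    unfolding q_def by (auto intro!: derivative_eq_intros)
  have "DERIV (g m) u :> g (Suc m) u" if "m < 2" for m u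
  proof (cases "m = 0")
    case True
    have "((\<lambda>u. ln (q u) - u * h) has_real_derivative (h * exp u / q u - h)) (at u)"
      using q_pos[of u] by (auto intro!: derivative_eq_intros q_deriv)
    then show ?thesis by (simp add: True g_def)
  next
    case False
    have "((\<lambda>u. h * exp u / q u - h) has_real_derivative (h * (1 - h) * (exp u / (q u)\<^sup>2))) (at u)"
      using q_pos[of u]
      by (auto intro!: derivative_eq_intros q_deriv simp: field_simps power2_eq_square)
         (simp add: q_def algebra_simps)
    then show ?thesis using False that by (simp add: g_def)
  qed
  then obtain u where u: "\<bar>u\<bar> \<le> \<bar>t\<bar>" "g 0 t = (\<Sum>m<2. g m 0 / fact m * t ^ m) + g 2 u / fact 2 * t ^ 2"
    using Maclaurin_bi_le[of g "g 0" 2 t] by auto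
  have eq: "ln (1 + h * (exp t - 1)) - t * h = h * (1 - h) * (t\<^sup>2 / 2) * (exp u / (q u)\<^sup>2)"
  proof -
    have "g 0 t = ln (q t) - t * h" "g 0 0 = 0" "g 1 0 = 0" "g 2 u = h * (1 - h) * (exp u / (q u)\<^sup>2)"
      by (simp_all add: g_def q_def)
    with u(2) show ?thesis
      by (simp add: numeral_2_eq_2 q_def[THEN fun_cong, of t, symmetric] ac_simps)
  qed
  have nn: "0 \<le> h * (1 - h) * (t\<^sup>2 / 2)" using h by simp
  have sq: "exp u * exp u = (exp u)\<^sup>2" "exp (- \<bar>u\<bar>) * (max 1 (exp u))\<^sup>2 \<le> exp u"
    "exp u \<le> exp \<bar>u\<bar> * (min 1 (exp u))\<^sup>2"
    by (auto simp: abs_if max_def min_def power2_eq_square simp flip: exp_add)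
  have "exp (- \<bar>u\<bar>) * (q u)\<^sup>2 \<le> exp (- \<bar>u\<bar>) * (max 1 (exp u))\<^sup>2"
    using q_between(2)[of u] q_pos[of u] by (intro mult_left_mono power_mono) auto
  then have lo: "exp (- \<bar>u\<bar>) \<le> exp u / (q u)\<^sup>2"
    using order_trans[OF _ sq(2)] q_pos[of u] by (simp add: pos_le_divide_eq)
  have "exp \<bar>u\<bar> * (min 1 (exp u))\<^sup>2 \<le> exp \<bar>u\<bar> * (q u)\<^sup>2"
    using q_between(1)[of u] by (intro mult_left_mono power_mono) auto
  then have hi: "exp u / (q u)\<^sup>2 \<le> exp \<bar>u\<bar>"
    using order_trans[OF sq(3)] q_pos[of u] by (simp add: pos_divide_le_eq)
  show "h * (1 - h) * (t\<^sup>2 / 2) * exp (- \<bar>t\<bar>) \<le> ln (1 + h * (exp t - 1)) - t * h"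
    unfolding eq using nn lo u(1) by (intro mult_left_mono) (auto intro: order_trans[rotated])
  show "ln (1 + h * (exp t - 1)) - t * h \<le> h * (1 - h) * (t\<^sup>2 / 2) * exp \<bar>t\<bar>"
    unfolding eq using nn hi u(1) by (intro mult_left_mono) (auto intro: order_trans)
qed

section \<open>Factorial moments of simple point processes\<close>

lemma falling_factorial_binomial:
  fixes n k :: nat
  shows "prod ((-) n) {0..<k} = fact k * (n choose k)"
proof (induction k)
  case (Suc k)
  have "Suc k * (n choose Suc k) = (n - k) * (n choose k)"
  proof (cases "k < n")
    case True
    then show ?thesis using binomial_absorb_comp[of n k] binomial_absorption[of k n]
      by (metis Suc_times_binomial_eq binomial_absorption)
  qed (simp add: binomial_eq_0)
  note eq = this
  have "prod ((-) n) {0..<Suc k} = fact k * ((n - k) * (n choose k))" using Suc by simp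
  also have "\<dots> = fact (Suc k) * (n choose Suc k)"
    unfolding eq[symmetric] by (simp only: fact_Suc of_nat_id ac_simps)
  finally show ?case .
qed simp

text \<open>Recording which of the first \<open>m\<close> sets contain a point yields finite Borel partitions that refine
each other and eventually separate any two points.\<close>

lemma separating_open_sequence:
  obtains B :: "nat \<Rightarrow> 'a::polish_space set"
  where "\<And>i. open (B i)" "\<And>x y. (\<And>i. x \<in> B i \<longleftrightarrow> y \<in> B i) \<Longrightarrow> x = y"
proof -
  obtain \<B> :: "'a set set" where \<B>: "countable \<B>" "topological_basis \<B>"
    using ex_countable_basis by blast
  have ne: "\<B> \<noteq> {}"
    using topological_basisE[OF \<B>(2) open_UNIV UNIV_I[of undefined]] by blast
  show ?thesis
  proof
    show "open (from_nat_into \<B> i)" for i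
      using topological_basis_open[OF \<B>(2) from_nat_into[OF ne]] .
    fix x y assume same: "\<And>i. x \<in> from_nat_into \<B> i \<longleftrightarrow> y \<in> from_nat_into \<B> i"
    show "x = y"
    proof (rule ccontr)
      assume "x \<noteq> y"
      then obtain U where U: "open U" "x \<in> U" "y \<notin> U" using t1_space by blast
      obtain b where b: "b \<in> \<B>" "x \<in> b" "b \<subseteq> U" by (rule topological_basisE[OF \<B>(2) U(1,2)])
      obtain i where "b = from_nat_into \<B> i" using from_nat_into_surj[OF \<B>(1) b(1)] by metis
      then show False using same[of i] b U by auto
    qed
  qed
qed

locale separating_sequence =
  fixes B :: "nat \<Rightarrow> 'a::polish_space set" and D :: "'a set"
  assumes open_B: "\<And>i. open (B i)"
    and separating: "\<And>x y. (\<And>i. x \<in> B i \<longleftrightarrow> y \<in> B i) \<Longrightarrow> x = y"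
    and D_borel: "D \<in> sets borel"
begin

definition code :: "nat \<Rightarrow> 'a \<Rightarrow> nat set" where
  "code m x = {i. i < m \<and> x \<in> B i}"

definition cell :: "nat \<Rightarrow> nat set \<Rightarrow> 'a set" where
  "cell m S = {x \<in> D. code m x = S}"

lemma code_Pow: "code m x \<in> Pow {..<m}"
  by (auto simp: code_def)

lemma code_antimono:
  assumes "m \<le> m'" "code m' x = code m' y"
  shows "code m x = code m y"
proof -
  have "code m z = code m' z \<inter> {..<m}" for z using assms(1) by (auto simp: code_def)
  then show ?thesis using assms(2) by simp
qed

lemma code_refine: "code (Suc m) x = code (Suc m) y \<Longrightarrow> code m x = code m y"
  by (rule code_antimono[of m "Suc m"]) simp_all

lemma code_separates: "x \<noteq> y \<Longrightarrow> \<exists>m. code m x \<noteq> code m y"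
proof (rule ccontr)
  assume "x \<noteq> y" "\<nexists>m. code m x \<noteq> code m y"
  then have "code (Suc i) x = code (Suc i) y" for i by blast
  then have "x \<in> B i \<longleftrightarrow> y \<in> B i" for i by (auto simp: code_def set_eq_iff)
  then show False using separating \<open>x \<noteq> y\<close> by blast
qed

lemma cell_measurable: "cell m S \<in> sets borel"
proof -
  have "cell m S = (if S \<subseteq> {..<m} then {x \<in> D. \<forall>i\<in>{..<m}. x \<in> B i \<longleftrightarrow> i \<in> S} else {})"
    by (auto simp: cell_def code_def set_eq_iff)
  moreover have "{x \<in> D. \<forall>i\<in>{..<m}. x \<in> B i \<longleftrightarrow> i \<in> S} \<in> sets borel"
  proof -
    have [measurable]: "B i \<in> sets borel" for i using open_B by simp
    note D_borel[measurable]
    show ?thesis by measurable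
  qed
  ultimately show ?thesis by simp
qed

lemma cells_disjoint: "S \<noteq> S' \<Longrightarrow> cell m S \<inter> cell m S' = {}"
  by (auto simp: cell_def)

lemma cells_cover: "D = (\<Union>S\<in>Pow {..<m}. cell m S)"
  using code_Pow by (auto simp: cell_def)

lemma cell_mass_sum:
  assumes "sets N = sets borel"
  shows "emeasure N D = (\<Sum>S\<in>Pow {..<m}. emeasure N (cell m S))"
  by (subst cells_cover[of m], subst sum_emeasure[symmetric])
     (auto simp: disjoint_family_on_def assms cell_measurable, auto simp: cell_def)

text \<open>Let \<open>G m\<close> be the set of pairs in \<open>D \<times> D\<close> whose points lie in a common cell. Its mass under
\<open>N \<times> N\<close> is the sum of the squares of the cell masses. The sets \<open>G m\<close> decrease to the
diagonal, whose mass is the integral over \<open>D\<close> of the point masses and hence at most the number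
\<open>N D\<close> of points. So finally the squares of the integers \<open>N(cell)\<close> add up to no more than the
integers themselves, and all of them are \<open>0\<close> or \<open>1\<close>.\<close>

lemma eventually_single_occupation:
  assumes sets: "sets N = sets borel" and sf: "sigma_finite_measure N"
    and int_valued: "\<And>A. A \<in> sets borel \<Longrightarrow> emeasure N A \<in> insert \<infinity> \<nat>"
    and fin: "emeasure N D < \<infinity>" and simple: "\<And>x. emeasure N {x} \<le> 1"
  shows "\<forall>\<^sub>F m in sequentially. \<forall>S. emeasure N (cell m S) \<in> {0, 1}"
proof -
  interpret sigma_finite_measure N by fact
  have space: "space N = UNIV" using sets_eq_imp_space_eq[OF sets] by simp
  define n where "n m S = nat \<lfloor>measure N (cell m S)\<rfloor>" for m S
  have cell_le: "emeasure N (cell m S) \<le> emeasure N D" for m S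
    by (intro emeasure_mono) (auto simp: cell_def sets D_borel)
  have n: "emeasure N (cell m S) = of_nat (n m S)" for m S
  proof -
    have "emeasure N (cell m S) \<in> \<nat>"
      using int_valued[OF cell_measurable[of m S]] cell_le[of m S] fin by auto
    then obtain i :: nat where "emeasure N (cell m S) = of_nat i" by (auto simp: Nats_def)
    then show ?thesis by (simp add: n_def measure_def)
  qed
  obtain c :: nat where c: "emeasure N D = of_nat c"
    using int_valued[OF D_borel] fin by (auto simp: Nats_def)
  have sum_n: "(\<Sum>S\<in>Pow {..<m}. n m S) = c" for m
  proof -
    have "of_nat (\<Sum>S\<in>Pow {..<m}. n m S) = (of_nat c :: ennreal)"
      using cell_mass_sum[OF sets, of m] by (simp add: c n)
    then show ?thesis by (simp only: of_nat_eq_iff)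
  qed
  define G where "G m = {z \<in> D \<times> D. code m (fst z) = code m (snd z)}" for m
  have G_eq: "G m = (\<Union>S\<in>Pow {..<m}. cell m S \<times> cell m S)" for m
    using code_Pow by (auto simp: G_def cell_def)
  have box: "cell m S \<times> cell m S \<in> sets (N \<Otimes>\<^sub>M N)" for m S
    by (intro pair_measureI) (auto simp: sets cell_measurable)
  have G_sets: "G m \<in> sets (N \<Otimes>\<^sub>M N)" for m
    unfolding G_eq using box by (intro sets.finite_UN) auto
  have G_mass: "emeasure (N \<Otimes>\<^sub>M N) (G m) = of_nat (\<Sum>S\<in>Pow {..<m}. n m S * n m S)" for m
  proof -
    have "emeasure (N \<Otimes>\<^sub>M N) (G m) = (\<Sum>S\<in>Pow {..<m}. emeasure (N \<Otimes>\<^sub>M N) (cell m S \<times> cell m S))"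
      unfolding G_eq
      by (subst sum_emeasure) (use box in \<open>auto simp: disjoint_family_on_def cell_def\<close>)
    also have "\<dots> = (\<Sum>S\<in>Pow {..<m}. of_nat (n m S) * of_nat (n m S))"
      by (simp add: emeasure_pair_measure_Times sets cell_measurable n)
    finally show ?thesis by simp
  qed
  have "decseq G"
  proof (rule decseq_SucI, rule subsetI)
    show "z \<in> G m" if "z \<in> G (Suc m)" for m z
      using that code_refine[of m "fst z" "snd z"] by (auto simp: G_def)
  qed
  then have lim: "(\<lambda>m. emeasure (N \<Otimes>\<^sub>M N) (G m)) \<longlonglongrightarrow> emeasure (N \<Otimes>\<^sub>M N) (\<Inter>m. G m)"
    by (rule Lim_emeasure_decseq[rotated]) (use G_sets in \<open>auto simp: G_mass simp del: of_nat_sum\<close>)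
  have sep: "(\<forall>m. code m x = code m y) \<longleftrightarrow> x = y" for x y
    using code_separates by blast
  have "(\<Inter>m. G m) = {z. fst z \<in> D \<and> snd z \<in> D \<and> (\<forall>m. code m (fst z) = code m (snd z))}"
    by (auto simp: G_def)
  also have "\<dots> = {z. fst z \<in> D \<and> fst z = snd z}"
    unfolding sep by auto
  finally have "(\<Inter>m. G m) = {z. fst z \<in> D \<and> fst z = snd z}" .
  moreover have "(\<Inter>m. G m) \<in> sets (N \<Otimes>\<^sub>M N)" using G_sets by auto
  ultimately have diag: "emeasure (N \<Otimes>\<^sub>M N) (\<Inter>m. G m) = (\<integral>\<^sup>+ x. emeasure N (Pair x -` {z. fst z \<in> D \<and> fst z = snd z}) \<partial>N)"
    by (metis emeasure_pair_measure_alt)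
  also have "\<dots> \<le> (\<integral>\<^sup>+ x. indicator D x \<partial>N)"
  proof (rule nn_integral_mono)
    fix x
    have "Pair x -` {z. fst z \<in> D \<and> fst z = snd z} = (if x \<in> D then {x} else {})" by auto
    then show "emeasure N (Pair x -` {z. fst z \<in> D \<and> fst z = snd z}) \<le> indicator D x"
      using simple[of x] by (simp add: indicator_def)
  qed
  also have "\<dots> = of_nat c" using c by (simp add: sets D_borel)
  also have "\<dots> < of_nat (Suc c)" by (simp add: ennreal_of_nat_eq_real_of_nat ennreal_less_iff)
  \<comment> \<open>the masses are integers, so a limit below \<open>c + 1\<close> bounds them by \<open>c\<close> eventually\<close>
  finally have "\<forall>\<^sub>F m in sequentially. emeasure (N \<Otimes>\<^sub>M N) (G m) < of_nat (Suc c)"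
    using lim by (rule order_tendstoD[rotated])
  then show ?thesis
  proof eventually_elim
    case (elim m)
    have le: "(\<Sum>S\<in>Pow {..<m}. n m S * n m S) \<le> (\<Sum>S\<in>Pow {..<m}. n m S)"
      using elim unfolding G_mass sum_n by (simp only: of_nat_less_iff)
    have le1: "n m S \<le> 1" if S: "S \<in> Pow {..<m}" for S
    proof (rule ccontr)
      assume "\<not> n m S \<le> 1"
      then have "n m S * 1 < n m S * n m S" by (intro mult_strict_left_mono) auto
      then have "(\<Sum>S\<in>Pow {..<m}. n m S) < (\<Sum>S\<in>Pow {..<m}. n m S * n m S)"
        using S by (intro sum_strict_mono_ex1) (auto simp: le_square)
      then show False using le by simp
    qed
    have emp: "cell m S = {}" if "S \<notin> Pow {..<m}" for S
      using that code_Pow by (auto simp: cell_def)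
    have "n m S = 0 \<or> n m S = 1 \<or> cell m S = {}" for S
    proof (cases "S \<in> Pow {..<m}")
      case True
      then have "n m S = 0 \<or> n m S = 1" using le1[of S] by linarith
      then show ?thesis by blast
    qed (use emp[of S] in blast)
    note cases = this
    have "emeasure N (cell m S) = 0 \<or> emeasure N (cell m S) = 1" for S
      using cases[of S] n[of m S] by (elim disjE) simp_all
    then show ?case by simp
  qed
qed

text \<open>The \<open>k\<close>-tuples in \<open>D\<close> whose points lie in distinct cells. They are a disjoint union of boxes
with disjoint sides, the sets on which joint intensities are specified.\<close>

definition distinct_cells :: "nat \<Rightarrow> nat \<Rightarrow> (nat \<Rightarrow> 'a) set" where
  "distinct_cells k m = {x \<in> {..<k} \<rightarrow>\<^sub>E D. inj_on (\<lambda>i. code m (x i)) {..<k}}"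

definition cell_choices :: "nat \<Rightarrow> nat \<Rightarrow> (nat \<Rightarrow> nat set) set" where
  "cell_choices k m = {S \<in> {..<k} \<rightarrow>\<^sub>E Pow {..<m}. inj_on S {..<k}}"

lemma finite_cell_choices: "finite (cell_choices k m)"
  unfolding cell_choices_def by (rule finite_subset[of _ "{..<k} \<rightarrow>\<^sub>E Pow {..<m}"]) (auto intro!: finite_PiE)

lemma distinct_cells_eq: "distinct_cells k m = (\<Union>S\<in>cell_choices k m. \<Pi>\<^sub>E i\<in>{..<k}. cell m (S i))"
proof (intro equalityI subsetI)
  fix x assume x: "x \<in> distinct_cells k m"
  let ?S = "\<lambda>i\<in>{..<k}. code m (x i)"
  have "?S \<in> cell_choices k m" "x \<in> (\<Pi>\<^sub>E i\<in>{..<k}. cell m (?S i))"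
    using x code_Pow by (auto simp: distinct_cells_def cell_choices_def cell_def inj_on_def PiE_iff)
  then show "x \<in> (\<Union>S\<in>cell_choices k m. \<Pi>\<^sub>E i\<in>{..<k}. cell m (S i))" by blast
next
  fix x assume "x \<in> (\<Union>S\<in>cell_choices k m. \<Pi>\<^sub>E i\<in>{..<k}. cell m (S i))"
  then obtain S where S: "S \<in> cell_choices k m" "x \<in> (\<Pi>\<^sub>E i\<in>{..<k}. cell m (S i))" by blast
  have "code m (x i) = S i" if "i \<in> {..<k}" for i
    using PiE_mem[OF S(2) that] by (simp add: cell_def)
  then have "inj_on (\<lambda>i. code m (x i)) {..<k} \<longleftrightarrow> inj_on S {..<k}" by (rule inj_on_cong)
  moreover have "x \<in> {..<k} \<rightarrow>\<^sub>E D" using S(2) by (auto simp: PiE_iff cell_def)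
  ultimately show "x \<in> distinct_cells k m"
    using S(1) by (simp add: distinct_cells_def cell_choices_def)
qed

lemma cell_boxes_disjoint: "disjoint_family_on (\<lambda>S. \<Pi>\<^sub>E i\<in>{..<k}. cell m (S i)) (cell_choices k m)"
proof (unfold disjoint_family_on_def, intro ballI impI)
  fix S S' assume S: "S \<in> cell_choices k m" "S' \<in> cell_choices k m" "S \<noteq> S'"
  have "\<exists>i<k. S i \<noteq> S' i"
  proof (rule ccontr)
    assume "\<not> (\<exists>i<k. S i \<noteq> S' i)"
    then have "S = S'"
      using S(1,2) by (intro PiE_ext[of S "{..<k}" "\<lambda>_. Pow {..<m}" S']) (auto simp: cell_choices_def)
    then show False using S(3) by simp
  qed
  then obtain i where i: "i < k" "S i \<noteq> S' i" by blast
  then show "(\<Pi>\<^sub>E i\<in>{..<k}. cell m (S i)) \<inter> (\<Pi>\<^sub>E i\<in>{..<k}. cell m (S' i)) = {}"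
    using cells_disjoint[OF i(2), of m] by (auto simp: PiE_iff)
qed

lemma cell_box_measurable: "(\<Pi>\<^sub>E i\<in>{..<k}. cell m (S i)) \<in> sets (\<Pi>\<^sub>M i\<in>{..<k::nat}. borel)"
  by (intro sets_PiM_I_finite) (auto simp: cell_measurable)

lemma distinct_cells_measurable: "distinct_cells k m \<in> sets (\<Pi>\<^sub>M i\<in>{..<k}. borel)"
  unfolding distinct_cells_eq by (intro sets.finite_UN finite_cell_choices cell_box_measurable)

lemma emeasure_distinct_cells:
  assumes "sets \<nu> = sets (\<Pi>\<^sub>M i\<in>{..<k}. borel)"
  shows "emeasure \<nu> (distinct_cells k m) = (\<Sum>S\<in>cell_choices k m. emeasure \<nu> (\<Pi>\<^sub>E i\<in>{..<k}. cell m (S i)))"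
proof -
  have "(\<lambda>S. \<Pi>\<^sub>E i\<in>{..<k}. cell m (S i)) ` cell_choices k m \<subseteq> sets \<nu>"
    unfolding assms by (intro image_subsetI cell_box_measurable)
  from sum_emeasure[OF this cell_boxes_disjoint finite_cell_choices] show ?thesis
    by (simp only: distinct_cells_eq)
qed

lemma incseq_distinct_cells: "incseq (distinct_cells k)"
proof (rule incseq_SucI)
  show "distinct_cells k m \<subseteq> distinct_cells k (Suc m)" for m
  proof
    fix x assume x: "x \<in> distinct_cells k m"
    then have "inj_on (\<lambda>i. code (Suc m) (x i)) {..<k}"
      by (intro inj_onI) (auto simp: distinct_cells_def dest!: code_refine dest: inj_onD)
    then show "x \<in> distinct_cells k (Suc m)" using x by (simp add: distinct_cells_def)
  qed
qed

lemma UN_distinct_cells: "(\<Union>m. distinct_cells k m) = {x \<in> {..<k} \<rightarrow>\<^sub>E D. inj_on x {..<k}}"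
proof (intro equalityI subsetI)
  fix x assume x: "x \<in> {x \<in> {..<k} \<rightarrow>\<^sub>E D. inj_on x {..<k}}"
  have "\<forall>p\<in>{..<k} \<times> {..<k}. \<exists>m. fst p \<noteq> snd p \<longrightarrow> code m (x (fst p)) \<noteq> code m (x (snd p))"
  proof
    fix p assume p: "p \<in> {..<k} \<times> {..<k}"
    show "\<exists>m. fst p \<noteq> snd p \<longrightarrow> code m (x (fst p)) \<noteq> code m (x (snd p))"
    proof (cases "fst p = snd p")
      case False
      then have "x (fst p) \<noteq> x (snd p)" using x p by (auto simp: inj_on_def)
      then show ?thesis using code_separates by blast
    qed simp
  qed
  then obtain f where f: "\<And>p. p \<in> {..<k} \<times> {..<k} \<Longrightarrow> fst p \<noteq> snd p \<longrightarrow> code (f p) (x (fst p)) \<noteq> code (f p) (x (snd p))"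
    by metis
  define m where "m = Max (insert 0 (f ` ({..<k} \<times> {..<k})))"
  have "f p \<le> m" if "p \<in> {..<k} \<times> {..<k}" for p
    unfolding m_def using that by (intro Max_ge) auto
  note f_le = this
  have "inj_on (\<lambda>i. code m (x i)) {..<k}"
  proof (rule inj_onI, rule ccontr)
    fix i j assume ij: "i \<in> {..<k}" "j \<in> {..<k}" "code m (x i) = code m (x j)" "i \<noteq> j"
    then have p: "(i, j) \<in> {..<k} \<times> {..<k}" by simp
    show False using f[OF p] code_antimono[OF f_le[OF p] ij(3)] ij(4) by simp
  qed
  then show "x \<in> (\<Union>m. distinct_cells k m)" using x by (auto simp: distinct_cells_def)
next
  fix x assume "x \<in> (\<Union>m. distinct_cells k m)"
  then obtain m where m: "x \<in> {..<k} \<rightarrow>\<^sub>E D" "inj_on (\<lambda>i. code m (x i)) {..<k}"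
    by (auto simp: distinct_cells_def)
  have "inj_on x {..<k}" using inj_onD[OF m(2)] by (intro inj_onI) simp
  then show "x \<in> {x \<in> {..<k} \<rightarrow>\<^sub>E D. inj_on x {..<k}}" using m(1) by simp
qed

text \<open>Once every cell contains at most one point, the sum counts the injective maps from \<open>{..<k}\<close> into
the set of occupied cells, which is as large as the number of points in \<open>D\<close>.\<close>

lemma sum_cell_products_eventually:
  assumes sets: "sets N = sets borel" and sf: "sigma_finite_measure N"
    and int_valued: "\<And>A. A \<in> sets borel \<Longrightarrow> emeasure N A \<in> insert \<infinity> \<nat>"
    and fin: "emeasure N D < \<infinity>" and simple: "\<And>x. emeasure N {x} \<le> 1"
  shows "\<forall>\<^sub>F m in sequentially. (\<Sum>S\<in>cell_choices k m. \<Prod>i<k. emeasure N (cell m (S i)))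
      = of_nat (fact k * (nat \<lfloor>measure N D\<rfloor> choose k))"
proof -
  have "\<forall>\<^sub>F m in sequentially. \<forall>S. emeasure N (cell m S) \<in> {0, 1}"
    by (rule eventually_single_occupation[OF sets sf _ fin simple]) (rule int_valued)
  then show ?thesis
  proof eventually_elim
    case (elim m)
    define Z where "Z = {S \<in> Pow {..<m}. emeasure N (cell m S) = 1}"
    have Z: "finite Z" "Z \<subseteq> Pow {..<m}" by (auto simp: Z_def)
    have one: "emeasure N (cell m S) = (if S \<in> Z then 1 else 0)" if "S \<in> Pow {..<m}" for S
      using elim that by (auto simp: Z_def)
    have "emeasure N D = (\<Sum>S\<in>Pow {..<m}. if S \<in> Z then 1 else 0)"
      unfolding cell_mass_sum[OF sets, of m] by (intro sum.cong) (auto simp: one)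
    also have "\<dots> = of_nat (card Z)"
      using Z by (simp add: sum.If_cases Z(2)[THEN Int_absorb2] Z(2)[THEN Int_absorb1])
    finally have card: "nat \<lfloor>measure N D\<rfloor> = card Z" by (simp add: measure_def)
    have "(\<Sum>S\<in>cell_choices k m. \<Prod>i<k. emeasure N (cell m (S i)))
        = (\<Sum>S\<in>cell_choices k m. if S \<in> {..<k} \<rightarrow>\<^sub>E Z then 1 else 0)"
    proof (intro sum.cong refl)
      fix S assume S: "S \<in> cell_choices k m"
      then have "(\<Prod>i<k. emeasure N (cell m (S i))) = (\<Prod>i<k. if S i \<in> Z then 1 else 0)"
        by (intro prod.cong refl one) (auto simp: cell_choices_def PiE_iff)
      also have "\<dots> = (if S \<in> {..<k} \<rightarrow>\<^sub>E Z then 1 else 0)"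
      proof (cases "S \<in> {..<k} \<rightarrow>\<^sub>E Z")
        case True
        then show ?thesis by (auto simp: PiE_iff intro!: prod.neutral)
      next
        case False
        then obtain i where "i < k" "S i \<notin> Z" using S by (auto simp: cell_choices_def PiE_iff)
        then show ?thesis using False by (auto intro!: prod_zero)
      qed
      finally show "(\<Prod>i<k. emeasure N (cell m (S i))) = (if S \<in> {..<k} \<rightarrow>\<^sub>E Z then 1 else 0)" .
    qed
    also have "\<dots> = of_nat (card (cell_choices k m \<inter> ({..<k} \<rightarrow>\<^sub>E Z)))"
      using finite_cell_choices by (simp add: sum.If_cases)
    also have "cell_choices k m \<inter> ({..<k} \<rightarrow>\<^sub>E Z) = {S \<in> {..<k} \<rightarrow>\<^sub>E Z. inj_on S {..<k}}"
      using PiE_mono[of "{..<k}" "\<lambda>_. Z" "\<lambda>_. Pow {..<m}"] Z(2) unfolding cell_choices_def by blast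
    also have "card \<dots> = fact k * (card Z choose k)"
      using card_inj_on_subset_funcset[of "{..<k}" Z "{..<k}"] Z(1) by (simp add: falling_factorial_binomial)
    finally show ?case by (simp add: card)
  qed
qed

text \<open>Joint intensities are specified on boxes with disjoint sides only. Summing over all boxes formed by
distinct cells gives, on both sides, the mass of \<open>distinct_cells k m\<close>: under the random product
measure, and under the measure with density \<open>\<rho> k\<close>. Both masses increase with \<open>m\<close>, and the
random one ends up at the falling factorial of the number of points because the process is simple.
Simplicity also explains why the right-hand side is restricted to tuples of distinct points.\<close>

lemma factorial_moment:
  assumes P: "simple_point_process P X" and \<rho>: "joint_intensities P X \<mu> \<rho>"
    and sets: "sets \<mu> = sets borel" and sf: "sigma_finite_measure \<mu>"
    and fin: "AE \<omega> in P. emeasure (X \<omega>) D < \<infinity>" and k: "1 \<le> k"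
  shows "(\<integral>\<^sup>+ \<omega>. of_nat (fact k * (nat \<lfloor>measure (X \<omega>) D\<rfloor> choose k)) \<partial>P)
     = (\<integral>\<^sup>+ x\<in>{x \<in> {..<k} \<rightarrow>\<^sub>E D. inj_on x {..<k}}. ennreal (\<rho> k x) \<partial>(\<Pi>\<^sub>M i\<in>{..<k}. \<mu>))"
proof -
  let ?M = "\<Pi>\<^sub>M i\<in>{..<k}. \<mu>"
  have pp0: "point_process P X" and simple: "AE \<omega> in P. \<not> (\<exists>x. emeasure (X \<omega>) {x} > 1)"
    using P unfolding simple_point_process_def by blast+
  note pp = pp0[unfolded point_process_def, THEN conjunct2]
  note pp\<omega> = pp[THEN conjunct1, THEN bspec]
  have X_sets: "sets (X \<omega>) = sets borel" if "\<omega> \<in> space P" for \<omega>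
    using pp\<omega>[OF that, THEN conjunct1] unfolding radon_measure_def by (rule conjunct1)
  note X_sf = pp\<omega>[THEN conjunct2, THEN conjunct1]
    and X_int = pp\<omega>[THEN conjunct2, THEN conjunct2, THEN bspec]
    and meas = pp[THEN conjunct2, THEN bspec]
  have M_sets: "sets ?M = sets (\<Pi>\<^sub>M i\<in>{..<k}. borel)"
    by (intro sets_PiM_cong) (auto simp: sets)
  have \<rho>m: "\<rho> k \<in> borel_measurable ?M" using \<rho> k by (simp add: joint_intensities_def)
  define \<nu> where "\<nu> = density ?M (\<lambda>x. ennreal (\<rho> k x))"
  have \<nu>_sets: "sets \<nu> = sets (\<Pi>\<^sub>M i\<in>{..<k}. borel)" by (simp add: \<nu>_def M_sets)
  define T where "T m \<omega> = (\<Sum>S\<in>cell_choices k m. \<Prod>i<k. emeasure (X \<omega>) (cell m (S i)))" for m \<omega>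
  have prod_meas: "(\<lambda>\<omega>. \<Prod>i<k. emeasure (X \<omega>) (cell m (S i))) \<in> borel_measurable P" for m S
    by (intro borel_measurable_prod_ennreal meas cell_measurable)
  have T_meas: "T m \<in> borel_measurable P" for m
    unfolding T_def by (intro borel_measurable_sum prod_meas)
  have T_eq: "T m \<omega> = emeasure (\<Pi>\<^sub>M i\<in>{..<k}. X \<omega>) (distinct_cells k m)" if \<omega>: "\<omega> \<in> space P" for m \<omega>
  proof -
    interpret product_sigma_finite "\<lambda>_::nat. X \<omega>"
      using X_sf[OF \<omega>] by (simp add: product_sigma_finite_def)
    have "sets (\<Pi>\<^sub>M i\<in>{..<k}. X \<omega>) = sets (\<Pi>\<^sub>M i\<in>{..<k}. borel)"
      by (intro sets_PiM_cong refl X_sets \<omega>)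
    then show ?thesis
      unfolding T_def
      by (subst emeasure_distinct_cells) (simp_all add: emeasure_PiM cell_measurable X_sets[OF \<omega>])
  qed
  have T_int: "(\<integral>\<^sup>+ \<omega>. T m \<omega> \<partial>P) = emeasure \<nu> (distinct_cells k m)" for m
  proof -
    have "(\<integral>\<^sup>+ \<omega>. T m \<omega> \<partial>P) = (\<Sum>S\<in>cell_choices k m. \<integral>\<^sup>+ \<omega>. (\<Prod>i<k. emeasure (X \<omega>) (cell m (S i))) \<partial>P)"
      unfolding T_def by (intro nn_integral_sum prod_meas)
    also have "\<dots> = (\<Sum>S\<in>cell_choices k m. emeasure \<nu> (\<Pi>\<^sub>E i\<in>{..<k}. cell m (S i)))"
    proof (intro sum.cong refl)
      fix S assume S: "S \<in> cell_choices k m"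
      have "disjoint_family_on (\<lambda>i. cell m (S i)) {..<k}"
        unfolding disjoint_family_on_def
        by (intro ballI impI cells_disjoint) (use S in \<open>auto simp: cell_choices_def dest: inj_onD\<close>)
      then have "(\<integral>\<^sup>+ \<omega>. (\<Prod>i<k. emeasure (X \<omega>) (cell m (S i))) \<partial>P)
         = (\<integral>\<^sup>+ x\<in>(\<Pi>\<^sub>E i\<in>{..<k}. cell m (S i)). ennreal (\<rho> k x) \<partial>?M)"
        using \<rho> k cell_measurable by (auto simp: joint_intensities_def)
      also have "\<dots> = emeasure \<nu> (\<Pi>\<^sub>E i\<in>{..<k}. cell m (S i))"
        unfolding \<nu>_def using \<rho>m cell_box_measurable[of k m S] by (subst emeasure_density) (auto simp: M_sets)
      finally show "(\<integral>\<^sup>+ \<omega>. (\<Prod>i<k. emeasure (X \<omega>) (cell m (S i))) \<partial>P) = emeasure \<nu> (\<Pi>\<^sub>E i\<in>{..<k}. cell m (S i))" .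
    qed
    also have "\<dots> = emeasure \<nu> (distinct_cells k m)"
      by (rule emeasure_distinct_cells[OF \<nu>_sets, symmetric])
    finally show ?thesis .
  qed
  have T_mono: "T m \<omega> \<le> T (Suc m) \<omega>" if "\<omega> \<in> space P" for m \<omega>
    unfolding T_eq[OF that] 
  proof (rule emeasure_mono)
    show "distinct_cells k m \<subseteq> distinct_cells k (Suc m)" using incseq_distinct_cells by (rule incseq_SucD)
    have "sets (\<Pi>\<^sub>M i\<in>{..<k}. X \<omega>) = sets (\<Pi>\<^sub>M i\<in>{..<k}. borel)"
      by (intro sets_PiM_cong refl X_sets that)
    then show "distinct_cells k (Suc m) \<in> sets (\<Pi>\<^sub>M i\<in>{..<k}. X \<omega>)" using distinct_cells_measurable by simp
  qed
  have "AE \<omega> in P. of_nat (fact k * (nat \<lfloor>measure (X \<omega>) D\<rfloor> choose k)) = (SUP m. T m \<omega>)"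
    using fin simple AE_space
  proof eventually_elim
    case (elim \<omega>)
    have inc: "incseq (\<lambda>m. T m \<omega>)" using T_mono[OF elim(3)] by (rule incseq_SucI)
    have "\<forall>\<^sub>F m in sequentially. T m \<omega> = of_nat (fact k * (nat \<lfloor>measure (X \<omega>) D\<rfloor> choose k))"
      unfolding T_def
      by (rule sum_cell_products_eventually[OF X_sets X_sf X_int[OF elim(3)]])
         (use elim in \<open>auto simp: not_less\<close>)
    then have "(\<lambda>m. T m \<omega>) \<longlonglongrightarrow> of_nat (fact k * (nat \<lfloor>measure (X \<omega>) D\<rfloor> choose k))"
      by (rule tendsto_eventually)
    then show ?case using LIMSEQ_unique[OF _ LIMSEQ_SUP[OF inc]] by blast
  qed
  then have "(\<integral>\<^sup>+ \<omega>. of_nat (fact k * (nat \<lfloor>measure (X \<omega>) D\<rfloor> choose k)) \<partial>P) = (\<integral>\<^sup>+ \<omega>. (SUP m. T m \<omega>) \<partial>P)"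
    by (rule nn_integral_cong_AE)
  also have "\<dots> = (SUP m. \<integral>\<^sup>+ \<omega>. T m \<omega> \<partial>P)"
    by (rule nn_integral_monotone_convergence_SUP_AE) (use T_mono T_meas in auto)
  also have "\<dots> = (SUP m. emeasure \<nu> (distinct_cells k m))" by (simp add: T_int)
  also have "\<dots> = emeasure \<nu> (\<Union>m. distinct_cells k m)"
    by (rule SUP_emeasure_incseq) (auto simp: \<nu>_sets distinct_cells_measurable incseq_distinct_cells)
  also have "\<dots> = (\<integral>\<^sup>+ x\<in>(\<Union>m. distinct_cells k m). ennreal (\<rho> k x) \<partial>?M)"
    unfolding \<nu>_def using \<rho>m distinct_cells_measurable
    by (subst emeasure_density) (auto simp: M_sets intro!: sets.countable_UN)
  finally show ?thesis unfolding UN_distinct_cells .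
qed

end

section \<open>Square-integrable functions\<close>

definition L2_norm_sq :: "'a measure \<Rightarrow> ('a \<Rightarrow> complex) \<Rightarrow> real" where
  "L2_norm_sq \<mu> f = (LINT x|\<mu>. (cmod (f x))\<^sup>2)"

lemma L2_measurable: "f \<in> L2 \<mu> \<Longrightarrow> f \<in> borel_measurable \<mu>"
  by (simp add: L2_def)

lemma cnj_measurable [measurable (raw)]:
  "f \<in> borel_measurable M \<Longrightarrow> (\<lambda>x. cnj (f x)) \<in> borel_measurable M"
  by (rule measurable_compose[where N = borel, OF _ borel_measurable_continuous_onI]) (auto intro: continuous_intros)

lemma L2_norm_sq_nonneg: "0 \<le> L2_norm_sq \<mu> f"
  by (simp add: L2_norm_sq_def)

lemma L2_nn_integral:
  "f \<in> L2 \<mu> \<Longrightarrow> (\<integral>\<^sup>+ x. ennreal ((cmod (f x))\<^sup>2) \<partial>\<mu>) = ennreal (L2_norm_sq \<mu> f)"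
  unfolding L2_norm_sq_def L2_def by (simp add: nn_integral_eq_integral)

lemma L2_bounded_by:
  assumes "f \<in> borel_measurable \<mu>" "g \<in> L2 \<mu>" "h \<in> L2 \<mu>"
    and "\<And>x. (cmod (f x))\<^sup>2 \<le> c * ((cmod (g x))\<^sup>2 + (cmod (h x))\<^sup>2)"
  shows "f \<in> L2 \<mu>"
proof -
  have "integrable \<mu> (\<lambda>x. c * ((cmod (g x))\<^sup>2 + (cmod (h x))\<^sup>2))"
    using assms(2,3) by (auto simp: L2_def)
  then have "integrable \<mu> (\<lambda>x. (cmod (f x))\<^sup>2)"
    by (rule Bochner_Integration.integrable_bound)
       (use assms(1) in \<open>auto intro: order_trans[OF assms(4) abs_ge_self]\<close>)
  then show ?thesis using assms(1) by (simp add: L2_def)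
qed

lemma L2_add:
  assumes "f \<in> L2 \<mu>" "g \<in> L2 \<mu>"
  shows "(\<lambda>x. f x + g x) \<in> L2 \<mu>"
proof (rule L2_bounded_by[OF _ assms])
  show "(cmod (f x + g x))\<^sup>2 \<le> 2 * ((cmod (f x))\<^sup>2 + (cmod (g x))\<^sup>2)" for x
  proof -
    have "(cmod (f x + g x))\<^sup>2 \<le> (cmod (f x) + cmod (g x))\<^sup>2"
      by (intro power_mono norm_triangle_ineq) simp
    then show ?thesis
      using sum_squares_bound[of "cmod (f x)" "cmod (g x)"] by (simp add: power2_sum)
  qed
qed (use assms in \<open>auto simp: L2_def\<close>)

lemma L2_scale: "f \<in> L2 \<mu> \<Longrightarrow> (\<lambda>x. c * f x) \<in> L2 \<mu>"
  by (auto simp: L2_def norm_mult power_mult_distrib)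

lemma L2_zero: "(\<lambda>x. 0) \<in> L2 \<mu>"
  by (simp add: L2_def)

lemma L2_diff:
  assumes "f \<in> L2 \<mu>" "g \<in> L2 \<mu>"
  shows "(\<lambda>x. f x - g x) \<in> L2 \<mu>"
  using L2_add[OF assms(1) L2_scale[OF assms(2), of "-1"]] by simp

lemma L2_sum:
  assumes "\<And>i. i \<in> A \<Longrightarrow> f i \<in> L2 \<mu>"
  shows "(\<lambda>x. \<Sum>i\<in>A. f i x) \<in> L2 \<mu>"
  using assms by (induction A rule: infinite_finite_induct) (auto intro: L2_zero L2_add)

lemma L2_indicator:
  assumes "f \<in> L2 \<mu>" "A \<in> sets \<mu>"
  shows "(\<lambda>x. indicator A x * f x) \<in> L2 \<mu>"
  by (rule L2_bounded_by[OF _ assms(1) assms(1), where c = 1])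
     (use assms in \<open>auto simp: L2_def indicator_def\<close>)

lemma integrable_L2_inner:
  assumes "f \<in> L2 \<mu>" "g \<in> L2 \<mu>"
  shows "integrable \<mu> (\<lambda>x. f x * cnj (g x))"
proof (rule Bochner_Integration.integrable_bound)
  show "integrable \<mu> (\<lambda>x. (cmod (f x))\<^sup>2 + (cmod (g x))\<^sup>2)"
    using assms by (auto simp: L2_def)
  show "AE x in \<mu>. norm (f x * cnj (g x)) \<le> norm ((cmod (f x))\<^sup>2 + (cmod (g x))\<^sup>2)"
  proof (rule AE_I2)
    fix x
    have "2 * (cmod (f x) * cmod (g x)) \<le> (cmod (f x))\<^sup>2 + (cmod (g x))\<^sup>2"
      using sum_squares_bound[of "cmod (f x)" "cmod (g x)"] by simp
    moreover have "0 \<le> cmod (f x) * cmod (g x)" by simp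
    ultimately have "cmod (f x) * cmod (g x) \<le> (cmod (f x))\<^sup>2 + (cmod (g x))\<^sup>2" by linarith
    then show "norm (f x * cnj (g x)) \<le> norm ((cmod (f x))\<^sup>2 + (cmod (g x))\<^sup>2)"
      by (simp add: norm_mult)
  qed
qed (use assms in \<open>auto simp: L2_def\<close>)

lemma L2_inner_cnj: "cnj (L2_inner \<mu> f g) = L2_inner \<mu> g f"
  unfolding L2_inner_def by (subst Bochner_Integration.integral_cnj[symmetric]) (simp add: mult.commute)

lemma L2_inner_mult_swap:
  "L2_inner \<mu> f g * L2_inner \<mu> g f = complex_of_real ((cmod (L2_inner \<mu> f g))\<^sup>2)"
  by (metis L2_inner_cnj complex_norm_square)

lemma L2_inner_self: "L2_inner \<mu> f f = complex_of_real (L2_norm_sq \<mu> f)"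
  unfolding L2_inner_def L2_norm_sq_def
  by (simp add: complex_norm_square[symmetric] flip: integral_complex_of_real)

lemma L2_inner_diff_left:
  assumes "f \<in> L2 \<mu>" "g \<in> L2 \<mu>" "h \<in> L2 \<mu>"
  shows "L2_inner \<mu> (\<lambda>x. f x - g x) h = L2_inner \<mu> f h - L2_inner \<mu> g h"
  unfolding L2_inner_def using integrable_L2_inner[OF assms(1,3)] integrable_L2_inner[OF assms(2,3)]
  by (simp add: left_diff_distrib)

lemma L2_inner_sum_left:
  assumes "\<And>i. i \<in> A \<Longrightarrow> f i \<in> L2 \<mu>" "h \<in> L2 \<mu>"
  shows "L2_inner \<mu> (\<lambda>x. \<Sum>i\<in>A. c i * f i x) h = (\<Sum>i\<in>A. c i * L2_inner \<mu> (f i) h)"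
  unfolding L2_inner_def using integrable_L2_inner[OF assms(1) assms(2)]
  by (simp add: sum_distrib_right mult.assoc)

text \<open>\<open>g\<close> is the component of \<open>f\<close> orthogonal to finitely many \<open>\<psi> i\<close>. Its squared norm \<open>r\<close> is
the defect in Bessel's inequality and equals the inner product of \<open>f\<close> with \<open>g\<close>.\<close>

lemma L2_residual:
  fixes \<psi> :: "'i \<Rightarrow> 'a \<Rightarrow> complex"
  assumes f: "f \<in> L2 \<mu>" and A: "finite A" "\<And>i. i \<in> A \<Longrightarrow> \<psi> i \<in> L2 \<mu>"
    and on: "\<And>i j. i \<in> A \<Longrightarrow> j \<in> A \<Longrightarrow> L2_inner \<mu> (\<psi> i) (\<psi> j) = (if i = j then 1 else 0)"
  defines "g \<equiv> (\<lambda>x. f x - (\<Sum>i\<in>A. L2_inner \<mu> f (\<psi> i) * \<psi> i x))"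
    and "r \<equiv> L2_norm_sq \<mu> f - (\<Sum>i\<in>A. (cmod (L2_inner \<mu> f (\<psi> i)))\<^sup>2)"
  shows "g \<in> L2 \<mu>" "\<And>i. i \<in> A \<Longrightarrow> L2_inner \<mu> g (\<psi> i) = 0"
    "L2_inner \<mu> f g = complex_of_real r" "L2_norm_sq \<mu> g = r"
proof -
  define S where "S = (\<lambda>x. \<Sum>i\<in>A. L2_inner \<mu> f (\<psi> i) * \<psi> i x)"
  have S: "S \<in> L2 \<mu>" unfolding S_def by (intro L2_sum L2_scale A)
  have gS: "g = (\<lambda>x. f x - S x)" by (simp add: g_def S_def)
  show g: "g \<in> L2 \<mu>" unfolding gS by (rule L2_diff[OF f S])
  show orth: "L2_inner \<mu> g (\<psi> i) = 0" if i: "i \<in> A" for i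
  proof -
    have "L2_inner \<mu> S (\<psi> i) = (\<Sum>j\<in>A. L2_inner \<mu> f (\<psi> j) * (if j = i then 1 else 0))"
      unfolding S_def by (subst L2_inner_sum_left) (auto simp: A i on intro!: sum.cong)
    also have "\<dots> = (\<Sum>j\<in>A. if j = i then L2_inner \<mu> f (\<psi> j) else 0)"
      by (intro sum.cong) auto
    also have "\<dots> = L2_inner \<mu> f (\<psi> i)" using A(1) i by simp
    finally show ?thesis unfolding gS by (subst L2_inner_diff_left[OF f S A(2)[OF i]]) simp
  qed
  have "L2_inner \<mu> S g = (\<Sum>i\<in>A. L2_inner \<mu> f (\<psi> i) * L2_inner \<mu> (\<psi> i) g)"
    unfolding S_def by (rule L2_inner_sum_left[OF A(2) g])
  also have "\<dots> = 0"
    using orth by (intro sum.neutral ballI) (metis L2_inner_cnj complex_cnj_zero mult_zero_right)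
  finally have Sg: "L2_inner \<mu> S g = 0" .
  have "L2_inner \<mu> S f = (\<Sum>i\<in>A. L2_inner \<mu> f (\<psi> i) * L2_inner \<mu> (\<psi> i) f)"
    unfolding S_def by (rule L2_inner_sum_left[OF A(2) f])
  also have "\<dots> = complex_of_real (\<Sum>i\<in>A. (cmod (L2_inner \<mu> f (\<psi> i)))\<^sup>2)"
    by (simp add: L2_inner_mult_swap)
  finally have "L2_inner \<mu> g f = complex_of_real r"
    unfolding gS r_def by (subst L2_inner_diff_left[OF f S f]) (simp add: L2_inner_self)
  then show fg: "L2_inner \<mu> f g = complex_of_real r"
    by (metis L2_inner_cnj complex_cnj_complex_of_real)
  have "L2_inner \<mu> g g = L2_inner \<mu> f g - L2_inner \<mu> S g"
    by (subst (1) gS) (rule L2_inner_diff_left[OF f S g])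
  then show "L2_norm_sq \<mu> g = r"
    by (simp add: fg Sg L2_inner_self)
qed

section \<open>Expansions of kernels\<close>

definition expansion_sum :: "nat set \<Rightarrow> (nat \<Rightarrow> real) \<Rightarrow> (nat \<Rightarrow> 'a \<Rightarrow> complex) \<Rightarrow> nat \<Rightarrow> 'a \<Rightarrow> 'a \<Rightarrow> complex" where
  "expansion_sum J \<eta> f N x y = (\<Sum>k\<in>J \<inter> {..<N}. complex_of_real (\<eta> k) * f k x * cnj (f k y))"

definition expansion_error ::
  "'a measure \<Rightarrow> ('a \<Rightarrow> 'a \<Rightarrow> complex) \<Rightarrow> nat set \<Rightarrow> (nat \<Rightarrow> real) \<Rightarrow> (nat \<Rightarrow> 'a \<Rightarrow> complex) \<Rightarrow> nat \<Rightarrow> ennreal" where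
  "expansion_error \<mu> K J \<eta> f N =
     (\<integral>\<^sup>+ (x, y). ennreal ((cmod (K x y - expansion_sum J \<eta> f N x y))\<^sup>2) \<partial>(\<mu> \<Otimes>\<^sub>M \<mu>))"

text \<open>An eigenvalue decomposition without orthonormality. The weaker notion is needed because restricting
a kernel to a smaller set preserves the expansion but destroys the orthogonality.\<close>

definition kernel_expansion ::
  "'a measure \<Rightarrow> ('a \<Rightarrow> 'a \<Rightarrow> complex) \<Rightarrow> nat set \<Rightarrow> (nat \<Rightarrow> real) \<Rightarrow> (nat \<Rightarrow> 'a \<Rightarrow> complex) \<Rightarrow> bool" where
  "kernel_expansion \<mu> K J \<eta> f \<longleftrightarrow>
     (\<lambda>(x, y). K x y) \<in> borel_measurable (\<mu> \<Otimes>\<^sub>M \<mu>) \<and>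
     (\<forall>k\<in>J. \<eta> k > 0 \<and> f k \<in> L2 \<mu>) \<and> expansion_error \<mu> K J \<eta> f \<longlonglongrightarrow> 0"

lemma eigen_decomposition_iff:
  "eigen_decomposition \<mu> K J \<eta> \<phi> \<longleftrightarrow> kernel_expansion \<mu> K J \<eta> \<phi> \<and>
     (\<forall>j\<in>J. \<forall>k\<in>J. L2_inner \<mu> (\<phi> j) (\<phi> k) = (if j = k then 1 else 0))"
  unfolding eigen_decomposition_def kernel_expansion_def expansion_error_def[abs_def] expansion_sum_def
  by auto

lemma kernel_expansionD:
  assumes "kernel_expansion \<mu> K J \<eta> f"
  shows "(\<lambda>z. K (fst z) (snd z)) \<in> borel_measurable (\<mu> \<Otimes>\<^sub>M \<mu>)"
    "\<And>k. k \<in> J \<Longrightarrow> 0 < \<eta> k" "\<And>k. k \<in> J \<Longrightarrow> f k \<in> L2 \<mu>" "expansion_error \<mu> K J \<eta> f \<longlonglongrightarrow> 0"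
  using assms by (auto simp: kernel_expansion_def case_prod_beta')

lemma kernel_expansion_cut:
  assumes e: "kernel_expansion \<mu> (cut_kernel D K) J \<eta> f" and C: "C \<subseteq> D" "C \<in> sets \<mu>"
  shows "kernel_expansion \<mu> (cut_kernel C K) J \<eta> (\<lambda>k x. indicator C x * f k x)"
proof -
  note [measurable] = kernel_expansionD(1)[OF e] C(2)
  have cut: "cut_kernel C K x y = indicator C x * cut_kernel D K x y * indicator C y" for x y
    using C(1) by (auto simp: cut_kernel_def indicator_def)
  have sum: "expansion_sum J \<eta> (\<lambda>k x. indicator C x * f k x) N x y
     = indicator C x * expansion_sum J \<eta> f N x y * indicator C y" for N x y
    by (simp add: expansion_sum_def indicator_def)
  have "expansion_error \<mu> (cut_kernel C K) J \<eta> (\<lambda>k x. indicator C x * f k x) N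
     \<le> expansion_error \<mu> (cut_kernel D K) J \<eta> f N" for N
    unfolding expansion_error_def sum cut
    by (intro nn_integral_mono) (auto simp: indicator_def)
  then have "expansion_error \<mu> (cut_kernel C K) J \<eta> (\<lambda>k x. indicator C x * f k x) \<longlonglongrightarrow> 0"
    by (intro tendsto_sandwich[OF always_eventually always_eventually tendsto_const kernel_expansionD(4)[OF e]]) auto
  moreover have "(\<lambda>z. cut_kernel C K (fst z) (snd z)) \<in> borel_measurable (\<mu> \<Otimes>\<^sub>M \<mu>)"
    unfolding cut by measurable
  ultimately show ?thesis
    using kernel_expansionD(2,3)[OF e] C(2)
    by (simp add: kernel_expansion_def L2_indicator case_prod_beta')
qed

text \<open>The sesquilinear form of the operator, written as an integral over the product space. It makes sense
for every square-integrable kernel and depends continuously on it in \<open>L\<^sup>2\<close>.\<close>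

definition kernel_form :: "'a measure \<Rightarrow> ('a \<Rightarrow> 'a \<Rightarrow> complex) \<Rightarrow> ('a \<Rightarrow> complex) \<Rightarrow> ('a \<Rightarrow> complex) \<Rightarrow> complex" where
  "kernel_form \<mu> K u v = (LINT z|(\<mu> \<Otimes>\<^sub>M \<mu>). K (fst z) (snd z) * cnj (u (fst z)) * v (snd z))"

context sigma_finite_measure
begin

lemma nn_integral_tensor:
  assumes u: "u \<in> L2 M" and v: "v \<in> L2 M"
  shows "(\<integral>\<^sup>+ z. ennreal ((cmod (u (fst z) * v (snd z)))\<^sup>2) \<partial>(M \<Otimes>\<^sub>M M))
    = ennreal (L2_norm_sq M u * L2_norm_sq M v)"
proof -
  note [measurable] = L2_measurable[OF u] L2_measurable[OF v]
  have "(\<integral>\<^sup>+ z. ennreal ((cmod (u (fst z) * v (snd z)))\<^sup>2) \<partial>(M \<Otimes>\<^sub>M M))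
     = (\<integral>\<^sup>+ x. \<integral>\<^sup>+ y. ennreal ((cmod (u x))\<^sup>2) * ennreal ((cmod (v y))\<^sup>2) \<partial>M \<partial>M)"
    by (subst nn_integral_fst[symmetric]) (auto simp: norm_mult power_mult_distrib ennreal_mult)
  also have "\<dots> = ennreal (L2_norm_sq M u * L2_norm_sq M v)"
    by (simp add: nn_integral_cmult nn_integral_multc L2_nn_integral[OF u] L2_nn_integral[OF v]
        ennreal_mult L2_norm_sq_nonneg)
  finally show ?thesis .
qed

lemma kernel_form_bound:
  assumes [measurable]: "(\<lambda>z. H (fst z) (snd z)) \<in> borel_measurable (M \<Otimes>\<^sub>M M)"
    and fin: "(\<integral>\<^sup>+ z. ennreal ((cmod (H (fst z) (snd z)))\<^sup>2) \<partial>(M \<Otimes>\<^sub>M M)) < \<infinity>"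
    and u: "u \<in> L2 M" and v: "v \<in> L2 M"
  shows "integrable (M \<Otimes>\<^sub>M M) (\<lambda>z. H (fst z) (snd z) * cnj (u (fst z)) * v (snd z))" (is ?int)
    and "ennreal ((cmod (kernel_form M H u v))\<^sup>2) \<le>
      (\<integral>\<^sup>+ z. ennreal ((cmod (H (fst z) (snd z)))\<^sup>2) \<partial>(M \<Otimes>\<^sub>M M)) *
      ennreal (L2_norm_sq M u * L2_norm_sq M v)" (is "_ \<le> ?B")
proof -
  note [measurable] = L2_measurable[OF u] L2_measurable[OF v]
  let ?P = "M \<Otimes>\<^sub>M M"
  let ?h = "\<lambda>z. H (fst z) (snd z) * cnj (u (fst z)) * v (snd z)"
  let ?I = "\<integral>\<^sup>+ z. ennreal (cmod (?h z)) \<partial>?P"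
  have "?I = (\<integral>\<^sup>+ z. ennreal (cmod (H (fst z) (snd z))) * ennreal (cmod (u (fst z) * v (snd z))) \<partial>?P)"
    by (intro nn_integral_cong) (simp add: norm_mult ennreal_mult mult.assoc)
  also have "\<dots>\<^sup>2 \<le> (\<integral>\<^sup>+ z. (ennreal (cmod (H (fst z) (snd z))))\<^sup>2 \<partial>?P) *
      (\<integral>\<^sup>+ z. (ennreal (cmod (u (fst z) * v (snd z))))\<^sup>2 \<partial>?P)"
    by (rule Cauchy_Schwarz_nn_integral) measurable
  also have "\<dots> = ?B"
    by (simp add: ennreal_power nn_integral_tensor[OF u v])
  finally have sq: "?I\<^sup>2 \<le> ?B" .
  have "?B < \<infinity>" using fin by (simp add: ennreal_mult_less_top)
  with sq have "?I\<^sup>2 < \<infinity>" by (rule le_less_trans)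
  then have I: "?I < \<infinity>"
    by (cases "?I") (auto simp: power2_eq_square ennreal_top_mult)
  then show ?int by (intro integrableI_bounded) measurable
  have "ennreal (cmod (kernel_form M H u v)) \<le> ?I"
    unfolding kernel_form_def by (rule integral_norm_bound_ennreal[OF \<open>?int\<close>])
  then have "(ennreal (cmod (kernel_form M H u v)))\<^sup>2 \<le> ?I\<^sup>2" by (rule power_mono) simp
  then show "ennreal ((cmod (kernel_form M H u v))\<^sup>2) \<le> ?B"
    using sq by (simp add: ennreal_power)
qed

lemma kernel_form_rank_one:
  assumes a: "a \<in> L2 M" and b: "b \<in> L2 M" and u: "u \<in> L2 M" and v: "v \<in> L2 M"
  shows "integrable (M \<Otimes>\<^sub>M M) (\<lambda>z. a (fst z) * cnj (b (snd z)) * cnj (u (fst z)) * v (snd z))"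
    and "kernel_form M (\<lambda>x y. a x * cnj (b y)) u v = L2_inner M a u * L2_inner M v b"
proof -
  interpret P: pair_sigma_finite M M ..
  note [measurable] = L2_measurable[OF a] L2_measurable[OF b] L2_measurable[OF u] L2_measurable[OF v]
  have b': "(\<lambda>y. cnj (b y)) \<in> L2 M" using b by (simp add: L2_def)
  show int: "integrable (M \<Otimes>\<^sub>M M) (\<lambda>z. a (fst z) * cnj (b (snd z)) * cnj (u (fst z)) * v (snd z))"
  proof (rule kernel_form_bound(1)[where H = "\<lambda>x y. a x * cnj (b y)", OF _ _ u v])
    show "(\<integral>\<^sup>+ z. ennreal ((cmod (a (fst z) * cnj (b (snd z))))\<^sup>2) \<partial>(M \<Otimes>\<^sub>M M)) < \<infinity>"
      by (subst nn_integral_tensor[OF a b']) simp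
  qed measurable
  have "kernel_form M (\<lambda>x y. a x * cnj (b y)) u v
     = (LINT x|M. LINT y|M. (a x * cnj (u x)) * (v y * cnj (b y)))"
    unfolding kernel_form_def using P.integral_fst'[OF int]
    by (simp add: ac_simps)
  then show "kernel_form M (\<lambda>x y. a x * cnj (b y)) u v = L2_inner M a u * L2_inner M v b"
    by (simp add: L2_inner_def)
qed

lemma expansion_sum_measurable:
  assumes "kernel_expansion M K J \<eta> f"
  shows "(\<lambda>z. expansion_sum J \<eta> f N (fst z) (snd z)) \<in> borel_measurable (M \<Otimes>\<^sub>M M)"
proof -
  have [measurable]: "f k \<in> borel_measurable M" if "k \<in> J \<inter> {..<N}" for k
    using kernel_expansionD(3)[OF assms] that by (auto dest: L2_measurable)
  show ?thesis unfolding expansion_sum_def by measurable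
qed

text \<open>Cauchy--Schwarz on the product space: the error of the form is the \<open>L\<^sup>2\<close>-error of the kernel times
the norms of the arguments. The explicit dependence on the norms matters for \<open>expansion_parseval\<close>,
where the arguments change with \<open>N\<close>.\<close>

lemma kernel_form_approx:
  assumes e: "kernel_expansion M K J \<eta> f" and fin: "expansion_error M K J \<eta> f N < \<infinity>"
    and u: "u \<in> L2 M" and v: "v \<in> L2 M"
  shows "ennreal ((cmod (kernel_form M K u v -
      (\<Sum>k\<in>J \<inter> {..<N}. complex_of_real (\<eta> k) * L2_inner M (f k) u * L2_inner M v (f k))))\<^sup>2)
    \<le> expansion_error M K J \<eta> f N * ennreal (L2_norm_sq M u * L2_norm_sq M v)"
proof -
  note [measurable] = kernel_expansionD(1)[OF e] expansion_sum_measurable[OF e]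
  define H where "H = (\<lambda>x y. K x y - expansion_sum J \<eta> f N x y)"
  have H_meas: "(\<lambda>z. H (fst z) (snd z)) \<in> borel_measurable (M \<Otimes>\<^sub>M M)"
    unfolding H_def by measurable
  have err: "(\<integral>\<^sup>+ z. ennreal ((cmod (H (fst z) (snd z)))\<^sup>2) \<partial>(M \<Otimes>\<^sub>M M)) = expansion_error M K J \<eta> f N"
    by (simp add: expansion_error_def H_def case_prod_beta')
  note H = kernel_form_bound[OF H_meas _ u v, unfolded err, OF fin]
  note r1 = kernel_form_rank_one[OF kernel_expansionD(3)[OF e] kernel_expansionD(3)[OF e] u v]
  have S_eq: "expansion_sum J \<eta> f N (fst z) (snd z) * cnj (u (fst z)) * v (snd z)
     = (\<Sum>k\<in>J \<inter> {..<N}. complex_of_real (\<eta> k) * (f k (fst z) * cnj (f k (snd z)) * cnj (u (fst z)) * v (snd z)))" for z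
    by (simp add: expansion_sum_def sum_distrib_right mult.assoc)
  have S_int: "integrable (M \<Otimes>\<^sub>M M) (\<lambda>z. expansion_sum J \<eta> f N (fst z) (snd z) * cnj (u (fst z)) * v (snd z))"
    unfolding S_eq using r1(1) by (intro Bochner_Integration.integrable_sum integrable_mult_right) auto
  have S: "kernel_form M (expansion_sum J \<eta> f N) u v
     = (\<Sum>k\<in>J \<inter> {..<N}. complex_of_real (\<eta> k) * L2_inner M (f k) u * L2_inner M v (f k))"
    unfolding kernel_form_def S_eq using r1
    by (subst Bochner_Integration.integral_sum) (auto simp: kernel_form_def mult.assoc)
  have "kernel_form M K u v
     = (LINT z|(M \<Otimes>\<^sub>M M). H (fst z) (snd z) * cnj (u (fst z)) * v (snd z)
          + expansion_sum J \<eta> f N (fst z) (snd z) * cnj (u (fst z)) * v (snd z))"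
    unfolding kernel_form_def H_def by (simp add: algebra_simps)
  also have "\<dots> = kernel_form M H u v + kernel_form M (expansion_sum J \<eta> f N) u v"
    unfolding kernel_form_def by (rule Bochner_Integration.integral_add[OF H(1) S_int])
  finally show ?thesis using H(2) by (simp add: S)
qed

lemma kernel_form_tendsto:
  assumes e: "kernel_expansion M K J \<eta> f" and u: "u \<in> L2 M" and v: "v \<in> L2 M"
  shows "(\<lambda>N. \<Sum>k\<in>J \<inter> {..<N}. complex_of_real (\<eta> k) * L2_inner M (f k) u * L2_inner M v (f k))
    \<longlonglongrightarrow> kernel_form M K u v"
proof -
  let ?S = "\<lambda>N. \<Sum>k\<in>J \<inter> {..<N}. complex_of_real (\<eta> k) * L2_inner M (f k) u * L2_inner M v (f k)"
  let ?c = "ennreal (L2_norm_sq M u * L2_norm_sq M v)"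
  have "\<forall>\<^sub>F N in sequentially. expansion_error M K J \<eta> f N < \<infinity>"
    using kernel_expansionD(4)[OF e] by (rule order_tendstoD) simp
  then have ev: "\<forall>\<^sub>F N in sequentially. ennreal ((cmod (kernel_form M K u v - ?S N))\<^sup>2) \<le> expansion_error M K J \<eta> f N * ?c"
    by eventually_elim (rule kernel_form_approx[OF e _ u v])
  have "(\<lambda>N. expansion_error M K J \<eta> f N * ?c) \<longlonglongrightarrow> 0 * ?c"
    by (intro tendsto_mult_ennreal kernel_expansionD(4)[OF e] tendsto_const) auto
  then have lim: "(\<lambda>N. expansion_error M K J \<eta> f N * ?c) \<longlonglongrightarrow> ennreal 0" by simp
  have "(\<lambda>N. ennreal ((cmod (kernel_form M K u v - ?S N))\<^sup>2)) \<longlonglongrightarrow> ennreal 0"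
    by (rule tendsto_sandwich[where f = "\<lambda>_. ennreal 0", OF _ ev tendsto_const lim]) simp
  then have "(\<lambda>N. (cmod (kernel_form M K u v - ?S N))\<^sup>2) \<longlonglongrightarrow> 0"
    by (subst (asm) tendsto_ennreal_iff) auto
  then have "(\<lambda>N. sqrt ((cmod (kernel_form M K u v - ?S N))\<^sup>2)) \<longlonglongrightarrow> sqrt 0"
    by (rule tendsto_real_sqrt)
  then have "(\<lambda>N. kernel_form M K u v - ?S N) \<longlonglongrightarrow> 0"
    by (subst tendsto_norm_zero_iff[symmetric]) simp
  from tendsto_diff[OF tendsto_const this, of "kernel_form M K u v"] show ?thesis by simp
qed

end

section \<open>Uniqueness of the trace and pointwise convergence\<close>

lemma sum_restrict_lessThan:
  "(\<Sum>k\<in>J \<inter> {..<N}. g k) = (\<Sum>k<N::nat. if k \<in> J then g k else 0)"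
  by (simp add: Int_commute[of J] sum.inter_restrict)

lemma ennreal_suminf_swap:
  fixes a :: "nat \<Rightarrow> nat \<Rightarrow> ennreal"
  shows "(\<Sum>i. \<Sum>j. a i j) = (\<Sum>j. \<Sum>i. a i j)"
  using nn_integral_suminf[of "\<lambda>j i. a i j" "count_space UNIV"]
  by (simp add: nn_integral_count_space_nat)

lemma eigenfunction_norm:
  assumes "eigen_decomposition \<mu> K J \<eta> \<phi>" "k \<in> J"
  shows "L2_norm_sq \<mu> (\<phi> k) = 1"
proof -
  have "L2_inner \<mu> (\<phi> k) (\<phi> k) = 1" using assms by (auto simp: eigen_decomposition_iff)
  then show ?thesis by (simp add: L2_inner_self)
qed

lemma eigen_trace_eq:
  assumes "eigen_decomposition \<mu> K J \<eta> \<phi>"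
  shows "(\<Sum>k. ennreal (if k \<in> J then \<eta> k * L2_norm_sq \<mu> (\<phi> k) else 0)) = (\<Sum>k. ennreal (if k \<in> J then \<eta> k else 0))"
  using eigenfunction_norm[OF assms] by (simp cong: if_cong)

context sigma_finite_measure
begin

lemma kernel_form_diag_sums:
  assumes e: "kernel_expansion M K J \<eta> f" and g: "g \<in> L2 M"
  shows "(\<lambda>k. if k \<in> J then \<eta> k * (cmod (L2_inner M (f k) g))\<^sup>2 else 0) sums Re (kernel_form M K g g)"
proof -
  have eq: "complex_of_real (\<eta> k) * L2_inner M (f k) g * L2_inner M g (f k)
     = complex_of_real (\<eta> k * (cmod (L2_inner M (f k) g))\<^sup>2)" for k
    by (simp add: L2_inner_mult_swap mult.assoc)
  have "(\<lambda>N. Re (\<Sum>k\<in>J \<inter> {..<N}. complex_of_real (\<eta> k) * L2_inner M (f k) g * L2_inner M g (f k)))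
      \<longlonglongrightarrow> Re (kernel_form M K g g)"
    by (intro tendsto_Re kernel_form_tendsto[OF e g g])
  then show ?thesis
    unfolding eq of_real_sum[symmetric] Re_complex_of_real sums_def sum_restrict_lessThan .
qed

lemma eigenvalue_eq_form:
  assumes e: "eigen_decomposition M K I \<theta> \<psi>" and j: "j \<in> I"
  shows "Re (kernel_form M K (\<psi> j) (\<psi> j)) = \<theta> j"
proof -
  have k: "kernel_expansion M K I \<theta> \<psi>" and on: "\<And>i. i \<in> I \<Longrightarrow> L2_inner M (\<psi> i) (\<psi> j) = (if i = j then 1 else 0)"
    using e j by (auto simp: eigen_decomposition_iff)
  have "(\<lambda>k. if k \<in> I then \<theta> k * (cmod (L2_inner M (\<psi> k) (\<psi> j)))\<^sup>2 else 0) = (\<lambda>k. if k = j then \<theta> k else 0)"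
    using on j by auto
  then have "(\<lambda>k. if k = j then \<theta> k else 0) sums Re (kernel_form M K (\<psi> j) (\<psi> j))"
    using kernel_form_diag_sums[OF k kernel_expansionD(3)[OF k j]] by simp
  then show ?thesis using sums_single[of j \<theta>] sums_unique2 by blast
qed

text \<open>The eigenfunctions \<open>\<psi>\<close> need not be complete, but they exhaust every \<open>f k\<close> that occurs in an
expansion of the same kernel with positive weights. Let \<open>g N\<close> be the part of \<open>f k\<close> orthogonal to
the first \<open>N\<close> eigenfunctions and \<open>r N\<close> its squared norm. The truncated eigenvalue expansion
annihilates \<open>g N\<close>, so the form at \<open>g N\<close> tends to \<open>0\<close>. On the other hand it is at least
\<open>\<eta> k * (r N)\<^sup>2\<close>, the contribution of \<open>f k\<close> in the other expansion. Thus \<open>r N\<close> tends to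
\<open>0\<close>. Working with finite residuals avoids projections onto infinite-dimensional subspaces.\<close>

lemma expansion_parseval:
  assumes e: "eigen_decomposition M K I \<theta> \<psi>" and e': "kernel_expansion M K J \<eta> f" and k: "k \<in> J"
  shows "(\<lambda>j. if j \<in> I then (cmod (L2_inner M (f k) (\<psi> j)))\<^sup>2 else 0) sums L2_norm_sq M (f k)"
proof -
  have ke: "kernel_expansion M K I \<theta> \<psi>"
    and on: "\<And>i j. i \<in> I \<Longrightarrow> j \<in> I \<Longrightarrow> L2_inner M (\<psi> i) (\<psi> j) = (if i = j then 1 else 0)"
    using e by (auto simp: eigen_decomposition_iff)
  note fk = kernel_expansionD(3)[OF e' k] and \<eta>k = kernel_expansionD(2)[OF e' k]
  let ?A = "\<lambda>N. I \<inter> {..<N}"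
  define g where "g N = (\<lambda>x. f k x - (\<Sum>i\<in>?A N. L2_inner M (f k) (\<psi> i) * \<psi> i x))" for N
  define r where "r N = L2_norm_sq M (f k) - (\<Sum>i\<in>?A N. (cmod (L2_inner M (f k) (\<psi> i)))\<^sup>2)" for N
  define q where "q = L2_norm_sq M (f k)"
  have res: "g N \<in> L2 M" "\<And>i. i \<in> ?A N \<Longrightarrow> L2_inner M (g N) (\<psi> i) = 0"
    "L2_inner M (f k) (g N) = complex_of_real (r N)" "L2_norm_sq M (g N) = r N" for N
  proof -
    have A: "finite (?A N)" "\<And>i. i \<in> ?A N \<Longrightarrow> \<psi> i \<in> L2 M"
      "\<And>i j. i \<in> ?A N \<Longrightarrow> j \<in> ?A N \<Longrightarrow> L2_inner M (\<psi> i) (\<psi> j) = (if i = j then 1 else 0)"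
      using kernel_expansionD(3)[OF ke] on by auto
    note R = L2_residual[OF fk A]
    show "g N \<in> L2 M" unfolding g_def by (rule R(1))
    show "L2_inner M (g N) (\<psi> i) = 0" if "i \<in> ?A N" for i unfolding g_def by (rule R(2)) (use that in auto)
    show "L2_inner M (f k) (g N) = complex_of_real (r N)" unfolding g_def r_def by (rule R(3))
    show "L2_norm_sq M (g N) = r N" unfolding g_def r_def by (rule R(4))
  qed
  have r: "0 \<le> r N" "r N \<le> q" for N
    using L2_norm_sq_nonneg[of M "g N"] unfolding res(4) by (simp_all add: r_def q_def sum_nonneg)
  have le: "ennreal ((\<eta> k * (r N)\<^sup>2)\<^sup>2) \<le> expansion_error M K I \<theta> \<psi> N * ennreal (q * q)"
    if fin: "expansion_error M K I \<theta> \<psi> N < \<infinity>" for N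
  proof -
    have zero: "(\<Sum>i\<in>?A N. complex_of_real (\<theta> i) * L2_inner M (\<psi> i) (g N) * L2_inner M (g N) (\<psi> i)) = 0"
      using res(2) by (intro sum.neutral) auto
    have "\<eta> k * (r N)\<^sup>2 \<le> Re (kernel_form M K (g N) (g N))"
    proof -
      note s = kernel_form_diag_sums[OF e' res(1)[of N]]
      have "\<eta> k * (cmod (L2_inner M (f k) (g N)))\<^sup>2
         = (\<Sum>i\<in>{k}. if i \<in> J then \<eta> i * (cmod (L2_inner M (f i) (g N)))\<^sup>2 else 0)" using k by simp
      also have "\<dots> \<le> (\<Sum>i. if i \<in> J then \<eta> i * (cmod (L2_inner M (f i) (g N)))\<^sup>2 else 0)"
        by (rule sum_le_suminf) (use sums_summable[OF s] kernel_expansionD(2)[OF e'] in \<open>auto simp: less_imp_le\<close>)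
      finally show ?thesis using s by (simp add: sums_iff res(3) norm_of_real)
    qed
    also have "\<dots> \<le> cmod (kernel_form M K (g N) (g N))" by (rule complex_Re_le_cmod)
    finally have "(\<eta> k * (r N)\<^sup>2)\<^sup>2 \<le> (cmod (kernel_form M K (g N) (g N)))\<^sup>2"
      using \<eta>k by (intro power_mono) auto
    then have "ennreal ((\<eta> k * (r N)\<^sup>2)\<^sup>2) \<le> ennreal ((cmod (kernel_form M K (g N) (g N)))\<^sup>2)"
      by (rule ennreal_leI)
    also have "\<dots> \<le> expansion_error M K I \<theta> \<psi> N * ennreal (r N * r N)"
      using kernel_form_approx[OF ke fin res(1)[of N] res(1)[of N]] by (simp add: zero res(4))
    also have "\<dots> \<le> expansion_error M K I \<theta> \<psi> N * ennreal (q * q)"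
      using r by (intro mult_left_mono ennreal_leI mult_mono) (auto intro: order_trans)
    finally show ?thesis .
  qed
  have "\<forall>\<^sub>F N in sequentially. expansion_error M K I \<theta> \<psi> N < \<infinity>"
    using kernel_expansionD(4)[OF ke] by (rule order_tendstoD) simp
  then have ev: "\<forall>\<^sub>F N in sequentially. ennreal ((\<eta> k * (r N)\<^sup>2)\<^sup>2) \<le> expansion_error M K I \<theta> \<psi> N * ennreal (q * q)"
    by eventually_elim (rule le)
  have "(\<lambda>N. expansion_error M K I \<theta> \<psi> N * ennreal (q * q)) \<longlonglongrightarrow> 0 * ennreal (q * q)"
    by (intro tendsto_mult_ennreal kernel_expansionD(4)[OF ke] tendsto_const) auto
  then have lim: "(\<lambda>N. expansion_error M K I \<theta> \<psi> N * ennreal (q * q)) \<longlonglongrightarrow> ennreal 0" by simp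
  have "(\<lambda>N. ennreal ((\<eta> k * (r N)\<^sup>2)\<^sup>2)) \<longlonglongrightarrow> ennreal 0"
    by (rule tendsto_sandwich[where f = "\<lambda>_. ennreal 0", OF _ ev tendsto_const lim]) simp
  then have "(\<lambda>N. (\<eta> k * (r N)\<^sup>2)\<^sup>2) \<longlonglongrightarrow> 0"
    by (subst (asm) tendsto_ennreal_iff) auto
  then have "(\<lambda>N. sqrt (sqrt ((\<eta> k * (r N)\<^sup>2)\<^sup>2) / \<eta> k)) \<longlonglongrightarrow> sqrt (sqrt 0 / \<eta> k)"
    by (intro tendsto_intros) (use \<eta>k in auto)
  then have "r \<longlonglongrightarrow> 0"
    using \<eta>k r(1) by (simp add: abs_of_nonneg)
  then have "(\<lambda>N. q - r N) \<longlonglongrightarrow> q - 0" by (intro tendsto_diff tendsto_const)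
  then show ?thesis
    unfolding sums_def by (simp add: r_def q_def sum_restrict_lessThan)
qed

text \<open>The trace of a nonnegative operator does not depend on how it is written as a sum of rank-one
operators. Both sides equal the double sum of \<open>\<eta> k\<close> times the squared modulus of the inner
product of \<open>f k\<close> and \<open>\<psi> j\<close>: summing over \<open>k\<close> first gives the form at \<open>\<psi> j\<close>, that is
the eigenvalue \<open>\<theta> j\<close>, and summing over \<open>j\<close> first is Parseval's identity for \<open>f k\<close>. In the
extended nonnegative reals this also transfers finiteness of the trace between the two sides.\<close>

theorem trace_unique:
  assumes e: "eigen_decomposition M K I \<theta> \<psi>" and e': "kernel_expansion M K J \<eta> f"
  shows "(\<Sum>j. ennreal (if j \<in> I then \<theta> j else 0))
       = (\<Sum>k. ennreal (if k \<in> J then \<eta> k * L2_norm_sq M (f k) else 0))"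
proof -
  have ke: "kernel_expansion M K I \<theta> \<psi>" using e by (simp add: eigen_decomposition_iff)
  define a where "a j k = ennreal (if j \<in> I then if k \<in> J then \<eta> k * (cmod (L2_inner M (f k) (\<psi> j)))\<^sup>2 else 0 else 0)" for j k
  have "ennreal (if j \<in> I then \<theta> j else 0) = (\<Sum>k. a j k)" for j
  proof (cases "j \<in> I")
    case True
    have "(\<Sum>k. a j k) = ennreal (Re (kernel_form M K (\<psi> j) (\<psi> j)))"
      unfolding a_def using True kernel_expansionD(2)[OF e']
      by (intro suminf_ennreal_eq)
         (auto intro!: kernel_form_diag_sums[OF e'] kernel_expansionD(3)[OF ke] simp: less_imp_le)
    then show ?thesis using True by (simp add: eigenvalue_eq_form[OF e])
  qed (simp add: a_def)
  moreover have "(\<Sum>j. a j k) = ennreal (if k \<in> J then \<eta> k * L2_norm_sq M (f k) else 0)" for k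
  proof (cases "k \<in> J")
    case True
    have "(\<lambda>j. \<eta> k * (if j \<in> I then (cmod (L2_inner M (f k) (\<psi> j)))\<^sup>2 else 0)) sums (\<eta> k * L2_norm_sq M (f k))"
      by (intro sums_mult expansion_parseval[OF e e' True])
    then have "(\<lambda>j. if j \<in> I then \<eta> k * (cmod (L2_inner M (f k) (\<psi> j)))\<^sup>2 else 0) sums (\<eta> k * L2_norm_sq M (f k))"
      by (simp add: if_distrib[of "(*) (\<eta> k)"] cong: if_cong)
    then show ?thesis
      unfolding a_def using True kernel_expansionD(2)[OF e' True]
      by (subst suminf_ennreal_eq[of _ "\<eta> k * L2_norm_sq M (f k)"]) (auto cong: if_cong)
  qed (simp add: a_def cong: if_cong)
  ultimately show ?thesis by (simp add: ennreal_suminf_swap[of a])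
qed

text \<open>Test the form of the restricted kernel with \<open>u\<close>, the part of \<open>\<phi> k\<close> outside \<open>D\<close>, in the
first argument and \<open>\<phi> k\<close> in the second: the integrand vanishes identically, whereas the
expansion gives \<open>\<eta> k\<close> times the squared norm of \<open>u\<close>.\<close>

lemma eigenfunction_vanishes_outside:
  assumes e: "eigen_decomposition M (cut_kernel D K) J \<eta> \<phi>" and D: "D \<in> sets M" and k: "k \<in> J"
  shows "AE x in M. x \<notin> D \<longrightarrow> \<phi> k x = 0"
proof -
  have ke: "kernel_expansion M (cut_kernel D K) J \<eta> \<phi>"
    and on: "\<And>i j. i \<in> J \<Longrightarrow> j \<in> J \<Longrightarrow> L2_inner M (\<phi> i) (\<phi> j) = (if i = j then 1 else 0)"
    using e by (auto simp: eigen_decomposition_iff)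
  define u where "u = (\<lambda>x. indicator (space M - D) x * \<phi> k x)"
  have u: "u \<in> L2 M" unfolding u_def using D by (intro L2_indicator kernel_expansionD(3)[OF ke k]) auto
  have zero: "kernel_form M (cut_kernel D K) u (\<phi> k) = 0"
    unfolding kernel_form_def by (rule integral_eq_zero_AE) (auto simp: u_def cut_kernel_def indicator_def)
  have lim: "(\<lambda>N. \<Sum>i\<in>J \<inter> {..<N}. complex_of_real (\<eta> i) * L2_inner M (\<phi> i) u * L2_inner M (\<phi> k) (\<phi> i))
     \<longlonglongrightarrow> complex_of_real (\<eta> k) * L2_inner M (\<phi> k) u"
  proof (rule tendsto_eventually, rule eventually_sequentiallyI[of "Suc k"])
    fix N assume N: "Suc k \<le> N"
    have "(\<Sum>i\<in>J \<inter> {..<N}. complex_of_real (\<eta> i) * L2_inner M (\<phi> i) u * L2_inner M (\<phi> k) (\<phi> i))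
       = (\<Sum>i\<in>J \<inter> {..<N}. if i = k then complex_of_real (\<eta> i) * L2_inner M (\<phi> i) u else 0)"
      using on k by (intro sum.cong) auto
    also have "\<dots> = complex_of_real (\<eta> k) * L2_inner M (\<phi> k) u"
      using N k by (subst sum.delta) auto
    finally show "(\<Sum>i\<in>J \<inter> {..<N}. complex_of_real (\<eta> i) * L2_inner M (\<phi> i) u * L2_inner M (\<phi> k) (\<phi> i))
       = complex_of_real (\<eta> k) * L2_inner M (\<phi> k) u" .
  qed
  have "complex_of_real (\<eta> k) * L2_inner M (\<phi> k) u = 0"
    using LIMSEQ_unique[OF lim kernel_form_tendsto[OF ke u kernel_expansionD(3)[OF ke k]]] by (simp only: zero)
  then have "L2_inner M (\<phi> k) u = 0"
    using kernel_expansionD(2)[OF ke k] by simp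
  moreover have "L2_inner M (\<phi> k) u = L2_inner M u u"
    unfolding L2_inner_def u_def by (intro Bochner_Integration.integral_cong) (auto simp: indicator_def)
  ultimately have "L2_norm_sq M u = 0" by (simp add: L2_inner_self)
  then have "AE x in M. (cmod (u x))\<^sup>2 = 0"
    unfolding L2_norm_sq_def using u by (subst (asm) integral_nonneg_eq_0_iff_AE) (auto simp: L2_def)
  then show ?thesis
    using AE_space by eventually_elim (auto simp: u_def indicator_def)
qed

lemma AE_pair_both:
  assumes "AE x in M. P x"
  shows "AE z in M \<Otimes>\<^sub>M M. P (fst z) \<and> P (snd z)"
proof -
  obtain N where N: "{x \<in> space M. \<not> P x} \<subseteq> N" "emeasure M N = 0" "N \<in> sets M"
    using assms by (auto elim!: AE_E)
  have "N \<times> space M \<union> space M \<times> N \<in> null_sets (M \<Otimes>\<^sub>M M)"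
    using N by (intro null_sets.Un) (auto simp: null_sets_def emeasure_pair_measure_Times)
  then show ?thesis
    by (rule AE_I') (use N(1) in \<open>auto simp: space_pair_measure\<close>)
qed

text \<open>The weight \<open>\<kappa> x\<close> is the formal diagonal value of the expansion at \<open>x\<close>; its integral over
\<open>A\<close> is the trace of the restriction to \<open>A\<close>.\<close>

lemma expansion_weight_finite:
  assumes e: "kernel_expansion M K J \<eta> f"
    and fin: "(\<Sum>k. ennreal (if k \<in> J then \<eta> k * L2_norm_sq M (f k) else 0)) < \<infinity>"
  defines "\<kappa> \<equiv> (\<lambda>x. \<Sum>k. ennreal (if k \<in> J then \<eta> k * (cmod (f k x))\<^sup>2 else 0))"
  shows "\<kappa> \<in> borel_measurable M"
    and "A \<in> sets M \<Longrightarrow> (\<integral>\<^sup>+ x\<in>A. \<kappa> x \<partial>M) =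
       (\<Sum>k. ennreal (if k \<in> J then \<eta> k * L2_norm_sq M (\<lambda>x. indicator A x * f k x) else 0))"
    and "(\<integral>\<^sup>+ x. \<kappa> x \<partial>M) < \<infinity>"
    and "AE x in M. \<kappa> x < \<infinity>"
proof -
  have m: "(\<lambda>x. ennreal (if k \<in> J then \<eta> k * (cmod (f k x))\<^sup>2 else 0)) \<in> borel_measurable M" for k
  proof (cases "k \<in> J")
    case True
    then have [measurable]: "f k \<in> borel_measurable M" using kernel_expansionD(3)[OF e] by (auto dest: L2_measurable)
    show ?thesis by measurable
  qed simp
  show meas: "\<kappa> \<in> borel_measurable M" unfolding \<kappa>_def using m by measurable
  show int: "(\<integral>\<^sup>+ x\<in>A. \<kappa> x \<partial>M) =
       (\<Sum>k. ennreal (if k \<in> J then \<eta> k * L2_norm_sq M (\<lambda>x. indicator A x * f k x) else 0))"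
    if A: "A \<in> sets M" for A
  proof -
    note m[measurable] A[measurable]
    have "(\<integral>\<^sup>+ x\<in>A. \<kappa> x \<partial>M) = (\<Sum>k. \<integral>\<^sup>+ x. ennreal (if k \<in> J then \<eta> k * (cmod (f k x))\<^sup>2 else 0) * indicator A x \<partial>M)"
      unfolding \<kappa>_def ennreal_suminf_multc[symmetric] by (rule nn_integral_suminf) measurable
    also have "\<dots> = (\<Sum>k. ennreal (if k \<in> J then \<eta> k * L2_norm_sq M (\<lambda>x. indicator A x * f k x) else 0))"
    proof (intro suminf_cong)
      fix k
      show "(\<integral>\<^sup>+ x. ennreal (if k \<in> J then \<eta> k * (cmod (f k x))\<^sup>2 else 0) * indicator A x \<partial>M)
         = ennreal (if k \<in> J then \<eta> k * L2_norm_sq M (\<lambda>x. indicator A x * f k x) else 0)"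
      proof (cases "k \<in> J")
        case True
        have fA: "(\<lambda>x. indicator A x * f k x) \<in> L2 M" by (rule L2_indicator[OF kernel_expansionD(3)[OF e True] A])
        note [measurable] = L2_measurable[OF fA]
        have "(\<integral>\<^sup>+ x. ennreal (if k \<in> J then \<eta> k * (cmod (f k x))\<^sup>2 else 0) * indicator A x \<partial>M)
           = (\<integral>\<^sup>+ x. ennreal (\<eta> k) * ennreal ((cmod (indicator A x * f k x))\<^sup>2) \<partial>M)"
          using True kernel_expansionD(2)[OF e True]
          by (intro nn_integral_cong) (auto simp: indicator_def ennreal_mult)
        also have "\<dots> = ennreal (\<eta> k) * ennreal (L2_norm_sq M (\<lambda>x. indicator A x * f k x))"
          by (subst nn_integral_cmult) (auto simp: L2_nn_integral[OF fA])
        finally show ?thesis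
          using True kernel_expansionD(2)[OF e True] by (simp add: ennreal_mult' L2_norm_sq_nonneg less_imp_le)
      qed simp
    qed
    finally show ?thesis .
  qed
  have "(\<integral>\<^sup>+ x. \<kappa> x \<partial>M) = (\<integral>\<^sup>+ x\<in>space M. \<kappa> x \<partial>M)" by (intro nn_integral_cong) auto
  also have "\<dots> = (\<Sum>k. ennreal (if k \<in> J then \<eta> k * L2_norm_sq M (\<lambda>x. indicator (space M) x * f k x) else 0))"
    by (rule int) simp
  also have "\<dots> = (\<Sum>k. ennreal (if k \<in> J then \<eta> k * L2_norm_sq M (f k) else 0))"
  proof -
    have "L2_norm_sq M (\<lambda>x. indicator (space M) x * f k x) = L2_norm_sq M (f k)" for k
      unfolding L2_norm_sq_def by (intro Bochner_Integration.integral_cong) auto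
    then show ?thesis by (simp cong: if_cong)
  qed
  finally show \<kappa>_int: "(\<integral>\<^sup>+ x. \<kappa> x \<partial>M) < \<infinity>" using fin by simp
  show "AE x in M. \<kappa> x < \<infinity>"
    using nn_integral_PInf_AE[OF meas] \<kappa>_int by (auto simp: less_top[symmetric])
qed

text \<open>Where the weight is finite, the Cauchy--Schwarz inequality for sums controls the kernel by its
diagonal. This is the bound by which all determinants below are dominated.\<close>

lemma expansion_sum_bound:
  assumes \<eta>: "\<And>k. k \<in> J \<Longrightarrow> 0 < \<eta> k"
    and x: "(\<Sum>k. ennreal (if k \<in> J then \<eta> k * (cmod (f k x))\<^sup>2 else 0)) < \<infinity>"
    and y: "(\<Sum>k. ennreal (if k \<in> J then \<eta> k * (cmod (f k y))\<^sup>2 else 0)) < \<infinity>"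
  shows "convergent (\<lambda>N. expansion_sum J \<eta> f N x y)"
    and "(cmod (expansion_sum J \<eta> f N x y))\<^sup>2 \<le>
       enn2real (\<Sum>k. ennreal (if k \<in> J then \<eta> k * (cmod (f k x))\<^sup>2 else 0)) *
       enn2real (\<Sum>k. ennreal (if k \<in> J then \<eta> k * (cmod (f k y))\<^sup>2 else 0))"
proof -
  define w where "w x k = (if k \<in> J then \<eta> k * (cmod (f k x))\<^sup>2 else 0)" for x k
  have w: "0 \<le> w x k" for x k using \<eta> by (auto simp: w_def less_imp_le)
  have sm: "summable (w x)" "summable (w y)"
    using x y w by (auto intro!: summable_suminf_not_top simp: w_def[abs_def, symmetric] w_def[symmetric] less_top[symmetric])
  have en: "(\<Sum>k. ennreal (if k \<in> J then \<eta> k * (cmod (f k z))\<^sup>2 else 0)) = ennreal (suminf (w z))" if "summable (w z)" for z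
    using suminf_ennreal2[OF w that] by (simp add: w_def[abs_def])
  define t where "t k = (if k \<in> J then complex_of_real (\<eta> k) * f k x * cnj (f k y) else 0)" for k
  have t: "cmod (t k) = sqrt (w x k) * sqrt (w y k)" for k
  proof (cases "k \<in> J")
    case True
    have "w x k * w y k = (\<eta> k * cmod (f k x) * cmod (f k y))\<^sup>2"
      using True by (simp add: w_def power2_eq_square)
    then have "sqrt (w x k) * sqrt (w y k) = sqrt ((\<eta> k * cmod (f k x) * cmod (f k y))\<^sup>2)"
      by (metis real_sqrt_mult)
    also have "\<dots> = \<eta> k * cmod (f k x) * cmod (f k y)"
      using \<eta>[OF True] by (subst real_sqrt_abs) (simp add: abs_mult)
    finally show ?thesis using True \<eta>[OF True] by (simp add: t_def norm_mult)
  qed (simp add: t_def w_def)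
  have "summable t"
  proof (rule summable_comparison_test'[where N = 0])
    show "summable (\<lambda>k. w x k + w y k)" using sm by (rule summable_add)
    show "norm (t k) \<le> w x k + w y k" for k
      using sum_squares_bound[of "sqrt (w x k)" "sqrt (w y k)"] w[of x k] w[of y k]
        mult_nonneg_nonneg[of "sqrt (w x k)" "sqrt (w y k)"]
      unfolding t by (simp add: real_sqrt_pow2)
  qed
  have tsum: "expansion_sum J \<eta> f N x y = (\<Sum>k<N. t k)" for N
    unfolding expansion_sum_def sum_restrict_lessThan t_def ..
  show "convergent (\<lambda>N. expansion_sum J \<eta> f N x y)"
    using \<open>summable t\<close> unfolding tsum summable_iff_convergent .
  have "cmod (expansion_sum J \<eta> f N x y) \<le> (\<Sum>k<N. sqrt (w x k) * sqrt (w y k))"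
    unfolding tsum using norm_sum[of t "{..<N}"] by (simp only: t)
  then have "(cmod (expansion_sum J \<eta> f N x y))\<^sup>2 \<le> (\<Sum>k<N. sqrt (w x k) * sqrt (w y k))\<^sup>2"
    by (rule power_mono) simp
  also have "\<dots> \<le> (\<Sum>k<N. (sqrt (w x k))\<^sup>2) * (\<Sum>k<N. (sqrt (w y k))\<^sup>2)"
    by (rule Cauchy_Schwarz_ineq_sum)
  also have "\<dots> = (\<Sum>k<N. w x k) * (\<Sum>k<N. w y k)" using w by simp
  also have "\<dots> \<le> suminf (w x) * suminf (w y)"
    using w sm by (intro mult_mono sum_le_suminf sum_nonneg suminf_nonneg) auto
  finally show "(cmod (expansion_sum J \<eta> f N x y))\<^sup>2 \<le>
       enn2real (\<Sum>k. ennreal (if k \<in> J then \<eta> k * (cmod (f k x))\<^sup>2 else 0)) *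
       enn2real (\<Sum>k. ennreal (if k \<in> J then \<eta> k * (cmod (f k y))\<^sup>2 else 0))"
    using w sm by (simp add: en suminf_nonneg)
qed

text \<open>By Fatou's lemma the \<open>L\<^sup>2\<close>-convergence forces the lower limit of the pointwise errors to vanish
almost everywhere. As the partial sums also converge almost everywhere, their limit must be the
kernel.\<close>

lemma expansion_pointwise:
  assumes e: "kernel_expansion M K J \<eta> f"
    and fin: "(\<Sum>k. ennreal (if k \<in> J then \<eta> k * L2_norm_sq M (f k) else 0)) < \<infinity>"
  shows "AE z in M \<Otimes>\<^sub>M M. (\<lambda>N. expansion_sum J \<eta> f N (fst z) (snd z)) \<longlonglongrightarrow> K (fst z) (snd z)"
proof -
  note [measurable] = kernel_expansionD(1)[OF e] expansion_sum_measurable[OF e]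
  let ?d = "\<lambda>N z. ennreal ((cmod (K (fst z) (snd z) - expansion_sum J \<eta> f N (fst z) (snd z)))\<^sup>2)"
  have "(\<integral>\<^sup>+ z. liminf (\<lambda>N. ?d N z) \<partial>(M \<Otimes>\<^sub>M M)) \<le> liminf (\<lambda>N. \<integral>\<^sup>+ z. ?d N z \<partial>(M \<Otimes>\<^sub>M M))"
    by (rule nn_integral_liminf) measurable
  also have "\<dots> = liminf (expansion_error M K J \<eta> f)"
    by (simp add: expansion_error_def[abs_def] case_prod_beta')
  also have "\<dots> = 0"
    using kernel_expansionD(4)[OF e] by (intro lim_imp_Liminf) auto
  finally have "AE z in M \<Otimes>\<^sub>M M. liminf (\<lambda>N. ?d N z) = 0"
    by (subst (asm) le_zero_eq, subst (asm) nn_integral_0_iff_AE) auto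
  with AE_pair_both[OF expansion_weight_finite(4)[OF e fin]] show ?thesis
  proof eventually_elim
    case (elim z)
    have "convergent (\<lambda>N. expansion_sum J \<eta> f N (fst z) (snd z))"
      by (rule expansion_sum_bound(1)) (use kernel_expansionD(2)[OF e] elim(1) in auto)
    then obtain l where l: "(\<lambda>N. expansion_sum J \<eta> f N (fst z) (snd z)) \<longlonglongrightarrow> l"
      by (auto simp: convergent_def)
    have lim: "(\<lambda>N. ?d N z) \<longlonglongrightarrow> ennreal ((cmod (K (fst z) (snd z) - l))\<^sup>2)"
      by (intro tendsto_ennrealI tendsto_power tendsto_norm tendsto_diff tendsto_const l)
    have "ennreal ((cmod (K (fst z) (snd z) - l))\<^sup>2) = 0"
      using lim_imp_Liminf[OF _ lim] elim(2) by simp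
    then have "(cmod (K (fst z) (snd z) - l))\<^sup>2 \<le> 0"
      by (simp only: ennreal_eq_0_iff)
    then have "l = K (fst z) (snd z)" by simp
    then show ?case using l by simp
  qed
qed

end

section \<open>The diagonal of the kernel\<close>

lemma radon_sigma_finite:
  fixes \<mu> :: "'a::polish_space measure"
  assumes lc: "locally_compact_space (euclidean :: 'a topology)" and r: "radon_measure \<mu>"
  shows "sigma_finite_measure \<mu>"
proof -
  define F where "F = {U::'a set. open U \<and> (\<exists>C. compact C \<and> U \<subseteq> C)}"
  have sets: "sets \<mu> = sets borel" and fin: "\<And>C. compact C \<Longrightarrow> emeasure \<mu> C < \<infinity>"
    using r by (auto simp: radon_measure_def)
  obtain F' where F': "F' \<subseteq> F" "countable F'" "\<Union>F' = \<Union>F"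
    using Lindelof[of F] by (auto simp: F_def)
  have UN: "\<Union>F = UNIV"
  proof -
    have "x \<in> \<Union>F" for x
      using lc unfolding locally_compact_space_def F_def by fastforce
    then show ?thesis by auto
  qed
  show ?thesis
  proof (intro sigma_finite_measure.intro exI conjI ballI)
    show "countable F'" by fact
    show "F' \<subseteq> sets \<mu>" using F'(1) by (auto simp: F_def sets)
    show "\<Union>F' = space \<mu>" using F'(3) UN sets_eq_imp_space_eq[OF sets] by simp
    fix U assume "U \<in> F'"
    then obtain C where C: "compact C" "U \<subseteq> C" using F'(1) by (auto simp: F_def)
    have "emeasure \<mu> U \<le> emeasure \<mu> C"
      using C by (intro emeasure_mono) (auto simp: sets compact_imp_closed)
    then show "emeasure \<mu> U \<noteq> \<infinity>" using fin[OF C(1)] by auto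
  qed
qed

text \<open>If \<open>{x \<in> D. 0 < g x}\<close> had positive mass, inner regularity would provide a compact subset of
positive mass, over which the integral of \<open>g\<close> would be positive.\<close>

lemma AE_nonpos_of_compact_integrals:
  fixes g :: "'a::polish_space \<Rightarrow> real"
  assumes r: "radon_measure \<mu>" and D: "D \<in> sets borel" and g: "g \<in> borel_measurable borel"
    and int: "\<And>C. compact C \<Longrightarrow> C \<subseteq> D \<Longrightarrow> set_integrable \<mu> C g \<and> (LINT x:C|\<mu>. g x) = 0"
  shows "AE x in \<mu>. x \<in> D \<longrightarrow> g x \<le> 0"
proof -
  have sets: "sets \<mu> = sets borel" and
    inner: "\<And>A. A \<in> sets borel \<Longrightarrow> emeasure \<mu> A = (SUP C\<in>{C. compact C \<and> C \<subseteq> A}. emeasure \<mu> C)"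
    using r by (auto simp: radon_measure_def)
  note sets_eq_imp_space_eq[OF sets, simp] and g[measurable] and D[measurable]
  define A where "A = {x \<in> D. 0 < g x}"
  have A: "A \<in> sets borel" unfolding A_def by measurable
  have "emeasure \<mu> C = 0" if C: "compact C" "C \<subseteq> A" for C
  proof -
    have Cs: "C \<in> sets \<mu>" using C by (simp add: sets compact_imp_closed)
    have CD: "C \<subseteq> D" using C by (auto simp: A_def)
    have i: "integrable \<mu> (\<lambda>x. indicator C x * g x)" "(LINT x|\<mu>. indicator C x * g x) = 0"
      using int[OF C(1) CD] unfolding set_integrable_def set_lebesgue_integral_def real_scaleR_def by blast+
    have "AE x in \<mu>. 0 \<le> indicator C x * g x"
      by (intro AE_I2) (use C(2) in \<open>auto simp: A_def indicator_def\<close>)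
    then have "AE x in \<mu>. indicator C x * g x = 0"
      using integral_nonneg_eq_0_iff_AE[OF i(1)] i(2) by simp
    then have "AE x in \<mu>. x \<notin> C"
      by eventually_elim (use C(2) in \<open>auto simp: A_def indicator_def\<close>)
    then show ?thesis using Cs by (simp add: AE_iff_measurable[OF Cs] sets.sets_into_space)
  qed
  then have "emeasure \<mu> A = 0"
    by (subst inner[OF A]) (auto intro!: SUP_eq_const)
  then have "A \<in> null_sets \<mu>" using A by (auto simp: null_sets_def sets)
  then show ?thesis by (rule AE_I') (auto simp: A_def)
qed

lemma summable_on_nonneg_sums:
  fixes f :: "nat \<Rightarrow> real"
  assumes "f summable_on J" 
  shows "(\<lambda>k. if k \<in> J then f k else 0) sums infsum f J"
proof -
  have "((\<lambda>k. if k \<in> J then f k else 0) has_sum infsum f J) UNIV"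
    using has_sum_infsum[OF assms] by (subst has_sum_cong_neutral[where T = J and g = f]) auto
  then show ?thesis by (rule has_sum_imp_sums)
qed

text \<open>Convergence of the expansion almost everywhere on the product space says nothing about the diagonal,
on which the determinants depend. There the trace formula is decisive: over every compact
\<open>C \<subseteq> D\<close> the integral of \<open>K x x\<close> is the trace of the restriction to \<open>C\<close>, and by
\<open>trace_unique\<close> so is the integral of the weight \<open>\<kappa>\<close>. Two functions with the same integrals
over all compact sets agree almost everywhere. Outside \<open>D\<close> the eigenfunctions vanish.\<close>

lemma kernel_diagonal:
  fixes \<mu> :: "'a::polish_space measure"
  assumes r: "radon_measure \<mu>" and sf: "sigma_finite_measure \<mu>"
    and K: "admissible_kernel \<mu> K" and D: "D \<in> sets borel"
    and e: "eigen_decomposition \<mu> (cut_kernel D K) J \<eta> \<phi>"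
    and fin: "(\<Sum>k. ennreal (if k \<in> J then \<eta> k else 0)) < \<infinity>"
  shows "AE x in \<mu>. (\<lambda>N. expansion_sum J \<eta> \<phi> N x x) \<longlonglongrightarrow> cut_kernel D K x x"
proof -
  interpret sigma_finite_measure \<mu> by fact
  have sets: "sets \<mu> = sets borel" using r by (simp add: radon_measure_def)
  have space: "space \<mu> = UNIV" using sets_eq_imp_space_eq[OF sets] by simp
  have ke: "kernel_expansion \<mu> (cut_kernel D K) J \<eta> \<phi>" using e by (simp add: eigen_decomposition_iff)
  have fin': "(\<Sum>k. ennreal (if k \<in> J then \<eta> k * L2_norm_sq \<mu> (\<phi> k) else 0)) < \<infinity>"
    using fin unfolding eigen_trace_eq[OF e] .
  define \<kappa> where "\<kappa> x = (\<Sum>k. ennreal (if k \<in> J then \<eta> k * (cmod (\<phi> k x))\<^sup>2 else 0))" for x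
  note wt = expansion_weight_finite[OF ke fin', folded \<kappa>_def]
  have \<kappa>m: "\<kappa> \<in> borel_measurable borel"
    using wt(1) by (simp add: measurable_cong_sets[OF sets refl])
  have Km: "(\<lambda>x. K x x) \<in> borel_measurable borel"
  proof -
    have "(\<lambda>(x, y). K x y) \<in> borel_measurable (\<mu> \<Otimes>\<^sub>M \<mu>)"
      using K by (simp add: admissible_kernel_def L2_operator_def)
    then have "(\<lambda>x. (\<lambda>(x, y). K x y) (x, x)) \<in> borel_measurable \<mu>"
      by (rule measurable_compose[rotated]) measurable
    then show ?thesis by (simp add: measurable_cong_sets[OF sets refl])
  qed
  have C: "set_integrable \<mu> C (\<lambda>x. K x x)" "set_integrable \<mu> C (\<lambda>x. enn2real (\<kappa> x))"
    "(LINT x:C|\<mu>. K x x) = complex_of_real (LINT x:C|\<mu>. enn2real (\<kappa> x))"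
    if C: "compact C" "C \<subseteq> D" for C
  proof -
    have Cs: "C \<in> sets \<mu>" using C by (simp add: sets compact_imp_closed)
    obtain I \<theta> \<psi> where d: "eigen_decomposition \<mu> (cut_kernel C K) I \<theta> \<psi>" "\<theta> summable_on I"
      using K C(1) by (auto simp: admissible_kernel_def locally_trace_class_def trace_class_def)
    have tf: "set_integrable \<mu> C (\<lambda>x. K x x) \<and> (LINT x:C|\<mu>. K x x) = complex_of_real (infsum \<theta> I)"
      using K C(1) d(1) by (auto simp: admissible_kernel_def trace_formula_def)
    then show "set_integrable \<mu> C (\<lambda>x. K x x)" by simp
    have pos: "0 \<le> (if k \<in> I then \<theta> k else 0)" for k
      using d(1) by (auto simp: eigen_decomposition_def less_imp_le)
    note s = summable_on_nonneg_sums[OF d(2)]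
    have S0: "0 \<le> infsum \<theta> I"
      using suminf_nonneg[OF sums_summable[OF s] pos] unfolding sums_unique[OF s, symmetric] .
    have "ennreal (infsum \<theta> I) = (\<Sum>k. ennreal (if k \<in> I then \<theta> k else 0))"
      using suminf_ennreal_eq[OF pos s] by simp
    also have "\<dots> = (\<Sum>k. ennreal (if k \<in> J then \<eta> k * L2_norm_sq \<mu> (\<lambda>x. indicator C x * \<phi> k x) else 0))"
      by (rule trace_unique[OF d(1) kernel_expansion_cut[OF ke C(2) Cs]])
    also have "\<dots> = (\<integral>\<^sup>+ x\<in>C. \<kappa> x \<partial>\<mu>)" by (rule wt(2)[OF Cs, symmetric])
    also have "\<dots> = (\<integral>\<^sup>+ x. ennreal (indicator C x *\<^sub>R enn2real (\<kappa> x)) \<partial>\<mu>)"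
      by (rule nn_integral_cong_AE) (use wt(4) in \<open>eventually_elim, auto simp: indicator_def less_top\<close>)
    finally have nn: "(\<integral>\<^sup>+ x. ennreal (indicator C x *\<^sub>R enn2real (\<kappa> x)) \<partial>\<mu>) = ennreal (infsum \<theta> I)" ..
    note [measurable] = Cs wt(1)
    have "has_bochner_integral \<mu> (\<lambda>x. indicator C x *\<^sub>R enn2real (\<kappa> x)) (infsum \<theta> I)"
      by (rule has_bochner_integral_nn_integral[OF _ _ S0 nn]) (auto simp: indicator_def)
    then show "set_integrable \<mu> C (\<lambda>x. enn2real (\<kappa> x))"
      and "(LINT x:C|\<mu>. K x x) = complex_of_real (LINT x:C|\<mu>. enn2real (\<kappa> x))"
      using tf by (auto simp: set_integrable_def set_lebesgue_integral_def has_bochner_integral_iff)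
  qed
  have zero: "AE x in \<mu>. x \<in> D \<longrightarrow> g x \<le> 0"
    if g: "g \<in> {\<lambda>x. Re (K x x) - enn2real (\<kappa> x), \<lambda>x. - (Re (K x x) - enn2real (\<kappa> x)), \<lambda>x. Im (K x x), \<lambda>x. - Im (K x x)}"
    for g
  proof (rule AE_nonpos_of_compact_integrals[OF r D])
    note [measurable] = Km \<kappa>m
    have "(\<lambda>x. Re (K x x)) \<in> borel_measurable borel" "(\<lambda>x. Im (K x x)) \<in> borel_measurable borel"
      by measurable
    then show "g \<in> borel_measurable borel" using g by auto
    fix C assume CD: "compact C" "C \<subseteq> D"
    note c = C[OF CD]
    have re: "set_integrable \<mu> C (\<lambda>x. Re (K x x))" "(LINT x:C|\<mu>. Re (K x x)) = (LINT x:C|\<mu>. enn2real (\<kappa> x))"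
      using c integral_Re[of \<mu> "\<lambda>x. indicator C x *\<^sub>R K x x"] integrable_Re[of \<mu> "\<lambda>x. indicator C x *\<^sub>R K x x"]
      by (auto simp: set_integrable_def set_lebesgue_integral_def)
    have im: "set_integrable \<mu> C (\<lambda>x. Im (K x x))" "(LINT x:C|\<mu>. Im (K x x)) = 0"
      using c integral_Im[of \<mu> "\<lambda>x. indicator C x *\<^sub>R K x x"] integrable_Im[of \<mu> "\<lambda>x. indicator C x *\<^sub>R K x x"]
      by (auto simp: set_integrable_def set_lebesgue_integral_def)
    have d: "set_integrable \<mu> C (\<lambda>x. Re (K x x) - enn2real (\<kappa> x))"
      "(LINT x:C|\<mu>. Re (K x x) - enn2real (\<kappa> x)) = 0"
      using set_integral_diff[OF re(1) c(2)] re(2) by auto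
    have neg: "set_integrable \<mu> C (\<lambda>x. - h x) \<and> (LINT x:C|\<mu>. - h x) = 0"
      if "set_integrable \<mu> C h" "(LINT x:C|\<mu>. h x) = 0" for h :: "'a \<Rightarrow> real"
      using that by (simp add: set_integrable_def set_lebesgue_integral_def)
    show "set_integrable \<mu> C g \<and> (LINT x:C|\<mu>. g x) = 0"
      using g d im neg[OF d] neg[OF im] by auto
  qed
  have "AE x in \<mu>. x \<in> D \<longrightarrow> K x x = complex_of_real (enn2real (\<kappa> x))"
    using zero[of "\<lambda>x. Re (K x x) - enn2real (\<kappa> x)"] zero[of "\<lambda>x. - (Re (K x x) - enn2real (\<kappa> x))"]
      zero[of "\<lambda>x. Im (K x x)"] zero[of "\<lambda>x. - Im (K x x)"]
    by (simp, elim AE_mp, intro AE_I2) (auto simp: complex_eq_iff)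
  moreover have "AE x in \<mu>. \<forall>k\<in>J. x \<notin> D \<longrightarrow> \<phi> k x = 0"
    by (subst AE_ball_countable) (use eigenfunction_vanishes_outside[OF e] D sets in auto)
  ultimately show ?thesis
    using wt(4)
  proof eventually_elim
    case (elim x)
    define w where "w k = (if k \<in> J then \<eta> k * (cmod (\<phi> k x))\<^sup>2 else 0)" for k
    have w: "0 \<le> w k" for k using kernel_expansionD(2)[OF ke] by (auto simp: w_def less_imp_le)
    have sm: "summable w"
      using elim(3) w by (auto intro!: summable_suminf_not_top simp: \<kappa>_def w_def[abs_def])
    have \<kappa>: "enn2real (\<kappa> x) = suminf w"
      using suminf_ennreal2[OF w sm] suminf_nonneg[OF sm w] by (simp add: \<kappa>_def w_def[abs_def])
    have "expansion_sum J \<eta> \<phi> N x x = complex_of_real (\<Sum>k<N. w k)" for N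
      unfolding expansion_sum_def sum_restrict_lessThan of_real_sum
      by (intro sum.cong) (auto simp: w_def complex_norm_square mult.assoc simp del: of_real_power)
    moreover have "(\<lambda>N. complex_of_real (\<Sum>k<N. w k)) \<longlonglongrightarrow> complex_of_real (suminf w)"
      by (intro tendsto_of_real summable_LIMSEQ sm)
    moreover have "cut_kernel D K x x = complex_of_real (suminf w)"
    proof (cases "x \<in> D")
      case True
      then show ?thesis using elim(1) \<kappa> by (simp add: cut_kernel_def)
    next
      case False
      then have "w = (\<lambda>_. 0)" using elim(2) by (auto simp: w_def)
      then show ?thesis using False by (simp add: cut_kernel_def)
    qed
    ultimately show ?case by simp
  qed
qed

section \<open>Integrals of determinants\<close>

text \<open>The elementary symmetric polynomial of degree \<open>k\<close> in the \<open>\<eta> t\<close>, \<open>t \<in> A\<close>.\<close>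

definition esym :: "('i \<Rightarrow> real) \<Rightarrow> 'i set \<Rightarrow> nat \<Rightarrow> real" where
  "esym \<eta> A k = (\<Sum>S | S \<subseteq> A \<and> card S = k. \<Prod>t\<in>S. \<eta> t)"

text \<open>Group the injections by their image; each \<open>k\<close>-element subset of \<open>A\<close> is the image of
\<open>k!\<close> of them.\<close>

lemma injection_sum_eq_esym:
  assumes A: "finite A"
  shows "(\<Sum>s | s \<in> {..<k} \<rightarrow>\<^sub>E A \<and> inj_on s {..<k}. \<Prod>i<k. \<eta> (s i)) = fact k * esym \<eta> A k"
proof -
  let ?I = "{s. s \<in> {..<k} \<rightarrow>\<^sub>E A \<and> inj_on s {..<k}}"
  let ?T = "{S. S \<subseteq> A \<and> card S = k}"
  have fin: "finite ?I" by (rule finite_subset[of _ "{..<k} \<rightarrow>\<^sub>E A"]) (auto intro!: finite_PiE A)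
  have finT: "finite ?T" using A by simp
  have sub: "(\<lambda>s. s ` {..<k}) ` ?I \<subseteq> ?T"
    by (auto simp: card_image PiE_iff)
  have "(\<Sum>s\<in>?I. \<Prod>i<k. \<eta> (s i)) = (\<Sum>S\<in>?T. \<Sum>s\<in>{s \<in> ?I. s ` {..<k} = S}. \<Prod>i<k. \<eta> (s i))"
    by (rule sum.group[OF fin finT sub, symmetric])
  also have "\<dots> = (\<Sum>S\<in>?T. fact k * (\<Prod>t\<in>S. \<eta> t))"
  proof (rule sum.cong[OF refl])
    fix S assume S: "S \<in> ?T"
    then have finS: "finite S" using A finite_subset by blast
    have eq: "{s \<in> ?I. s ` {..<k} = S} = {s \<in> {..<k} \<rightarrow>\<^sub>E S. inj_on s {..<k}}"
    proof (intro equalityI subsetI)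
      fix s assume s: "s \<in> {s \<in> {..<k} \<rightarrow>\<^sub>E S. inj_on s {..<k}}"
      then have "s ` {..<k} \<subseteq> S" "card (s ` {..<k}) = card S" using S by (auto simp: card_image)
      then have "s ` {..<k} = S" using finS by (intro card_subset_eq)
      then show "s \<in> {s \<in> ?I. s ` {..<k} = S}" using s S by (auto simp: PiE_iff)
    qed (auto simp: PiE_iff)
    have "(\<Prod>i<k. \<eta> (s i)) = (\<Prod>t\<in>S. \<eta> t)" if "s \<in> {s \<in> ?I. s ` {..<k} = S}" for s
      using that prod.reindex[of s "{..<k}" \<eta>] by auto
    then have "(\<Sum>s\<in>{s \<in> ?I. s ` {..<k} = S}. \<Prod>i<k. \<eta> (s i)) = real (card {s \<in> ?I. s ` {..<k} = S}) * (\<Prod>t\<in>S. \<eta> t)"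
      by simp
    also have "card {s \<in> ?I. s ` {..<k} = S} = fact k"
      unfolding eq using card_inj_on_subset_funcset[of "{..<k}" S "{..<k}"] finS S
      by (simp add: falling_factorial_binomial)
    finally show "(\<Sum>s\<in>{s \<in> ?I. s ` {..<k} = S}. \<Prod>i<k. \<eta> (s i)) = fact k * (\<Prod>t\<in>S. \<eta> t)" by simp
  qed
  finally show ?thesis by (simp add: esym_def sum_distrib_left)
qed

lemma det_mat_Leibniz:
  "Determinant.det (Matrix.mat k k (\<lambda>(i, j). h i j))
     = (\<Sum>p | p permutes {..<k}. of_int (sign p) * (\<Prod>i<k. h i (p i)))"
proof -
  have "(\<Prod>i<k. Matrix.mat k k (\<lambda>(i, j). h i j) $$ (i, p i)) = (\<Prod>i<k. h i (p i))"
    if "p permutes {..<k}" for p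
    using permutes_in_image[OF that] by (intro prod.cong) auto
  then show ?thesis
    by (subst det_def'[of _ k]) (auto simp: lessThan_atLeast0 intro!: sum.cong)
qed

text \<open>For \<open>k\<close> members \<open>\<phi> (s i)\<close> of an orthonormal family this is the Gram determinant: the matrix
is the identity if they are distinct, and has two equal rows otherwise.\<close>

lemma det_coincidence:
  "Determinant.det (Matrix.mat k k (\<lambda>(i, j). if s i = s j then 1 else 0))
     = (if inj_on s {..<k} then 1 else (0::complex))"
proof (cases "inj_on s {..<k}")
  case True
  then have "Matrix.mat k k (\<lambda>(i, j). if s i = s j then 1 else (0::complex)) = 1\<^sub>m k"
    by (intro eq_matI) (auto simp: inj_on_def)
  then show ?thesis using True by simp
next
  case False
  then obtain i j where ij: "i < k" "j < k" "i \<noteq> j" "s i = s j" by (auto simp: inj_on_def)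
  have "Determinant.det (Matrix.mat k k (\<lambda>(i, j). if s i = s j then 1 else (0::complex))) = 0"
    by (rule det_identical_rows[OF _ ij(3,1,2)]) (use ij in \<open>auto intro!: eq_vecI\<close>)
  then show ?thesis using False by simp
qed

lemma det_repeated_point:
  fixes h :: "'a \<Rightarrow> 'a \<Rightarrow> complex"
  assumes "\<not> inj_on x {..<k}"
  shows "Determinant.det (Matrix.mat k k (\<lambda>(i, j). h (x i) (x j))) = 0"
proof -
  obtain i j where ij: "i < k" "j < k" "i \<noteq> j" "x i = x j" using assms by (auto simp: inj_on_def)
  show ?thesis
    by (rule det_identical_rows[OF _ ij(3,1,2)]) (use ij in \<open>auto intro!: eq_vecI\<close>)
qed

context sigma_finite_measure
begin

lemma AE_PiM_component_sigma_finite: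
  assumes "finite I" "i \<in> I" "AE y in M. P y"
  shows "AE x in (\<Pi>\<^sub>M i\<in>I. M). P (x i)"
proof -
  interpret product_sigma_finite "\<lambda>_. M" by (simp add: product_sigma_finite_def sigma_finite_measure_axioms)
  obtain N where N: "{y \<in> space M. \<not> P y} \<subseteq> N" "emeasure M N = 0" "N \<in> sets M"
    using assms(3) by (auto elim!: AE_E)
  let ?N = "\<Pi>\<^sub>E j\<in>I. if j = i then N else space M"
  have "emeasure (\<Pi>\<^sub>M i\<in>I. M) ?N = (\<Prod>j\<in>I. emeasure M (if j = i then N else space M))"
    using N(3) assms(1) by (intro emeasure_PiM) auto
  also have "\<dots> = 0" using assms(1,2) N(2) by (intro prod_zero) auto
  finally have "?N \<in> null_sets (\<Pi>\<^sub>M i\<in>I. M)"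
    using N(3) assms(1) by (auto simp: null_sets_def intro!: sets_PiM_I_finite)
  then show ?thesis
    by (rule AE_I') (use N(1) assms(2) in \<open>auto simp: space_PiM PiE_iff extensional_def\<close>)
qed

text \<open>The measure need not be finite, so a pair of coordinates does not have the product measure as its
distribution. Null sets still pull back to null sets, by integrating out the other coordinates.\<close>

lemma AE_PiM_two_components:
  assumes I: "finite I" "i \<in> I" "j \<in> I" "i \<noteq> j" and P: "AE z in M \<Otimes>\<^sub>M M. P (fst z) (snd z)"
  shows "AE x in (\<Pi>\<^sub>M i\<in>I. M). P (x i) (x j)"
proof -
  interpret product_sigma_finite "\<lambda>_. M" by (simp add: product_sigma_finite_def sigma_finite_measure_axioms)
  obtain N where N: "{z \<in> space (M \<Otimes>\<^sub>M M). \<not> P (fst z) (snd z)} \<subseteq> N" "emeasure (M \<Otimes>\<^sub>M M) N = 0"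
    "N \<in> sets (M \<Otimes>\<^sub>M M)"
    using P by (auto elim!: AE_E)
  note N(3)[measurable]
  define I' where "I' = I - {i, j}"
  have I': "I = insert i (insert j I')" "finite I'" "i \<notin> insert j I'" "j \<notin> I'"
    using I by (auto simp: I'_def)
  let ?c = "emeasure (\<Pi>\<^sub>M i\<in>I'. M) (space (\<Pi>\<^sub>M i\<in>I'. M))"
  have m: "(\<lambda>x. indicator N (x i, x j)) \<in> borel_measurable (\<Pi>\<^sub>M i\<in>insert i (insert j I'). M)"
    by measurable
  have m2: "(\<lambda>x. indicator N (y, x j)) \<in> borel_measurable (\<Pi>\<^sub>M i\<in>insert j I'. M)" if "y \<in> space M" for y
    using that by measurable
  have "(\<integral>\<^sup>+ x. indicator N (x i, x j) \<partial>(\<Pi>\<^sub>M i\<in>I. M))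
     = (\<integral>\<^sup>+ y. \<integral>\<^sup>+ x. indicator N (y, x j) \<partial>(\<Pi>\<^sub>M i\<in>insert j I'. M) \<partial>M)"
    unfolding I'(1) using I'(3) I'(2) I(4)
    by (subst product_nn_integral_insert_rev[OF _ _ m]) auto
  also have "\<dots> = (\<integral>\<^sup>+ y. \<integral>\<^sup>+ z. indicator N (y, z) * ?c \<partial>M \<partial>M)"
  proof (rule nn_integral_cong)
    fix y assume y: "y \<in> space M"
    show "(\<integral>\<^sup>+ x. indicator N (y, x j) \<partial>(\<Pi>\<^sub>M i\<in>insert j I'. M)) = (\<integral>\<^sup>+ z. indicator N (y, z) * ?c \<partial>M)"
      using I'(2,4) by (subst product_nn_integral_insert_rev[OF _ _ m2[OF y]]) auto
  qed
  also have "\<dots> = (\<integral>\<^sup>+ z. indicator N z * ?c \<partial>(M \<Otimes>\<^sub>M M))"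
    using nn_integral_fst[of "\<lambda>z. indicator N z * ?c" M] by simp
  also have "\<dots> = 0" by (simp add: nn_integral_multc N(2))
  finally have "AE x in (\<Pi>\<^sub>M i\<in>I. M). indicator N (x i, x j) = (0::ennreal)"
    by (subst (asm) nn_integral_0_iff_AE) (use m I'(1) in auto)
  then show ?thesis
    using AE_space
  proof eventually_elim
    case (elim x)
    then have "(x i, x j) \<in> space (M \<Otimes>\<^sub>M M)" "(x i, x j) \<notin> N"
      using I(2,3) by (auto simp: space_PiM space_pair_measure indicator_def split: if_splits)
    then show ?case using N(1) by auto
  qed
qed

text \<open>Expand the determinant by Leibniz' formula and each product of sums over the maps \<open>s\<close> that assign
an index to every row. Integration over all variables turns the summand of a permutation \<open>p\<close> into
a product of inner products of \<open>\<phi> (s j)\<close> and \<open>\<phi> (s (p\<^sup>-\<^sup>1 j))\<close>. For fixed \<open>s\<close>, these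
products recombine to the determinant of \<open>det_coincidence\<close>, so exactly the injective \<open>s\<close>
survive.\<close>

lemma integral_det_expansion:
  assumes A: "finite A" "\<And>t. t \<in> A \<Longrightarrow> \<phi> t \<in> L2 M"
    and on: "\<And>s t. s \<in> A \<Longrightarrow> t \<in> A \<Longrightarrow> L2_inner M (\<phi> s) (\<phi> t) = (if s = t then 1 else 0)"
  shows "(LINT x|(\<Pi>\<^sub>M i\<in>{..<k}. M). Determinant.det (Matrix.mat k k
            (\<lambda>(i, j). \<Sum>t\<in>A. complex_of_real (\<eta> t) * \<phi> t (x i) * cnj (\<phi> t (x j)))))
     = complex_of_real (fact k * esym \<eta> A k)" (is "(LINT x|?M. ?det x) = _")
proof -
  interpret product_sigma_finite "\<lambda>_. M" by (simp add: product_sigma_finite_def sigma_finite_measure_axioms)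
  let ?F = "{..<k} \<rightarrow>\<^sub>E A" and ?P = "{p. p permutes {..<k}}"
  have finF: "finite ?F" using A(1) by (intro finite_PiE) auto
  have finP: "finite ?P" by (simp add: finite_permutations)
  define c where "c s = (\<Prod>i<k. complex_of_real (\<eta> (s i)))" for s
  define g where "g p s x = (\<Prod>j<k. \<phi> (s j) (x j) * cnj (\<phi> (s (Hilbert_Choice.inv p j)) (x j)))" for p s and x :: "nat \<Rightarrow> 'a"
  have det_eq: "?det x = (\<Sum>p\<in>?P. \<Sum>s\<in>?F. of_int (sign p) * c s * g p s x)" for x
  proof -
    have "(\<Prod>i<k. \<Sum>t\<in>A. complex_of_real (\<eta> t) * \<phi> t (x i) * cnj (\<phi> t (x (p i)))) = (\<Sum>s\<in>?F. c s * g p s x)"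
      if p: "p \<in> ?P" for p
    proof -
      have "(\<Prod>i<k. \<Sum>t\<in>A. complex_of_real (\<eta> t) * \<phi> t (x i) * cnj (\<phi> t (x (p i))))
         = (\<Sum>s\<in>?F. \<Prod>i<k. complex_of_real (\<eta> (s i)) * \<phi> (s i) (x i) * cnj (\<phi> (s i) (x (p i))))"
        by (rule prod_sum_PiE) (use A in auto)
      also have "\<dots> = (\<Sum>s\<in>?F. c s * g p s x)"
      proof (rule sum.cong[OF refl])
        fix s
        have "(\<Prod>j<k. cnj (\<phi> (s (Hilbert_Choice.inv p j)) (x j))) = (\<Prod>i<k. cnj (\<phi> (s i) (x (p i))))"
          using p permutes_inverses(2)[of p "{..<k}"]
          by (subst prod.permute[of p]) (auto simp: comp_def)
        then show "(\<Prod>i<k. complex_of_real (\<eta> (s i)) * \<phi> (s i) (x i) * cnj (\<phi> (s i) (x (p i)))) = c s * g p s x"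
          by (simp add: c_def g_def prod.distrib)
      qed
      finally show ?thesis .
    qed
    then show ?thesis
      by (simp add: det_mat_Leibniz sum_distrib_left mult.assoc)
  qed
  have s_mem: "s j \<in> A" "s (Hilbert_Choice.inv p j) \<in> A" if "p \<in> ?P" "s \<in> ?F" "j \<in> {..<k}" for p s j
    using that permutes_in_image[OF permutes_inv, of p "{..<k}" j] by (auto simp: PiE_iff)
  have g_int: "integrable ?M (g p s)" and g_val: "(LINT x|?M. g p s x) = (\<Prod>i<k. if s i = s (p i) then 1 else 0)"
    if ps: "p \<in> ?P" "s \<in> ?F" for p s
  proof -
    have i: "integrable M (\<lambda>y. \<phi> (s j) y * cnj (\<phi> (s (Hilbert_Choice.inv p j)) y))" if "j \<in> {..<k}" for j
      using s_mem[OF ps that] by (intro integrable_L2_inner A(2))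
    show "integrable ?M (g p s)"
      unfolding g_def by (rule product_integrable_prod) (use i in auto)
    have "(LINT x|?M. g p s x) = (\<Prod>j<k. LINT y|M. \<phi> (s j) y * cnj (\<phi> (s (Hilbert_Choice.inv p j)) y))"
      unfolding g_def by (rule product_integral_prod) (use i in auto)
    also have "\<dots> = (\<Prod>j<k. if s j = s (Hilbert_Choice.inv p j) then 1 else 0)"
      using s_mem[OF ps] by (intro prod.cong refl) (simp add: on flip: L2_inner_def)
    also have "\<dots> = (\<Prod>i<k. if s i = s (p i) then 1 else 0)"
      using ps(1) permutes_inverses(2)[of p "{..<k}"]
      by (subst prod.permute[of p]) (auto simp: comp_def eq_commute intro!: prod.cong)
    finally show "(LINT x|?M. g p s x) = (\<Prod>i<k. if s i = s (p i) then 1 else 0)" .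
  qed
  have "(LINT x|?M. ?det x) = (\<Sum>p\<in>?P. \<Sum>s\<in>?F. of_int (sign p) * c s * (\<Prod>i<k. if s i = s (p i) then 1 else 0))"
    unfolding det_eq using g_int g_val
    by (simp add: Bochner_Integration.integral_sum Bochner_Integration.integrable_sum)
  also have "\<dots> = (\<Sum>s\<in>?F. c s * (\<Sum>p\<in>?P. of_int (sign p) * (\<Prod>i<k. if s i = s (p i) then 1 else 0)))"
    by (subst sum.swap) (simp add: sum_distrib_left mult_ac)
  also have "\<dots> = (\<Sum>s\<in>?F. c s * (if inj_on s {..<k} then 1 else 0))"
    by (simp add: det_coincidence flip: det_mat_Leibniz[where h = "\<lambda>i j. if s i = s j then 1 else 0" for s])
  also have "\<dots> = (\<Sum>s | s \<in> ?F \<and> inj_on s {..<k}. c s)"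
    using finF by (intro sum.mono_neutral_cong_right) auto
  also have "\<dots> = complex_of_real (\<Sum>s | s \<in> ?F \<and> inj_on s {..<k}. \<Prod>i<k. \<eta> (s i))"
    by (simp add: c_def)
  finally show ?thesis unfolding injection_sum_eq_esym[OF A(1)] .
qed

text \<open>The partial sums of the expansion converge at almost every tuple: off the diagonal by
\<open>expansion_pointwise\<close>, on it by hypothesis. Every summand of Leibniz' formula is bounded by the
product of the weights \<open>\<kappa> (x i)\<close>, because each point occurs once as a row and once as a column.
Hence the determinants are dominated by \<open>k!\<close> times this integrable product.\<close>

theorem integral_det_eq_limit:
  assumes e: "eigen_decomposition M H J \<eta> \<phi>"
    and fin: "(\<Sum>k. ennreal (if k \<in> J then \<eta> k else 0)) < \<infinity>"
    and diag: "AE x in M. (\<lambda>N. expansion_sum J \<eta> \<phi> N x x) \<longlonglongrightarrow> H x x"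
    and diag_meas: "(\<lambda>x. H x x) \<in> borel_measurable M"
  shows "integrable (\<Pi>\<^sub>M i\<in>{..<k}. M) (\<lambda>x. Determinant.det (Matrix.mat k k (\<lambda>(i, j). H (x i) (x j))))"
    and "(\<lambda>N. complex_of_real (fact k * esym \<eta> (J \<inter> {..<N}) k)) \<longlonglongrightarrow>
      (LINT x|(\<Pi>\<^sub>M i\<in>{..<k}. M). Determinant.det (Matrix.mat k k (\<lambda>(i, j). H (x i) (x j))))"
proof -
  interpret product_sigma_finite "\<lambda>_. M" by (simp add: product_sigma_finite_def sigma_finite_measure_axioms)
  let ?M = "\<Pi>\<^sub>M i\<in>{..<k}. M"
  have ke: "kernel_expansion M H J \<eta> \<phi>"
    and on: "\<And>i j. i \<in> J \<Longrightarrow> j \<in> J \<Longrightarrow> L2_inner M (\<phi> i) (\<phi> j) = (if i = j then 1 else 0)"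
    using e by (auto simp: eigen_decomposition_iff)
  have fin': "(\<Sum>k. ennreal (if k \<in> J then \<eta> k * L2_norm_sq M (\<phi> k) else 0)) < \<infinity>"
    using fin unfolding eigen_trace_eq[OF e] .
  define \<kappa> where "\<kappa> x = (\<Sum>k. ennreal (if k \<in> J then \<eta> k * (cmod (\<phi> k x))\<^sup>2 else 0))" for x
  note wt = expansion_weight_finite[OF ke fin', folded \<kappa>_def]
  define w where "w x = fact k * (\<Prod>i<k. enn2real (\<kappa> (x i)))" for x
  have w_int: "integrable ?M w"
  proof -
    note wt(1)[measurable]
    have "(\<integral>\<^sup>+ x. ennreal (norm (enn2real (\<kappa> x))) \<partial>M) \<le> (\<integral>\<^sup>+ x. \<kappa> x \<partial>M)"
      by (intro nn_integral_mono) (simp add: ennreal_enn2real_if)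
    then have "integrable M (\<lambda>x. enn2real (\<kappa> x))"
      using wt(3) by (intro integrableI_bounded) (auto intro: le_less_trans)
    then show ?thesis unfolding w_def by (intro integrable_mult_right product_integrable_prod) auto
  qed
  have E_meas: "(\<lambda>x. expansion_sum J \<eta> \<phi> N (x i) (x j)) \<in> borel_measurable ?M" if "i < k" "j < k" for N i j
    using measurable_compose[OF _ expansion_sum_measurable[OF ke, of N], of "\<lambda>x. (x i, x j)" ?M] that by simp
  have H_meas: "(\<lambda>x. H (x i) (x j)) \<in> borel_measurable ?M" if "i < k" "j < k" for i j
    using measurable_compose[OF _ kernel_expansionD(1)[OF ke], of "\<lambda>x. (x i, x j)" ?M] that by simp
  have det_meas: "(\<lambda>x. Determinant.det (Matrix.mat k k (\<lambda>(i, j). G (x i) (x j)))) \<in> borel_measurable ?M"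
    if "\<And>i j. i < k \<Longrightarrow> j < k \<Longrightarrow> (\<lambda>x. G (x i) (x j)) \<in> borel_measurable ?M" for G :: "'a \<Rightarrow> 'a \<Rightarrow> complex"
    unfolding det_mat_Leibniz
    by (intro borel_measurable_sum borel_measurable_times borel_measurable_const borel_measurable_prod that)
       (auto dest: permutes_in_image)
  have fin_AE: "AE x in ?M. \<forall>i\<in>{..<k}. \<kappa> (x i) < \<infinity>"
    by (intro AE_finite_allI AE_PiM_component_sigma_finite wt(4)) auto
  have conv_AE: "AE x in ?M. \<forall>i\<in>{..<k}. \<forall>j\<in>{..<k}. (\<lambda>N. expansion_sum J \<eta> \<phi> N (x i) (x j)) \<longlonglongrightarrow> H (x i) (x j)"
  proof (intro AE_finite_allI finite_lessThan)
    fix i j assume ij: "i \<in> {..<k}" "j \<in> {..<k}"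
    show "AE x in ?M. (\<lambda>N. expansion_sum J \<eta> \<phi> N (x i) (x j)) \<longlonglongrightarrow> H (x i) (x j)"
    proof (cases "i = j")
      case True
      then show ?thesis using AE_PiM_component_sigma_finite[OF _ ij(1) diag] by simp
    next
      case False
      then show ?thesis using AE_PiM_two_components[OF _ ij False expansion_pointwise[OF ke fin']] by simp
    qed
  qed
  let ?dE = "\<lambda>N x. Determinant.det (Matrix.mat k k (\<lambda>(i, j). expansion_sum J \<eta> \<phi> N (x i) (x j)))"
  let ?dH = "\<lambda>x. Determinant.det (Matrix.mat k k (\<lambda>(i, j). H (x i) (x j)))"
  have lim_AE: "AE x in ?M. (\<lambda>N. ?dE N x) \<longlonglongrightarrow> ?dH x"
    using conv_AE
  proof eventually_elim
    case (elim x)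
    show ?case unfolding det_mat_Leibniz
      by (intro tendsto_sum tendsto_mult tendsto_const tendsto_prod) (use elim in \<open>auto dest: permutes_in_image\<close>)
  qed
  have bound_AE: "AE x in ?M. norm (?dE N x) \<le> w x" for N
    using fin_AE
  proof eventually_elim
    case (elim x)
    let ?r = "\<lambda>i. enn2real (\<kappa> (x i))"
    have E: "cmod (expansion_sum J \<eta> \<phi> N (x i) (x j)) \<le> sqrt (?r i) * sqrt (?r j)" if "i < k" "j < k" for i j
    proof -
      have "(cmod (expansion_sum J \<eta> \<phi> N (x i) (x j)))\<^sup>2 \<le> ?r i * ?r j"
        unfolding \<kappa>_def
        by (rule expansion_sum_bound(2)) (use kernel_expansionD(2)[OF ke] elim that in \<open>auto simp: \<kappa>_def\<close>)
      then show ?thesis by (simp add: real_le_rsqrt flip: real_sqrt_mult)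
    qed
    have summand: "norm (of_int (sign p) * (\<Prod>i<k. expansion_sum J \<eta> \<phi> N (x i) (x (p i)))) \<le> (\<Prod>i<k. ?r i)"
      if p: "p permutes {..<k}" for p
    proof -
      have "norm (of_int (sign p) * (\<Prod>i<k. expansion_sum J \<eta> \<phi> N (x i) (x (p i)))) = (\<Prod>i<k. cmod (expansion_sum J \<eta> \<phi> N (x i) (x (p i))))"
        by (simp add: norm_mult prod_norm sign_def)
      also have "\<dots> \<le> (\<Prod>i<k. sqrt (?r i) * sqrt (?r (p i)))"
        by (intro prod_mono conjI E norm_ge_zero) (use permutes_in_image[OF p] in auto)
      also have "\<dots> = (\<Prod>i<k. sqrt (?r i)) * (\<Prod>i<k. sqrt (?r i))"
        unfolding prod.distrib using prod.permute[OF p, of "\<lambda>i. sqrt (?r i)"] by (simp add: comp_def)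
      also have "\<dots> = (\<Prod>i<k. ?r i)"
        unfolding prod.distrib[symmetric] by simp
      finally show ?thesis .
    qed
    have "norm (?dE N x) \<le> (\<Sum>p | p permutes {..<k}. \<Prod>i<k. ?r i)"
      unfolding det_mat_Leibniz by (rule sum_norm_le) (use summand in auto)
    also have "\<dots> = w x" by (simp add: w_def card_permutations)
    finally show ?case .
  qed
  show "integrable ?M ?dH"
    by (rule integrable_dominated_convergence[OF _ _ w_int lim_AE bound_AE]) (use det_meas E_meas H_meas in auto)
  have "(\<lambda>N. LINT x|?M. ?dE N x) \<longlonglongrightarrow> (LINT x|?M. ?dH x)"
    by (rule integral_dominated_convergence[OF _ _ w_int lim_AE bound_AE]) (use det_meas E_meas H_meas in auto)
  moreover have "(LINT x|?M. ?dE N x) = complex_of_real (fact k * esym \<eta> (J \<inter> {..<N}) k)" for N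
    unfolding expansion_sum_def
    by (rule integral_det_expansion) (use kernel_expansionD(3)[OF ke] on in auto)
  ultimately show "(\<lambda>N. complex_of_real (fact k * esym \<eta> (J \<inter> {..<N}) k)) \<longlonglongrightarrow> (LINT x|?M. ?dH x)" by simp
qed

end

section \<open>The number of points of a determinantal process\<close>

lemma esym_0: "finite A \<Longrightarrow> esym \<eta> A 0 = 1"
proof -
  assume "finite A"
  then have "{S. S \<subseteq> A \<and> card S = 0} = {{}}" by (auto dest: finite_subset)
  then show ?thesis by (simp add: esym_def)
qed

lemma esym_1: "esym \<eta> A 1 = (\<Sum>t\<in>A. \<eta> t)"
proof -
  have "{S. S \<subseteq> A \<and> card S = 1} = (\<lambda>t. {t}) ` A"
    by (auto simp: card_1_singleton_iff)
  then show ?thesis by (simp add: esym_def sum.reindex)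
qed

lemma esym_2:
  fixes A :: "'a set"
  assumes A: "finite A"
  shows "2 * esym \<eta> A 2 = (\<Sum>t\<in>A. \<eta> t)\<^sup>2 - (\<Sum>t\<in>A. (\<eta> t)\<^sup>2)"
proof -
  have "2 * esym \<eta> A 2 = (\<Sum>s | s \<in> {..<2} \<rightarrow>\<^sub>E A \<and> inj_on s {..<2::nat}. \<Prod>i<2. \<eta> (s i))"
    unfolding injection_sum_eq_esym[OF A] by (simp add: numeral_2_eq_2)
  also have "\<dots> = (\<Sum>(a, b)\<in>A \<times> A - (\<lambda>a. (a, a)) ` A. \<eta> a * \<eta> b)"
  proof -
    let ?S = "{s. s \<in> {..<2} \<rightarrow>\<^sub>E A \<and> inj_on s {..<2::nat}}" and ?F = "\<lambda>s::nat \<Rightarrow> 'a. (s 0, s 1)"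
    have inj: "inj_on ?F ?S"
    proof (rule inj_onI)
      fix s s' assume s: "s \<in> ?S" "s' \<in> ?S" "?F s = ?F s'"
      then have "s i = s' i" if "i \<in> {..<2}" for i using that less_2_cases[of i] by auto
      then show "s = s'" using s by (intro PiE_ext[of s "{..<2}" "\<lambda>_. A" s']) auto
    qed
    have img: "?F ` ?S = A \<times> A - (\<lambda>a. (a, a)) ` A"
    proof (intro equalityI subsetI)
      fix p assume "p \<in> ?F ` ?S"
      then obtain s where s: "s \<in> {..<2} \<rightarrow>\<^sub>E A" "inj_on s {..<2::nat}" "p = ?F s" by auto
      have "s 0 \<noteq> s 1" using inj_onD[OF s(2), of 0 1] by auto
      then show "p \<in> A \<times> A - (\<lambda>a. (a, a)) ` A" using PiE_mem[OF s(1)] s(3) by auto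
    next
      fix p assume p: "p \<in> A \<times> A - (\<lambda>a. (a, a)) ` A"
      let ?s = "\<lambda>i\<in>{..<2::nat}. if i = 0 then fst p else snd p"
      have "fst p \<noteq> snd p" "fst p \<in> A" "snd p \<in> A" using p by (auto simp: image_iff)
      then have "?s \<in> ?S" by (auto simp: inj_on_def dest!: less_2_cases)
      moreover have "?F ?s = p" by simp
      ultimately show "p \<in> ?F ` ?S" by (metis (no_types, lifting) image_eqI)
    qed
    have "(\<Sum>s\<in>?S. \<Prod>i<2. \<eta> (s i)) = (\<Sum>s\<in>?S. case ?F s of (a, b) \<Rightarrow> \<eta> a * \<eta> b)"
      by (simp add: numeral_2_eq_2)
    also have "\<dots> = (\<Sum>(a, b)\<in>?F ` ?S. \<eta> a * \<eta> b)"
      by (subst sum.reindex[OF inj]) (simp add: comp_def)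
    finally show ?thesis unfolding img .
  qed
  also have "\<dots> = (\<Sum>(a, b)\<in>A \<times> A. \<eta> a * \<eta> b) - (\<Sum>(a, b)\<in>(\<lambda>a. (a, a)) ` A. \<eta> a * \<eta> b)"
    using A by (intro sum_diff) auto
  also have "(\<Sum>(a, b)\<in>A \<times> A. \<eta> a * \<eta> b) = (\<Sum>t\<in>A. \<eta> t)\<^sup>2"
    by (simp add: power2_eq_square sum_product sum.cartesian_product)
  also have "(\<Sum>(a, b)\<in>(\<lambda>a. (a, a)) ` A. \<eta> a * \<eta> b) = (\<Sum>t\<in>A. (\<eta> t)\<^sup>2)"
    by (subst sum.reindex) (auto simp: inj_on_def power2_eq_square)
  finally show ?thesis .
qed

lemma esym_nonneg: "(\<And>t. t \<in> A \<Longrightarrow> 0 \<le> \<eta> t) \<Longrightarrow> 0 \<le> esym \<eta> A k"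
  unfolding esym_def by (intro sum_nonneg prod_nonneg) auto

lemma esym_bound:
  assumes A: "finite A" and \<eta>: "\<And>t. t \<in> A \<Longrightarrow> 0 \<le> \<eta> t"
  shows "esym \<eta> A k \<le> (\<Sum>t\<in>A. \<eta> t) ^ k / fact k"
proof -
  have "fact k * esym \<eta> A k \<le> (\<Sum>s\<in>{..<k} \<rightarrow>\<^sub>E A. \<Prod>i<k. \<eta> (s i))"
    unfolding injection_sum_eq_esym[OF A, symmetric]
  proof (rule sum_mono2)
    show "finite ({..<k} \<rightarrow>\<^sub>E A)" using A by (intro finite_PiE) auto
    show "0 \<le> (\<Prod>i<k. \<eta> (s i))" if "s \<in> ({..<k} \<rightarrow>\<^sub>E A) - {s. s \<in> {..<k} \<rightarrow>\<^sub>E A \<and> inj_on s {..<k}}" for s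
      using that by (intro prod_nonneg \<eta>) (auto intro: PiE_mem)
  qed auto
  also have "\<dots> = (\<Prod>i<k. \<Sum>t\<in>A. \<eta> t)"
    using A by (subst prod_sum_PiE) auto
  finally show ?thesis by (simp add: field_simps)
qed

lemma esym_generating_function:
  assumes A: "finite A"
  shows "(\<lambda>k. esym \<eta> A k * z ^ k) sums (\<Prod>t\<in>A. 1 + z * \<eta> t)"
proof -
  have "(\<Prod>t\<in>A. 1 + z * \<eta> t) = (\<Prod>t\<in>A. z * \<eta> t + 1)"
    by (simp add: add.commute)
  also have "\<dots> = (\<Sum>S\<in>Pow A. z ^ card S * (\<Prod>t\<in>S. \<eta> t))"
    by (subst prod_add[OF A]) (simp add: prod.distrib)
  also have "\<dots> = (\<Sum>k\<in>{..card A}. \<Sum>S\<in>{S \<in> Pow A. card S = k}. z ^ card S * (\<Prod>t\<in>S. \<eta> t))"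
    using A by (intro sum.group[symmetric]) (auto intro: card_mono)
  also have "\<dots> = (\<Sum>k\<in>{..card A}. esym \<eta> A k * z ^ k)"
    unfolding esym_def sum_distrib_right by (intro sum.cong) (auto simp: mult.commute)
  finally have eq: "(\<Prod>t\<in>A. 1 + z * \<eta> t) = (\<Sum>k\<in>{..card A}. esym \<eta> A k * z ^ k)" .
  have "esym \<eta> A k = 0" if "k \<notin> {..card A}" for k
    unfolding esym_def using that card_mono[OF A] by (intro sum.neutral) auto
  then show ?thesis
    unfolding eq by (intro sums_finite) auto
qed

lemma det_cut_kernel:
  assumes x: "x \<in> extensional {..<k}"
  shows "Determinant.det (Matrix.mat k k (\<lambda>(i, j). cut_kernel D K (x i) (x j)))
     = indicator ({..<k} \<rightarrow>\<^sub>E D) x * Determinant.det (Matrix.mat k k (\<lambda>(i, j). K (x i) (x j)))"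
proof (cases "x \<in> {..<k} \<rightarrow>\<^sub>E D")
  case True
  then have "Matrix.mat k k (\<lambda>(i, j). cut_kernel D K (x i) (x j)) = Matrix.mat k k (\<lambda>(i, j). K (x i) (x j))"
    by (intro eq_matI) (auto simp: cut_kernel_def PiE_iff)
  then show ?thesis using True by simp
next
  case False
  then obtain i where i: "i < k" "x i \<notin> D" using x by (auto simp: PiE_iff)
  have zero: "(\<Prod>i<k. cut_kernel D K (x i) (x (p i))) = 0" for p
    by (rule prod_zero) (use i in \<open>auto simp: cut_kernel_def intro!: bexI[of _ i]\<close>)
  show ?thesis unfolding det_mat_Leibniz zero using False by simp
qed

locale determinantal_count =
  fixes \<mu> :: "'a::polish_space measure" and P :: "'w measure" and X :: "'w \<Rightarrow> 'a measure"
    and K :: "'a \<Rightarrow> 'a \<Rightarrow> complex" and D :: "'a set" and J :: "nat set"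
    and \<eta> :: "nat \<Rightarrow> real" and \<phi> :: "nat \<Rightarrow> 'a \<Rightarrow> complex"
  assumes radon: "radon_measure \<mu>" and sigma_finite_\<mu>: "sigma_finite_measure \<mu>"
    and determinantal: "determinantal_process P X \<mu> K" and admissible: "admissible_kernel \<mu> K"
    and D_borel: "D \<in> sets borel" and trace_class: "trace_class \<mu> (cut_kernel D K)"
    and eigen: "eigen_decomposition \<mu> (cut_kernel D K) J \<eta> \<phi>"
begin

sublocale base: sigma_finite_measure \<mu> by (rule sigma_finite_\<mu>)

sublocale prob_space P
  using determinantal unfolding determinantal_process_def simple_point_process_def point_process_def by blast

lemma sets_\<mu>: "sets \<mu> = sets borel"
  using radon by (simp add: radon_measure_def)

lemma \<eta>_pos: "k \<in> J \<Longrightarrow> 0 < \<eta> k"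
  using eigen by (simp add: eigen_decomposition_def)

definition weight :: "nat \<Rightarrow> real" where "weight k = (if k \<in> J then \<eta> k else 0)"

lemma weight_nonneg: "0 \<le> weight k"
  using \<eta>_pos by (auto simp: weight_def less_imp_le)

text \<open>Being trace-class provides some decomposition with summable eigenvalues; by \<open>trace_unique\<close> the
eigenvalues of the given decomposition have the same sum.\<close>

lemma trace_finite: "(\<Sum>k. ennreal (if k \<in> J then \<eta> k else 0)) < \<infinity>"
proof -
  obtain I \<theta> \<psi> where d: "eigen_decomposition \<mu> (cut_kernel D K) I \<theta> \<psi>" "\<theta> summable_on I"
    using trace_class by (auto simp: trace_class_def)
  have ke: "kernel_expansion \<mu> (cut_kernel D K) J \<eta> \<phi>" using eigen by (simp add: eigen_decomposition_iff)
  have pos: "0 \<le> (if k \<in> I then \<theta> k else 0)" for k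
    using d(1) by (auto simp: eigen_decomposition_def less_imp_le)
  have "(\<Sum>k. ennreal (if k \<in> J then \<eta> k else 0)) = (\<Sum>k. ennreal (if k \<in> I then \<theta> k else 0))"
    unfolding base.trace_unique[OF d(1) ke] by (rule eigen_trace_eq[OF eigen, symmetric])
  also have "\<dots> = ennreal (infsum \<theta> I)"
    by (rule suminf_ennreal_eq[OF pos summable_on_nonneg_sums[OF d(2)]])
  finally show ?thesis by simp
qed

lemma summable_weight: "summable weight"
  unfolding weight_def[abs_def] using trace_finite weight_nonneg
  by (intro summable_suminf_not_top) (auto simp: weight_def)

lemma sum_weight: "(\<Sum>k\<in>J \<inter> {..<N}. g (\<eta> k)) = (\<Sum>k<N. g (weight k))" if "g 0 = 0" for g :: "real \<Rightarrow> real"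
  unfolding sum_restrict_lessThan using that by (intro sum.cong) (auto simp: weight_def)

definition eigen_sum :: real where "eigen_sum = suminf weight"

lemma partial_sum_le_eigen_sum: "(\<Sum>k\<in>J \<inter> {..<N}. \<eta> k) \<le> eigen_sum"
  unfolding sum_weight[of "\<lambda>x. x", simplified] eigen_sum_def
  by (rule sum_le_suminf[OF summable_weight]) (auto simp: weight_nonneg)

text \<open>The number of points in \<open>D\<close>; it is \<open>0\<close> on the null event that there are infinitely many.\<close>

definition pts :: "'w \<Rightarrow> nat" where "pts \<omega> = nat \<lfloor>measure (X \<omega>) D\<rfloor>"

text \<open>Multiplying the determinant of \<open>K\<close> by the indicator of \<open>D\<^sup>k\<close> gives the determinant of the
restricted kernel, whose integral is known. Tuples with a repeated point may be added or removed
freely: there the matrix has two equal rows.\<close>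

lemma intensity_integral:
  assumes \<rho>: "joint_intensities P X \<mu> \<rho>" and k: "1 \<le> k"
    and det: "AE x in (\<Pi>\<^sub>M i\<in>{..<k}. \<mu>).
           complex_of_real (\<rho> k x) = Determinant.det (Matrix.mat k k (\<lambda>(i, j). K (x i) (x j)))"
  obtains L where "(\<lambda>N. esym \<eta> (J \<inter> {..<N}) k) \<longlonglongrightarrow> L"
    "(\<integral>\<^sup>+ x\<in>({..<k} \<rightarrow>\<^sub>E D). ennreal (\<rho> k x) \<partial>(\<Pi>\<^sub>M i\<in>{..<k}. \<mu>)) = ennreal (fact k * L)"
    "(\<integral>\<^sup>+ x\<in>{x \<in> {..<k} \<rightarrow>\<^sub>E D. inj_on x {..<k}}. ennreal (\<rho> k x) \<partial>(\<Pi>\<^sub>M i\<in>{..<k}. \<mu>)) = ennreal (fact k * L)"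
proof -
  let ?M = "\<Pi>\<^sub>M i\<in>{..<k}. \<mu>"
  let ?H = "cut_kernel D K"
  let ?dH = "\<lambda>x. Determinant.det (Matrix.mat k k (\<lambda>(i, j). ?H (x i) (x j)))"
  have ke: "kernel_expansion \<mu> ?H J \<eta> \<phi>" using eigen by (simp add: eigen_decomposition_iff)
  have diag_meas: "(\<lambda>x. ?H x x) \<in> borel_measurable \<mu>"
    using measurable_compose[OF _ kernel_expansionD(1)[OF ke], of "\<lambda>x. (x, x)" \<mu>] by simp
  note lim = base.integral_det_eq_limit[OF eigen trace_finite
      kernel_diagonal[OF radon sigma_finite_\<mu> admissible D_borel eigen trace_finite] diag_meas, where k = k]
  define L where "L = Re (LINT x|?M. ?dH x) / fact k"
  have "(\<lambda>N. Re (complex_of_real (fact k * esym \<eta> (J \<inter> {..<N}) k)) / fact k) \<longlonglongrightarrow> L"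
    unfolding L_def by (intro tendsto_divide tendsto_Re lim(2) tendsto_const) simp
  then have 1: "(\<lambda>N. esym \<eta> (J \<inter> {..<N}) k) \<longlonglongrightarrow> L" by simp
  have \<rho>_nonneg: "0 \<le> \<rho> k x" for x using \<rho> k by (simp add: joint_intensities_def)
  have eq: "AE x in ?M. Re (?dH x) = indicator ({..<k} \<rightarrow>\<^sub>E D) x * \<rho> k x"
    using det AE_space
  proof eventually_elim
    case (elim x)
    have "x \<in> extensional {..<k}" using elim(2) by (simp add: space_PiM PiE_def)
    then show ?case by (simp add: det_cut_kernel flip: elim(1)) (simp add: indicator_def)
  qed
  have "(\<integral>\<^sup>+ x. ennreal (Re (?dH x)) \<partial>?M) = ennreal (LINT x|?M. Re (?dH x))"
    by (rule nn_integral_eq_integral)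
       (use lim(1) eq \<rho>_nonneg in \<open>auto intro: integrable_Re elim!: eventually_mono\<close>)
  also have "\<dots> = ennreal (fact k * L)"
    using integral_Re[OF lim(1)] by (simp add: L_def)
  finally have int: "(\<integral>\<^sup>+ x. ennreal (Re (?dH x)) \<partial>?M) = ennreal (fact k * L)" .
  have 2: "(\<integral>\<^sup>+ x\<in>({..<k} \<rightarrow>\<^sub>E D). ennreal (\<rho> k x) \<partial>?M) = ennreal (fact k * L)"
    unfolding int[symmetric]
    by (rule nn_integral_cong_AE) (use eq in \<open>eventually_elim, auto simp: indicator_def\<close>)
  have 3: "(\<integral>\<^sup>+ x\<in>{x \<in> {..<k} \<rightarrow>\<^sub>E D. inj_on x {..<k}}. ennreal (\<rho> k x) \<partial>?M) = ennreal (fact k * L)"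
    unfolding 2[symmetric]
  proof (rule nn_integral_cong_AE, use det in eventually_elim)
    case (elim x)
    have "\<rho> k x = 0" if "\<not> inj_on x {..<k}"
      using elim det_repeated_point[OF that, of K] by simp
    then show ?case by (cases "inj_on x {..<k}") (auto simp: indicator_def)
  qed
  show thesis by (rule that[OF 1 2 3])
qed

lemma AE_finite_count: "AE \<omega> in P. emeasure (X \<omega>) D < \<infinity>"
proof -
  obtain \<rho> where \<rho>: "joint_intensities P X \<mu> \<rho>"
    "\<And>k. 1 \<le> k \<Longrightarrow> AE x in (\<Pi>\<^sub>M i\<in>{..<k}. \<mu>).
           complex_of_real (\<rho> k x) = Determinant.det (Matrix.mat k k (\<lambda>(i, j). K (x i) (x j)))"
    using determinantal unfolding determinantal_process_def by blast
  obtain L where L: "(\<integral>\<^sup>+ x\<in>({..<1} \<rightarrow>\<^sub>E D). ennreal (\<rho> 1 x) \<partial>(\<Pi>\<^sub>M i\<in>{..<1}. \<mu>)) = ennreal (fact 1 * L)"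
    by (rule intensity_integral[OF \<rho>(1) order_refl \<rho>(2)[OF order_refl]])
  have meas: "(\<lambda>\<omega>. emeasure (X \<omega>) D) \<in> borel_measurable P"
    using determinantal D_borel
    unfolding determinantal_process_def simple_point_process_def point_process_def by blast
  have "(\<integral>\<^sup>+ \<omega>. (\<Prod>i<1::nat. emeasure (X \<omega>) D) \<partial>P) =
           (\<integral>\<^sup>+ x\<in>(\<Pi>\<^sub>E i\<in>{..<1}. D). ennreal (\<rho> 1 x) \<partial>(\<Pi>\<^sub>M i\<in>{..<1}. \<mu>))"
    using \<rho>(1)[unfolded joint_intensities_def, rule_format, OF order_refl, THEN conjunct2, THEN conjunct2,
        THEN conjunct2, rule_format, of "\<lambda>_. D"] D_borel
    by (auto simp: disjoint_family_on_def)
  then have "(\<integral>\<^sup>+ \<omega>. emeasure (X \<omega>) D \<partial>P) < \<infinity>" unfolding L by (simp add: lessThan_Suc)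
  then show ?thesis
    using nn_integral_PInf_AE[OF meas] by (auto simp: less_top[symmetric])
qed

lemma pts_measurable: "pts \<in> measurable P (count_space UNIV)"
proof -
  have "(\<lambda>\<omega>. emeasure (X \<omega>) D) \<in> borel_measurable P"
    using determinantal D_borel
    unfolding determinantal_process_def simple_point_process_def point_process_def by blast
  then have "(\<lambda>\<omega>. measure (X \<omega>) D) \<in> borel_measurable P"
    unfolding measure_def by measurable
  then have "(\<lambda>\<omega>. \<lfloor>measure (X \<omega>) D\<rfloor>) \<in> measurable P (count_space UNIV)"
    by (rule measurable_compose[OF _ measurable_real_floor])
  then show ?thesis unfolding pts_def[abs_def] by (rule measurable_compose) simp
qed

lemma pts_function_measurable: "(\<lambda>\<omega>. g (pts \<omega>) :: real) \<in> borel_measurable P"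
  by (rule measurable_compose[OF pts_measurable]) simp

lemma num_points_eq: "\<omega> \<in> space P \<Longrightarrow> num_points X D \<omega> = real (pts \<omega>)"
proof -
  assume \<omega>: "\<omega> \<in> space P"
  note pp = determinantal[unfolded determinantal_process_def simple_point_process_def point_process_def,
      THEN conjunct1, THEN conjunct1, THEN conjunct2, THEN conjunct1, THEN bspec, OF \<omega>]
  have "emeasure (X \<omega>) D \<in> insert \<infinity> \<nat>"
    using pp[THEN conjunct2, THEN conjunct2, THEN bspec, OF D_borel] .
  then have "measure (X \<omega>) D \<in> \<nat>" by (auto simp: measure_def Nats_def)
  then show ?thesis by (auto simp: num_points_def pts_def Nats_def)
qed

definition fmoment :: "nat \<Rightarrow> real" where "fmoment k = expectation (\<lambda>\<omega>. real (pts \<omega> choose k))"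

lemma factorial_moment_limit:
  shows "integrable P (\<lambda>\<omega>. real (pts \<omega> choose k))"
    and "(\<lambda>N. esym \<eta> (J \<inter> {..<N}) k) \<longlonglongrightarrow> fmoment k"
proof -
  have "integrable P (\<lambda>\<omega>. real (pts \<omega> choose k)) \<and> (\<lambda>N. esym \<eta> (J \<inter> {..<N}) k) \<longlonglongrightarrow> fmoment k"
  proof (cases "k = 0")
    case True
    then show ?thesis by (simp add: fmoment_def esym_0 prob_space)
  next
    case False
    then have k: "1 \<le> k" by simp
    obtain \<rho> where \<rho>: "joint_intensities P X \<mu> \<rho>"
      "AE x in (\<Pi>\<^sub>M i\<in>{..<k}. \<mu>).
           complex_of_real (\<rho> k x) = Determinant.det (Matrix.mat k k (\<lambda>(i, j). K (x i) (x j)))"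
      using determinantal k unfolding determinantal_process_def by blast
    obtain L where L: "(\<lambda>N. esym \<eta> (J \<inter> {..<N}) k) \<longlonglongrightarrow> L"
      "(\<integral>\<^sup>+ x\<in>{x \<in> {..<k} \<rightarrow>\<^sub>E D. inj_on x {..<k}}. ennreal (\<rho> k x) \<partial>(\<Pi>\<^sub>M i\<in>{..<k}. \<mu>)) = ennreal (fact k * L)"
      by (rule intensity_integral[OF \<rho>(1) k \<rho>(2)])
    have L0: "0 \<le> L"
      by (rule LIMSEQ_le_const[OF L(1)]) (auto intro!: esym_nonneg simp: \<eta>_pos less_imp_le)
    obtain B :: "nat \<Rightarrow> 'a set" where B: "\<And>i. open (B i)" "\<And>x y. (\<And>i. x \<in> B i \<longleftrightarrow> y \<in> B i) \<Longrightarrow> x = y"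
      using separating_open_sequence by metis
    interpret sep: separating_sequence B D by unfold_locales (use B D_borel in auto)
    have simple: "simple_point_process P X" using determinantal by (simp add: determinantal_process_def)
    have "(\<integral>\<^sup>+ \<omega>. of_nat (fact k * (pts \<omega> choose k)) \<partial>P) = ennreal (fact k * L)"
      using sep.factorial_moment[OF simple \<rho>(1) sets_\<mu> sigma_finite_\<mu> AE_finite_count k]
      unfolding pts_def L(2) .
    then have nn: "(\<integral>\<^sup>+ \<omega>. ennreal (fact k * real (pts \<omega> choose k)) \<partial>P) = ennreal (fact k * L)"
      by (simp add: ennreal_of_nat_eq_real_of_nat)
    have "has_bochner_integral P (\<lambda>\<omega>. fact k * real (pts \<omega> choose k)) (fact k * L)"
      by (rule has_bochner_integral_nn_integral[OF _ _ _ nn]) (use L0 pts_function_measurable in auto)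
    then have "integrable P (\<lambda>\<omega>. real (pts \<omega> choose k))" "fmoment k = L"
      by (auto simp: has_bochner_integral_iff fmoment_def)
    then show ?thesis using L(1) by simp
  qed
  then show "integrable P (\<lambda>\<omega>. real (pts \<omega> choose k))"
    "(\<lambda>N. esym \<eta> (J \<inter> {..<N}) k) \<longlonglongrightarrow> fmoment k" by blast+
qed

lemma esym_le: "\<bar>esym \<eta> (J \<inter> {..<N}) k\<bar> \<le> eigen_sum ^ k / fact k"
proof -
  have pos: "\<And>t. t \<in> J \<inter> {..<N} \<Longrightarrow> 0 \<le> \<eta> t" by (auto simp: \<eta>_pos less_imp_le)
  have "esym \<eta> (J \<inter> {..<N}) k \<le> (\<Sum>t\<in>J \<inter> {..<N}. \<eta> t) ^ k / fact k"
    by (rule esym_bound) (use pos in auto)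
  also have "\<dots> \<le> eigen_sum ^ k / fact k"
    by (intro divide_right_mono power_mono partial_sum_le_eigen_sum sum_nonneg pos) auto
  finally have "esym \<eta> (J \<inter> {..<N}) k \<le> eigen_sum ^ k / fact k" .
  moreover have "0 \<le> esym \<eta> (J \<inter> {..<N}) k" by (rule esym_nonneg[OF pos])
  ultimately show ?thesis by simp
qed

lemma fmoment_bounds: "0 \<le> fmoment k" "fmoment k \<le> eigen_sum ^ k / fact k"
proof -
  show "0 \<le> fmoment k" by (simp add: fmoment_def)
  show "fmoment k \<le> eigen_sum ^ k / fact k"
    by (rule LIMSEQ_le_const2[OF factorial_moment_limit(2)]) (use esym_le abs_le_D1 in blast)
qed

text \<open>By the binomial theorem the generating function is the power series of the binomial moments, which
are the limits of the elementary symmetric polynomials of the first \<open>N\<close> eigenvalues. The bound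
\<open>eigen_sum ^ k / k!\<close> permits interchanging sum, expectation and limit for every real \<open>z\<close>. The
limit is the generating function of a sum of independent Bernoulli variables with parameters
\<open>\<eta> t\<close>, written without constructing these variables.\<close>

theorem generating_function:
  shows "integrable P (\<lambda>\<omega>. (1 + z) ^ pts \<omega>)"
    and "(\<lambda>N. \<Prod>t\<in>J \<inter> {..<N}. 1 + z * \<eta> t) \<longlonglongrightarrow> expectation (\<lambda>\<omega>. (1 + z) ^ pts \<omega>)"
proof -
  define f where "f k \<omega> = real (pts \<omega> choose k) * z ^ k" for k \<omega>
  have f_sums: "(\<lambda>k. f k \<omega>) sums (1 + z) ^ pts \<omega>" for \<omega>
  proof -
    have "(1 + z) ^ pts \<omega> = (\<Sum>k\<le>pts \<omega>. f k \<omega>)"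
      using binomial_ring[of z 1 "pts \<omega>"] by (simp add: f_def add.commute)
    moreover have "(\<lambda>k. f k \<omega>) sums (\<Sum>k\<le>pts \<omega>. f k \<omega>)"
      by (rule sums_finite) (auto simp: f_def binomial_eq_0)
    ultimately show ?thesis by simp
  qed
  have f_abs: "summable (\<lambda>k. norm (f k \<omega>))" for \<omega>
    by (rule summable_finite[of "{..pts \<omega>}"]) (auto simp: f_def binomial_eq_0)
  have f_int: "integrable P (f k)" for k
    unfolding f_def using factorial_moment_limit(1) by (rule integrable_mult_left)
  have exp_summable: "summable (\<lambda>k. eigen_sum ^ k / fact k * \<bar>z\<bar> ^ k)"
    using summable_exp[of "eigen_sum * \<bar>z\<bar>"] by (simp add: power_mult_distrib field_simps)
  have f_norm: "summable (\<lambda>k. LINT \<omega>|P. norm (f k \<omega>))"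
  proof (rule summable_comparison_test'[OF exp_summable, of 0])
    fix k
    have "(LINT \<omega>|P. norm (f k \<omega>)) = fmoment k * \<bar>z\<bar> ^ k"
      by (simp add: f_def fmoment_def abs_mult power_abs)
    moreover have "fmoment k * \<bar>z\<bar> ^ k \<le> eigen_sum ^ k / fact k * \<bar>z\<bar> ^ k"
      by (intro mult_right_mono fmoment_bounds) simp
    ultimately show "norm (LINT \<omega>|P. norm (f k \<omega>)) \<le> eigen_sum ^ k / fact k * \<bar>z\<bar> ^ k"
      using fmoment_bounds(1)[of k] by (simp add: abs_mult)
  qed
  have suminf_f: "(\<Sum>k. f k \<omega>) = (1 + z) ^ pts \<omega>" for \<omega>
    using sums_unique[OF f_sums] by simp
  show "integrable P (\<lambda>\<omega>. (1 + z) ^ pts \<omega>)"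
    using integrable_suminf[OF f_int AE_I2[OF f_abs] f_norm] unfolding suminf_f .
  have E: "expectation (\<lambda>\<omega>. (1 + z) ^ pts \<omega>) = (\<Sum>k. fmoment k * z ^ k)"
    using integral_suminf[OF f_int AE_I2[OF f_abs] f_norm] unfolding suminf_f
    by (simp add: f_def fmoment_def)
  have "(\<lambda>N. \<Sum>k. esym \<eta> (J \<inter> {..<N}) k * z ^ k) \<longlonglongrightarrow> (\<Sum>k. fmoment k * z ^ k)"
  proof (rule tannerys_theorem[THEN conjunct2, THEN conjunct2])
    show "(\<lambda>N. esym \<eta> (J \<inter> {..<N}) k * z ^ k) \<longlonglongrightarrow> fmoment k * z ^ k" for k
      by (intro tendsto_mult factorial_moment_limit(2) tendsto_const)
    have "norm (esym \<eta> (J \<inter> {..<N}) k * z ^ k) \<le> eigen_sum ^ k / fact k * \<bar>z\<bar> ^ k" for k N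
      unfolding real_norm_def abs_mult power_abs by (intro mult_right_mono esym_le) simp
    then show "\<forall>\<^sub>F (k, N) in at_top \<times>\<^sub>F sequentially.
        norm (esym \<eta> (J \<inter> {..<N}) k * z ^ k) \<le> eigen_sum ^ k / fact k * \<bar>z\<bar> ^ k"
      by (intro always_eventually) auto
  qed (use exp_summable in auto)
  moreover have gf: "(\<Prod>t\<in>J \<inter> {..<N}. 1 + z * \<eta> t) = (\<Sum>k. esym \<eta> (J \<inter> {..<N}) k * z ^ k)" for N
    by (rule sums_unique[OF esym_generating_function]) simp
  ultimately show "(\<lambda>N. \<Prod>t\<in>J \<inter> {..<N}. 1 + z * \<eta> t) \<longlonglongrightarrow> expectation (\<lambda>\<omega>. (1 + z) ^ pts \<omega>)"
    unfolding E by (simp only: gf)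
qed

lemma generating_function_pos:
  fixes z :: real
  assumes "-1 < z"
  shows "0 < expectation (\<lambda>\<omega>. (1 + z) ^ pts \<omega>)"
proof -
  have "expectation (\<lambda>\<omega>. (1 + z) ^ pts \<omega>) \<noteq> 0"
  proof
    assume "expectation (\<lambda>\<omega>. (1 + z) ^ pts \<omega>) = 0"
    then have "AE \<omega> in P. (1 + z) ^ pts \<omega> = 0"
      using assms integral_nonneg_eq_0_iff_AE[OF generating_function(1)[of z]] by simp
    then show False using assms by simp
  qed
  moreover have "0 \<le> expectation (\<lambda>\<omega>. (1 + z) ^ pts \<omega>)" using assms by simp
  ultimately show ?thesis by linarith
qed

text \<open>For \<open>\<eta> k > 1\<close> the point \<open>z = -1 / \<eta> k\<close> is greater than \<open>-1\<close>, where the generating function is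
positive; but the factor with index \<open>k\<close> vanishes there.\<close>

lemma \<eta>_le_1: "k \<in> J \<Longrightarrow> \<eta> k \<le> 1"
proof (rule ccontr)
  assume k: "k \<in> J" "\<not> \<eta> k \<le> 1"
  let ?z = "- (1 / \<eta> k)"
  have "\<forall>\<^sub>F N in sequentially. (\<Prod>t\<in>J \<inter> {..<N}. 1 + ?z * \<eta> t) = 0"
  proof (rule eventually_sequentiallyI[of "Suc k"])
    fix N assume "Suc k \<le> N"
    then show "(\<Prod>t\<in>J \<inter> {..<N}. 1 + ?z * \<eta> t) = 0"
      using k by (intro prod_zero) auto
  qed
  then have "(\<lambda>N. \<Prod>t\<in>J \<inter> {..<N}. 1 + ?z * \<eta> t) \<longlonglongrightarrow> 0" by (rule tendsto_eventually)
  then have "expectation (\<lambda>\<omega>. (1 + ?z) ^ pts \<omega>) = 0"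
    by (rule LIMSEQ_unique[OF generating_function(2)])
  then show False using generating_function_pos[of ?z] k by simp
qed

lemma weight_le_1: "weight k \<le> 1"
  using \<eta>_le_1 by (auto simp: weight_def)

definition eigen_var :: real where "eigen_var = (\<Sum>\<^sub>\<infinity>k\<in>J. \<eta> k * (1 - \<eta> k))"

lemma eigen_var_sums: "(\<lambda>k. weight k * (1 - weight k)) sums eigen_var"
proof -
  have nn: "0 \<le> weight k * (1 - weight k)" for k using weight_nonneg weight_le_1 by simp
  have "summable (\<lambda>k. weight k * (1 - weight k))"
    by (rule summable_comparison_test'[OF summable_weight, of 0])
       (use nn weight_nonneg in \<open>auto simp: abs_of_nonneg algebra_simps\<close>)
  then have "(\<lambda>k. weight k * (1 - weight k)) summable_on UNIV"
    using nn by (subst summable_on_UNIV_nonneg_real_iff)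
  then have "(\<lambda>k. \<eta> k * (1 - \<eta> k)) summable_on J"
    by (subst summable_on_cong_neutral[where T = UNIV and g = "\<lambda>k. weight k * (1 - weight k)"])
       (auto simp: weight_def)
  moreover have "(if k \<in> J then \<eta> k * (1 - \<eta> k) else 0) = weight k * (1 - weight k)" for k
    by (simp add: weight_def)
  ultimately show ?thesis
    using summable_on_nonneg_sums[of "\<lambda>k. \<eta> k * (1 - \<eta> k)" J] by (simp add: eigen_var_def)
qed

lemma expectation_pts: "integrable P (\<lambda>\<omega>. real (pts \<omega>))" "expectation (\<lambda>\<omega>. real (pts \<omega>)) = eigen_sum"
proof -
  show "integrable P (\<lambda>\<omega>. real (pts \<omega>))" using factorial_moment_limit(1)[of 1] by simp
  have "(\<lambda>N. \<Sum>k<N. weight k) \<longlonglongrightarrow> fmoment 1"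
    using factorial_moment_limit(2)[of 1] by (simp add: esym_1 sum_weight[of "\<lambda>x. x", simplified] del: One_nat_def)
  moreover have "(\<lambda>N. \<Sum>k<N. weight k) \<longlonglongrightarrow> eigen_sum"
    unfolding eigen_sum_def by (rule summable_LIMSEQ[OF summable_weight])
  ultimately have "fmoment 1 = eigen_sum" by (rule LIMSEQ_unique)
  then show "expectation (\<lambda>\<omega>. real (pts \<omega>)) = eigen_sum" by (simp add: fmoment_def)
qed

lemma variance_pts: "variance (\<lambda>\<omega>. real (pts \<omega>)) = eigen_var"
proof -
  have sq: "(real (pts \<omega>))\<^sup>2 = 2 * real (pts \<omega> choose 2) + real (pts \<omega>)" for \<omega>
  proof -
    have "even (pts \<omega> * (pts \<omega> - 1))" by (cases "pts \<omega>") auto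
    then have "2 * (pts \<omega> choose 2) = pts \<omega> * (pts \<omega> - 1)"
      by (simp add: choose_two)
    then have "real (2 * (pts \<omega> choose 2)) = real (pts \<omega> * (pts \<omega> - 1))" by (simp only:)
    then show ?thesis by (cases "pts \<omega>") (auto simp: power2_eq_square algebra_simps)
  qed
  have sq_int: "integrable P (\<lambda>\<omega>. (real (pts \<omega>))\<^sup>2)"
    unfolding sq by (intro Bochner_Integration.integrable_add integrable_mult_right factorial_moment_limit(1) expectation_pts(1))
  have "expectation (\<lambda>\<omega>. (real (pts \<omega>))\<^sup>2) = 2 * fmoment 2 + eigen_sum"
    unfolding sq using factorial_moment_limit(1)[of 2] expectation_pts by (simp add: fmoment_def)
  then have V: "variance (\<lambda>\<omega>. real (pts \<omega>)) = 2 * fmoment 2 + eigen_sum - eigen_sum\<^sup>2"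
    using variance_eq[OF expectation_pts(1) sq_int] expectation_pts(2) by simp
  have tot: "(\<lambda>N. \<Sum>k<N. weight k) \<longlonglongrightarrow> eigen_sum"
    unfolding eigen_sum_def by (rule summable_LIMSEQ[OF summable_weight])
  have "(\<lambda>N. (\<Sum>k<N. weight k)\<^sup>2 - 2 * esym \<eta> (J \<inter> {..<N}) 2) \<longlonglongrightarrow> eigen_sum\<^sup>2 - 2 * fmoment 2"
    by (intro tendsto_intros tot factorial_moment_limit(2))
  moreover have "(\<Sum>k<N. weight k)\<^sup>2 - 2 * esym \<eta> (J \<inter> {..<N}) 2 = (\<Sum>k<N. (weight k)\<^sup>2)" for N
    using esym_2[of "J \<inter> {..<N}" \<eta>]
    by (simp add: sum_weight[of "\<lambda>x. x", simplified] sum_weight[of "\<lambda>x. x\<^sup>2", simplified])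
  ultimately have "(\<lambda>N. (\<Sum>k<N. weight k) - (\<Sum>k<N. (weight k)\<^sup>2)) \<longlonglongrightarrow> eigen_sum - (eigen_sum\<^sup>2 - 2 * fmoment 2)"
    using tendsto_diff[OF tot] by simp
  moreover have "(\<lambda>N. (\<Sum>k<N. weight k) - (\<Sum>k<N. (weight k)\<^sup>2)) \<longlonglongrightarrow> eigen_var"
    using eigen_var_sums unfolding sums_def by (simp add: sum_subtractf[symmetric] power2_eq_square algebra_simps)
  ultimately have "eigen_var = eigen_sum - (eigen_sum\<^sup>2 - 2 * fmoment 2)" by (rule LIMSEQ_unique[rotated])
  then show ?thesis using V by simp
qed

lemma exp_pts: "exp (t * real (pts \<omega>)) = (1 + (exp t - 1)) ^ pts \<omega>"
  by (simp add: exp_of_nat2_mult)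

lemma exp_moment_integrable: "integrable P (\<lambda>\<omega>. exp (t * real (pts \<omega>)))"
  unfolding exp_pts by (rule generating_function(1))

text \<open>The moment generating function is the limit of products of those of centred Bernoulli variables. The
bounds of \<open>bernoulli_cgf_bounds\<close> add up in the exponent, and the sum of the variances
\<open>\<eta> k (1 - \<eta> k)\<close> is the variance of the count.\<close>

theorem centered_mgf_bounds:
  shows "exp (eigen_var * (t\<^sup>2 / 2) * exp (- \<bar>t\<bar>)) \<le> expectation (\<lambda>\<omega>. exp (t * (real (pts \<omega>) - eigen_sum)))"
    and "expectation (\<lambda>\<omega>. exp (t * (real (pts \<omega>) - eigen_sum))) \<le> exp (eigen_var * (t\<^sup>2 / 2) * exp \<bar>t\<bar>)"
proof -
  define g where "g k = ln (1 + weight k * (exp t - 1)) - t * weight k" for k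
  have pos: "0 < 1 + weight k * (exp t - 1)" for k
  proof -
    have "1 + weight k * (exp t - 1) = (1 - weight k) + weight k * exp t" by (simp add: algebra_simps)
    moreover have "0 \<le> 1 - weight k" "0 \<le> weight k * exp t" using weight_nonneg weight_le_1 by auto
    moreover have "weight k * exp t \<noteq> 0 \<or> 1 - weight k \<noteq> 0" by auto
    ultimately show ?thesis by linarith
  qed
  have prod: "(\<Prod>k\<in>J \<inter> {..<N}. 1 + (exp t - 1) * \<eta> k) * exp (- (t * (\<Sum>k<N. weight k))) = exp (\<Sum>k<N. g k)" for N
  proof -
    have "(\<Prod>k\<in>J \<inter> {..<N}. 1 + (exp t - 1) * \<eta> k) = (\<Prod>k<N. 1 + weight k * (exp t - 1))"
      unfolding Int_commute[of J] by (subst prod.inter_restrict) (auto simp: weight_def mult.commute intro!: prod.cong)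
    also have "\<dots> = exp (\<Sum>k<N. ln (1 + weight k * (exp t - 1)))"
      using pos by (simp add: exp_sum)
    finally show ?thesis
      by (simp add: g_def sum_subtractf sum_distrib_left flip: exp_add)
  qed
  have "expectation (\<lambda>\<omega>. exp (t * (real (pts \<omega>) - eigen_sum))) = exp (- (t * eigen_sum)) * expectation (\<lambda>\<omega>. exp (t * real (pts \<omega>)))"
    by (simp add: right_diff_distrib exp_diff exp_minus divide_inverse mult.commute)
  moreover have "(\<lambda>N. (\<Prod>k\<in>J \<inter> {..<N}. 1 + (exp t - 1) * \<eta> k) * exp (- (t * (\<Sum>k<N. weight k))))
      \<longlonglongrightarrow> expectation (\<lambda>\<omega>. exp (t * real (pts \<omega>))) * exp (- (t * eigen_sum))"
    unfolding exp_pts eigen_sum_def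
    by (intro tendsto_mult tendsto_exp tendsto_minus tendsto_const generating_function(2) summable_LIMSEQ summable_weight)
  ultimately have lim: "(\<lambda>N. exp (\<Sum>k<N. g k)) \<longlonglongrightarrow> expectation (\<lambda>\<omega>. exp (t * (real (pts \<omega>) - eigen_sum)))"
    unfolding prod by (simp add: mult.commute)
  have V: "(\<lambda>N. exp ((\<Sum>k<N. weight k * (1 - weight k)) * (t\<^sup>2 / 2) * c)) \<longlonglongrightarrow> exp (eigen_var * (t\<^sup>2 / 2) * c)" for c
    using eigen_var_sums unfolding sums_def by (intro tendsto_exp tendsto_mult tendsto_const)
  note g = bernoulli_cgf_bounds[OF weight_nonneg weight_le_1, of _ t, folded g_def]
  have lo: "exp ((\<Sum>k<N. weight k * (1 - weight k)) * (t\<^sup>2 / 2) * exp (- \<bar>t\<bar>)) \<le> exp (\<Sum>k<N. g k)" for N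
    unfolding exp_le_cancel_iff sum_distrib_right by (intro sum_mono g(1))
  have hi: "exp (\<Sum>k<N. g k) \<le> exp ((\<Sum>k<N. weight k * (1 - weight k)) * (t\<^sup>2 / 2) * exp \<bar>t\<bar>)" for N
    unfolding exp_le_cancel_iff sum_distrib_right by (intro sum_mono g(2))
  show "exp (eigen_var * (t\<^sup>2 / 2) * exp (- \<bar>t\<bar>)) \<le> expectation (\<lambda>\<omega>. exp (t * (real (pts \<omega>) - eigen_sum)))"
    by (rule LIMSEQ_le[OF V lim]) (use lo in auto)
  show "expectation (\<lambda>\<omega>. exp (t * (real (pts \<omega>) - eigen_sum))) \<le> exp (eigen_var * (t\<^sup>2 / 2) * exp \<bar>t\<bar>)"
    by (rule LIMSEQ_le[OF lim V]) (use hi in auto)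
qed

lemma eigen_var_nonneg: "0 \<le> eigen_var"
  using suminf_nonneg[OF sums_summable[OF eigen_var_sums]] weight_nonneg weight_le_1
  unfolding sums_unique[OF eigen_var_sums, symmetric] by simp

lemma num_points_measurable: "num_points X D \<in> borel_measurable P"
  using pts_function_measurable[of real] by (rule measurable_cong[THEN iffD1, rotated]) (simp add: num_points_eq)

lemma expectation_num_points: "expectation (num_points X D) = eigen_sum"
  using expectation_pts(2) by (subst Bochner_Integration.integral_cong[OF refl num_points_eq]) auto

lemma variance_num_points: "variance (num_points X D) = eigen_var"
  unfolding expectation_num_points using variance_pts[unfolded expectation_pts(2)]
  by (subst Bochner_Integration.integral_cong[OF refl, where g = "\<lambda>\<omega>. (real (pts \<omega>) - eigen_sum)\<^sup>2"])
     (auto simp: num_points_eq)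

lemma num_points_mgf:
  shows "integrable P (\<lambda>\<omega>. exp (t * (num_points X D \<omega> - eigen_sum)))"
    and "exp (eigen_var * (t\<^sup>2 / 2) * exp (- \<bar>t\<bar>)) \<le> expectation (\<lambda>\<omega>. exp (t * (num_points X D \<omega> - eigen_sum)))"
    and "expectation (\<lambda>\<omega>. exp (t * (num_points X D \<omega> - eigen_sum))) \<le> exp (eigen_var * (t\<^sup>2 / 2) * exp \<bar>t\<bar>)"
proof -
  have eq: "exp (t * (num_points X D \<omega> - eigen_sum)) = exp (t * (real (pts \<omega>) - eigen_sum))" if "\<omega> \<in> space P" for \<omega>
    by (simp add: num_points_eq that)
  have "integrable P (\<lambda>\<omega>. exp (t * real (pts \<omega>)) * exp (- (t * eigen_sum)))"
    by (rule integrable_mult_left) (rule exp_moment_integrable)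
  then have "integrable P (\<lambda>\<omega>. exp (t * (real (pts \<omega>) - eigen_sum)))"
    by (simp add: algebra_simps flip: exp_add)
  then show "integrable P (\<lambda>\<omega>. exp (t * (num_points X D \<omega> - eigen_sum)))"
    by (subst Bochner_Integration.integrable_cong[OF refl eq])
  have E: "expectation (\<lambda>\<omega>. exp (t * (num_points X D \<omega> - eigen_sum)))
     = expectation (\<lambda>\<omega>. exp (t * (real (pts \<omega>) - eigen_sum)))"
    by (rule Bochner_Integration.integral_cong[OF refl eq])
  show "exp (eigen_var * (t\<^sup>2 / 2) * exp (- \<bar>t\<bar>)) \<le> expectation (\<lambda>\<omega>. exp (t * (num_points X D \<omega> - eigen_sum)))"
    and "expectation (\<lambda>\<omega>. exp (t * (num_points X D \<omega> - eigen_sum))) \<le> exp (eigen_var * (t\<^sup>2 / 2) * exp \<bar>t\<bar>)"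
    unfolding E by (rule centered_mgf_bounds)+
qed

end

section \<open>Moderate deviations\<close>

theorem theorem1p4:
  fixes \<mu> :: "'a::polish_space measure"
    and P :: "nat \<Rightarrow> 'w measure"
    and X :: "nat \<Rightarrow> 'w \<Rightarrow> 'a measure"
    and K :: "nat \<Rightarrow> 'a \<Rightarrow> 'a \<Rightarrow> complex"
    and D :: "nat \<Rightarrow> 'a set"
    and J :: "nat \<Rightarrow> nat set"
    and \<eta> :: "nat \<Rightarrow> nat \<Rightarrow> real"
    and \<phi> :: "nat \<Rightarrow> nat \<Rightarrow> 'a \<Rightarrow> complex"
    and a :: "nat \<Rightarrow> real"
  assumes "locally_compact_space (euclidean :: 'a topology)"
    and "radon_measure \<mu>"
    and "\<And>n. determinantal_process (P n) (X n) \<mu> (K n)"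
    and "\<And>n. good_kernel \<mu> (K n)"
    and "\<And>n. D n \<in> sets borel"
    and "\<And>n. trace_class \<mu> (cut_kernel (D n) (K n))"
    and "\<And>n. eigen_decomposition \<mu> (cut_kernel (D n) (K n)) (J n) (\<eta> n) (\<phi> n)"
    and "(\<lambda>n. 1) \<lless> a"
    and "a \<lless> (\<lambda>n. sqrt (\<Sum>\<^sub>\<infinity>k\<in>J n. \<eta> n k * (1 - \<eta> n k)))"
  shows "satisfies_LDP P
           (\<lambda>n \<omega>. 1 / a n *
              ((num_points (X n) (D n) \<omega> - prob_space.expectation (P n) (num_points (X n) (D n)))
                / sqrt (prob_space.variance (P n) (num_points (X n) (D n)))))
           (\<lambda>n. (a n)\<^sup>2) (\<lambda>x. x\<^sup>2 / 2)"
proof -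
  have sf: "sigma_finite_measure \<mu>" by (rule radon_sigma_finite[OF assms(1,2)])
  interpret c: determinantal_count \<mu> "P n" "X n" "K n" "D n" "J n" "\<eta> n" "\<phi> n" for n
    by (intro determinantal_count.intro assms(2,3,5-7) sf assms(4)[unfolded good_kernel_def, THEN conjunct1])
  define m where "m n = determinantal_count.eigen_sum (J n) (\<eta> n)" for n
  define V where "V n = determinantal_count.eigen_var (J n) (\<eta> n)" for n
  note E = c.expectation_num_points[folded m_def] and Var = c.variance_num_points[folded V_def]
    and mgf = c.num_points_mgf[folded m_def V_def]
  define Z where "Z n \<omega> = 1 / a n * ((num_points (X n) (D n) \<omega> - m n) / sqrt (V n))" for n \<omega>
  have Z_eq: "l * Z n \<omega> = l / (a n * sqrt (V n)) * (num_points (X n) (D n) \<omega> - m n)" for l n \<omega>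
    by (simp add: Z_def divide_inverse)
  have a_ne: "\<forall>\<^sub>F n in sequentially. a n \<noteq> 0" and a_lim: "(\<lambda>n. 1 / a n) \<longlonglongrightarrow> 0"
    using assms(8) by (auto simp: much_less_def)
  have V_ne: "\<forall>\<^sub>F n in sequentially. sqrt (V n) \<noteq> 0" and V_lim: "(\<lambda>n. a n / sqrt (V n)) \<longlonglongrightarrow> 0"
    using assms(9) by (simp_all add: much_less_def V_def c.eigen_var_def)
  have "gaussian_cgf_limit P Z (\<lambda>n. (a n)\<^sup>2)"
  proof (rule gaussian_cgf_limit.intro)
    show "prob_space (P n)" for n by (rule c.prob_space_axioms)
    show "Z n \<in> borel_measurable (P n)" for n
      unfolding Z_def using c.num_points_measurable[of n] by measurable
    show "filterlim (\<lambda>n. (a n)\<^sup>2) at_top sequentially"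
    proof -
      have "(\<lambda>n. (1 / a n)\<^sup>2) \<longlonglongrightarrow> 0" using tendsto_power[OF a_lim, of 2] by simp
      moreover have "\<forall>\<^sub>F n in sequentially. 0 < (1 / a n)\<^sup>2" using a_ne by eventually_elim simp
      ultimately have "filterlim (\<lambda>n. inverse ((1 / a n)\<^sup>2)) at_top sequentially"
        by (rule filterlim_inverse_at_top)
      then show ?thesis by (simp add: power_one_over divide_inverse power_inverse)
    qed
    show "integrable (P n) (\<lambda>\<omega>. exp (l * Z n \<omega>))" for n l
      unfolding Z_eq by (rule mgf(1))
    show "(\<lambda>n. ln (LINT \<omega>|P n. exp ((a n)\<^sup>2 * l * Z n \<omega>)) / (a n)\<^sup>2) \<longlonglongrightarrow> l\<^sup>2 / 2" for l
    proof -
      \<comment> \<open>the exponent at which the moment generating function of the centred count is taken; it tends to \<open>0\<close> because \<open>a \<lless> sqrt V\<close>\<close>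
      define t where "t n = l * (a n / sqrt (V n))" for n
      have t_lim: "t \<longlonglongrightarrow> 0" unfolding t_def using tendsto_mult[OF tendsto_const V_lim, of l] by simp
      have bounds: "\<forall>\<^sub>F n in sequentially.
          l\<^sup>2 / 2 * exp (- \<bar>t n\<bar>) \<le> ln (LINT \<omega>|P n. exp ((a n)\<^sup>2 * l * Z n \<omega>)) / (a n)\<^sup>2 \<and>
          ln (LINT \<omega>|P n. exp ((a n)\<^sup>2 * l * Z n \<omega>)) / (a n)\<^sup>2 \<le> l\<^sup>2 / 2 * exp \<bar>t n\<bar>"
        using a_ne V_ne
      proof eventually_elim
        case (elim n)
        have V: "0 < V n" using elim(2) c.eigen_var_nonneg[of n, folded V_def] by (simp add: less_le)
        have a: "0 < (a n)\<^sup>2" using elim(1) by simp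
        have "(a n)\<^sup>2 * l / (a n * sqrt (V n)) = t n"
          using elim by (simp add: t_def power2_eq_square)
        then have mgf_eq: "(LINT \<omega>|P n. exp ((a n)\<^sup>2 * l * Z n \<omega>))
            = (LINT \<omega>|P n. exp (t n * (num_points (X n) (D n) \<omega> - m n)))"
          unfolding Z_eq by simp
        have Vt: "V n * ((t n)\<^sup>2 / 2) = (a n)\<^sup>2 * (l\<^sup>2 / 2)"
          using V by (simp add: t_def power_mult_distrib power_divide)
        let ?E = "LINT \<omega>|P n. exp (t n * (num_points (X n) (D n) \<omega> - m n))"
        note b = mgf(2,3)[of n "t n", unfolded Vt]
        have E_pos: "0 < ?E" by (rule less_le_trans[OF _ b(1)]) simp
        have "(a n)\<^sup>2 * (l\<^sup>2 / 2) * exp (- \<bar>t n\<bar>) \<le> ln ?E"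
          using ln_ge_iff[OF E_pos] b(1) by blast
        moreover have "ln ?E \<le> (a n)\<^sup>2 * (l\<^sup>2 / 2) * exp \<bar>t n\<bar>"
          using ln_mono[OF b(2) E_pos] by (simp only: ln_exp)
        ultimately show ?case
          unfolding mgf_eq using a by (simp add: pos_le_divide_eq pos_divide_le_eq mult_ac)
      qed
      have "(\<lambda>n. l\<^sup>2 / 2 * exp (- \<bar>t n\<bar>)) \<longlonglongrightarrow> l\<^sup>2 / 2 * exp (- \<bar>0\<bar>)"
        and "(\<lambda>n. l\<^sup>2 / 2 * exp \<bar>t n\<bar>) \<longlonglongrightarrow> l\<^sup>2 / 2 * exp \<bar>0\<bar>"
        by (intro tendsto_mult tendsto_exp tendsto_minus tendsto_rabs tendsto_const t_lim)+
      then have lims: "(\<lambda>n. l\<^sup>2 / 2 * exp (- \<bar>t n\<bar>)) \<longlonglongrightarrow> l\<^sup>2 / 2"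
        "(\<lambda>n. l\<^sup>2 / 2 * exp \<bar>t n\<bar>) \<longlonglongrightarrow> l\<^sup>2 / 2" by simp_all
      show ?thesis
        by (rule tendsto_sandwich[OF _ _ lims]) (use bounds in \<open>auto elim: eventually_mono\<close>)
    qed
  qed
  from gaussian_cgf_limit.satisfies_LDP_gaussian[OF this] show ?thesis
    unfolding Z_def E Var[unfolded E] .
qed

end
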